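(* Let $\alpha\in\mathbb{R}$, let $q_0\in L^2(0,\pi)$ be a given potential and let $k\ge 1$ be an integer. Then: $(1^o)$ For any $\lambda\in\mathbb{R}$ there exists a solution $\hat q$ of the inverse optimization spectral problem $P(k)$, i.e. there exists $\hat q\in L^2(0,\pi)$ such that $\lambda_k(\hat q)=\lambda$ and $$\|q_0-\hat q\|_{L^2}=\inf\{\|q_0-q\|_{L^2}:\ q\in L^2(0,\pi),\ \lambda_k(q)=\lambda\}.$$ Furthermore, $(2^o)$ for $\lambda<\lambda_k(q_0)$ there exists a non-zero weak solution $\hat u_\delta$ of problem $(NP_\delta)$ with $\delta=1$, and for $\lambda>\lambda_k(q_0)$ there exists a non-zero weak solution $\hat u_\delta$ of problem $(NP_\delta)$ with $\delta=-1$, so that in each case the following explicit formula holds: $$\hat q=q_0-\delta\,\hat u_\delta^2\quad\text{a.e. in }(0,\pi).$$ $(3^o)$ The solution $\hat u_\delta$ of $(NP_\delta)$, $\delta=\pm1$, possesses precisely $k-1$ roots in $(0,\pi)$.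
   Context: $L^2:=L^2(0,\pi)$ is the space of real-valued square-integrable functions, with norm $\|\cdot\|_{L^2}$. Fix $\alpha\in\mathbb{R}$. For $q\in L^2(0,\pi)$, $\mathcal{L}[q]$ denotes the self-adjoint Sturm–Liouville operator on $L^2(0,\pi)$ given by $\mathcal{L}[q]u=-u''+q(x)u$ subject to the separated boundary conditions $$u(0)\cos\alpha+u'(0)\sin\alpha=0,\qquad u(\pi)\cos\alpha+u'(\pi)\sin\alpha=0.$$ Its spectrum is a sequence of simple eigenvalues $\lambda_1(q)<\lambda_2(q)<\cdots$. For $\lambda\in\mathbb{R}$ and $\delta\in\{1,-1\}$, $(NP_\delta)$ denotes the nonlinear boundary value problem $$-u''+q_0(x)u=\lambda u+\delta u^3,\quad x\in(0,\pi),$$ $$u(0)\cos\alpha+u'(0)\sin\alpha=0,\qquad u(\pi)\cos\alpha+u'(\pi)\sin\alpha=0.$$ Weak solutions are understood in the standard sense (equivalently, $u\in W^{2,2}(0,\pi)$ satisfying the equation a.e. and the boundary conditions). *)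

theory Defs
  imports "HOL-Analysis.Analysis"
begin

text \<open>
  Elements of \<open>L\<^sup>2(0,\<pi>)\<close> are represented by functions on the whole real line, of which only the
  restriction to \<open>(0,\<pi>)\<close> matters; all notions below depend on a potential in \<open>L2\<close> only up
  to equality almost everywhere on \<open>(0,\<pi>)\<close>.
\<close>

definition L2 :: "(real \<Rightarrow> real) set" where
  "L2 = {f. f \<in> borel_measurable (lebesgue_on {0<..<pi}) \<and>
            integrable (lebesgue_on {0<..<pi}) (\<lambda>x. (f x)\<^sup>2)}"

definition L2_norm :: "(real \<Rightarrow> real) \<Rightarrow> real" where
  "L2_norm f = sqrt (LINT x|lebesgue_on {0<..<pi}. (f x)\<^sup>2)"

text \<open>
  \<open>W22 u u' u''\<close>: the function \<open>u\<close> is the \<open>C\<^sup>1([0,\<pi>])\<close> representative of an element of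
  \<open>W\<^sup>2\<^sup>,\<^sup>2(0,\<pi>)\<close>, its derivative \<open>u'\<close> is absolutely continuous on \<open>[0,\<pi>]\<close>, and \<open>u''\<close>
  (unique up to a null set) is the density of \<open>u'\<close>, i.e. the weak second derivative of \<open>u\<close>.
  Boundary values are those of this representative.
\<close>

definition W22 :: "(real \<Rightarrow> real) \<Rightarrow> (real \<Rightarrow> real) \<Rightarrow> (real \<Rightarrow> real) \<Rightarrow> bool" where
  "W22 u u' u'' \<longleftrightarrow>
     (\<forall>x\<in>{0..pi}. (u has_real_derivative u' x) (at x within {0..pi})) \<and>
     u'' \<in> L2 \<and>
     (\<forall>x\<in>{0..pi}. u' x = u' 0 + (LINT t|lebesgue_on {0..x}. u'' t))"

definition separated_bc :: "real \<Rightarrow> (real \<Rightarrow> real) \<Rightarrow> (real \<Rightarrow> real) \<Rightarrow> bool" where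
  "separated_bc \<alpha> u u' \<longleftrightarrow>
     u 0 * cos \<alpha> + u' 0 * sin \<alpha> = 0 \<and> u pi * cos \<alpha> + u' pi * sin \<alpha> = 0"

text \<open>
  Since \<open>u\<close> is continuous on \<open>[0,\<pi>]\<close>, being non-zero at some point of \<open>[0,\<pi>]\<close> is the same as
  being non-zero as an element of \<open>L\<^sup>2(0,\<pi>)\<close>.
\<close>

definition nonzero :: "(real \<Rightarrow> real) \<Rightarrow> bool" where
  "nonzero u \<longleftrightarrow> (\<exists>x\<in>{0..pi}. u x \<noteq> 0)"

text \<open>
  For \<open>q \<in> L2\<close> and \<open>W22 u u' u''\<close> the function \<open>- u'' + q u\<close> is automatically in \<open>L\<^sup>2(0,\<pi>)\<close>, so
  the domain of the operator consists of all \<open>W\<^sup>2\<^sup>,\<^sup>2\<close> functions satisfying the boundary conditions.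
\<close>

definition SL_eigenfunction ::
    "real \<Rightarrow> (real \<Rightarrow> real) \<Rightarrow> real \<Rightarrow> (real \<Rightarrow> real) \<Rightarrow> bool" where
  "SL_eigenfunction \<alpha> q lam u \<longleftrightarrow> nonzero u \<and>
     (\<exists>u' u''. W22 u u' u'' \<and> separated_bc \<alpha> u u' \<and>
        (AE x in lebesgue_on {0<..<pi}. - u'' x + q x * u x = lam * u x))"

definition SL_eigenvalues :: "real \<Rightarrow> (real \<Rightarrow> real) \<Rightarrow> real set" where
  "SL_eigenvalues \<alpha> q = {lam. \<exists>u. SL_eigenfunction \<alpha> q lam u}"

text \<open>
  The eigenvalues are simple and form a sequence \<open>\<lambda>\<^sub>1 < \<lambda>\<^sub>2 < \<dots>\<close>, so the \<open>k\<close>-th one (\<open>k \<ge> 1\<close>)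
  is the eigenvalue below which there are exactly \<open>k - 1\<close> eigenvalues.
\<close>

definition SL_eigenvalue :: "real \<Rightarrow> nat \<Rightarrow> (real \<Rightarrow> real) \<Rightarrow> real" where
  "SL_eigenvalue \<alpha> k q =
     (THE lam. lam \<in> SL_eigenvalues \<alpha> q \<and>
        finite {\<mu> \<in> SL_eigenvalues \<alpha> q. \<mu> < lam} \<and>
        card {\<mu> \<in> SL_eigenvalues \<alpha> q. \<mu> < lam} = k - 1)"

definition inverse_opt_solution ::
    "real \<Rightarrow> nat \<Rightarrow> (real \<Rightarrow> real) \<Rightarrow> real \<Rightarrow> (real \<Rightarrow> real) \<Rightarrow> bool" where
  "inverse_opt_solution \<alpha> k q0 lam qh \<longleftrightarrow>
     qh \<in> L2 \<and> SL_eigenvalue \<alpha> k qh = lam \<and>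
     L2_norm (\<lambda>x. q0 x - qh x) =
       Inf {L2_norm (\<lambda>x. q0 x - q x) |q. q \<in> L2 \<and> SL_eigenvalue \<alpha> k q = lam}"

definition NP_solution ::
    "real \<Rightarrow> (real \<Rightarrow> real) \<Rightarrow> real \<Rightarrow> real \<Rightarrow> (real \<Rightarrow> real) \<Rightarrow> bool" where
  "NP_solution \<alpha> q0 lam \<delta> u \<longleftrightarrow>
     (\<exists>u' u''. W22 u u' u'' \<and> separated_bc \<alpha> u u' \<and>
        (AE x in lebesgue_on {0<..<pi}. - u'' x + q0 x * u x = lam * u x + \<delta> * (u x) ^ 3))"

end

(*
  With m the mean of q, P(x) the integral of m - q over (0,x) and v = u' + P u, the equation
  -u'' + q u = lam u becomes the system u' = v - P u, v' = P v - (P^2 + c) u, c = lam - m, whose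
  coefficients are continuous; P vanishes at 0 and pi, so the boundary conditions keep their form.
  Its Pruefer angle solves theta' = (cos theta - P sin theta)^2 + c (sin theta)^2. It crosses multiples
  of pi only upwards, and its value at pi is strictly increasing and onto in c, so the k-th eigenvalue
  is m + c_k(P), where theta first makes k - 1 half-turns beyond the initial direction. Since c_k is
  continuous in P for the uniform norm, it is weakly continuous in q, and minimizers exist by
  compactness. The derivative of the k-th eigenvalue in direction h is the integral of h u^2 divided by
  that of u^2, where u is the k-th eigenfunction. Hence q0 - qh, for a minimizer qh, has no component
  orthogonal to u^2, i.e. q0 - qh = c u^2; the sign of c follows from monotonicity of the eigenvalue
  along the segment from qh to q0, and the solution of the nonlinear problem is a multiple of u.
*)

theory Submission
  imports Defs "HOL-Complex_Analysis.Great_Picard"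
begin

section \<open>Ordinary differential equations and comparison\<close>

text \<open>The obstacle is that \<open>q\<close> is merely square integrable, so \<open>u''\<close>
  need not be continuous. Trading the potential for its primitive lets the spectral theory run on
  classical \<open>C^1\<close> solutions, and makes an eigenvalue depend on \<open>q\<close> only
  through its mean and a primitive. This pays off twice. Uniform convergence of primitives suffices
  to pass to the limit in the constraint; and the eigenvalue derivative comes from a Green identity
  in \<open>P\<close>, with one integration by parts at the end to return to \<open>h\<close>.
  Compactness is therefore phrased for primitives: bounded square norms make them equi-Hoelder,
  Arzela-Ascoli gives a uniform limit, and what remains is that this limit is again the primitive of
  a function of no larger norm. The constraint is nonlinear, but adding a constant to
  \<open>q\<close> shifts every eigenvalue by that constant. So any perturbation is brought back to
  the constraint by an explicit constant; this shows that admissible potentials exist and takes the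
  place of a multiplier rule in the first variation.\<close>

lemma uniform_limit_indefinite_integral:
  fixes f :: "'i \<Rightarrow> real \<Rightarrow> real"
  assumes lim: "uniform_limit {a..b} f g F"
    and cf: "\<And>n. continuous_on {a..b} (f n)" and cg: "continuous_on {a..b} g"
  shows "uniform_limit {a..b} (\<lambda>n x. integral {a..x} (f n)) (\<lambda>x. integral {a..x} g) F"
proof (rule uniform_limitI)
  fix e :: real assume e: "e > 0"
  define r where "r = e / (\<bar>b - a\<bar> + 1)"
  have r: "r > 0" using e by (simp add: r_def)
  have "\<forall>\<^sub>F n in F. \<forall>x\<in>{a..b}. dist (f n x) (g x) < r"
    using uniform_limitD[OF lim r] .
  then show "\<forall>\<^sub>F n in F. \<forall>x\<in>{a..b}. dist (integral {a..x} (f n)) (integral {a..x} g) < e"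
  proof eventually_elim
    case (elim n)
    show ?case
    proof
      fix x assume x: "x \<in> {a..b}"
      have sub: "{a..x} \<subseteq> {a..b}" using x by auto
      have i1: "f n integrable_on {a..x}" "g integrable_on {a..x}"
        using continuous_on_subset[OF cf sub] continuous_on_subset[OF cg sub]
        by (auto intro: integrable_continuous_real)
      have "norm (integral {a..x} (\<lambda>s. f n s - g s)) \<le> integral {a..x} (\<lambda>s. r)"
        by (rule integral_norm_bound_integral)
          (use elim sub i1 in \<open>auto intro!: integrable_diff simp: dist_norm intro: less_imp_le\<close>)
      also have "\<dots> = r * (x - a)" using x by simp
      also have "\<dots> \<le> r * \<bar>b - a\<bar>" using x r by (intro mult_left_mono) auto
      also have "\<dots> < e"
        unfolding r_def using e by (simp add: divide_simps)
      finally show "dist (integral {a..x} (f n)) (integral {a..x} g) < e"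
        using i1 by (simp add: integral_diff dist_norm)
    qed
  qed
qed

text \<open>Successive approximation from the constant \<open>a\<close>. The factorial in the bound
  \<open>B * (L * x) ^ n / fact n\<close> for the increments gives uniform convergence on all of
  \<open>{0..T}\<close>, however large \<open>L * T\<close> is. Continuity is asked along continuous
  curves, the form in which it enters the integral equation.\<close>

theorem picard_lindelof_real:
  fixes f :: "real \<Rightarrow> real \<Rightarrow> real"
  assumes T: "0 \<le> T" and L: "0 \<le> L"
    and cont: "\<And>y. continuous_on {0..T} y \<Longrightarrow> continuous_on {0..T} (\<lambda>s. f s (y s))"
    and lip: "\<And>s y z. s \<in> {0..T} \<Longrightarrow> \<bar>f s y - f s z\<bar> \<le> L * \<bar>y - z\<bar>"
  obtains y where "y 0 = a"
    "\<And>x. x \<in> {0..T} \<Longrightarrow> (y has_real_derivative f x (y x)) (at x within {0..T})"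
proof -
  define Y where "Y = rec_nat (\<lambda>x::real. a) (\<lambda>_ y x. a + integral {0..x} (\<lambda>s. f s (y s)))"
  have Y0: "Y 0 = (\<lambda>x. a)" and YS: "Y (Suc n) = (\<lambda>x. a + integral {0..x} (\<lambda>s. f s (Y n s)))" for n
    by (simp_all add: Y_def)
  have cY: "continuous_on {0..T} (Y n)" for n
    by (induction n)
      (auto simp: Y0 YS intro!: continuous_intros indefinite_integral_continuous_1
        integrable_continuous_real cont)
  have cfY: "continuous_on {0..T} (\<lambda>s. f s (Y n s))" for n
    by (rule cont[OF cY])
  have "compact ((\<lambda>x. Y 1 x - Y 0 x) ` {0..T})"
    using cY by (intro compact_continuous_image continuous_intros) auto
  then obtain B where B: "\<And>x. x \<in> {0..T} \<Longrightarrow> \<bar>Y 1 x - Y 0 x\<bar> \<le> B"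
    by (force dest!: compact_imp_bounded simp: bounded_iff)
  have bound: "\<bar>Y (Suc n) x - Y n x\<bar> \<le> B * (L * x) ^ n / fact n" if "x \<in> {0..T}" for n x
    using that
  proof (induction n arbitrary: x)
    case 0 then show ?case using B by simp
  next
    case (Suc n)
    have sub: "{0..x} \<subseteq> {0..T}" using Suc.prems by auto
    have i: "(\<lambda>s. f s (Y m s)) integrable_on {0..x}" for m
      using continuous_on_subset[OF cfY sub] by (rule integrable_continuous_real)
    \<comment> \<open>Integrating \<open>L\<close> times the bound for one increment reproduces the
      bound for the next one.\<close>
    have hi: "((\<lambda>s. L * (B * (L * s) ^ n / fact n)) has_integral
        (B * (L * x) ^ Suc n / fact (Suc n) - B * (L * 0) ^ Suc n / fact (Suc n))) {0..x}"
    proof (rule fundamental_theorem_of_calculus)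
      show "0 \<le> x" using Suc.prems by simp
      fix s assume "s \<in> {0..x}"
      have "((\<lambda>s. B * (L * s) ^ Suc n / fact (Suc n)) has_real_derivative
          L * (B * (L * s) ^ n / fact n)) (at s within {0..x})"
        by (rule derivative_eq_intros refl | simp del: of_nat_Suc fact_Suc)+
          (simp add: fact_Suc del: of_nat_Suc)
      then show "((\<lambda>s. B * (L * s) ^ Suc n / fact (Suc n)) has_vector_derivative
          L * (B * (L * s) ^ n / fact n)) (at s within {0..x})"
        by (simp add: has_real_derivative_iff_has_vector_derivative)
    qed
    have "\<bar>Y (Suc (Suc n)) x - Y (Suc n) x\<bar>
        = norm (integral {0..x} (\<lambda>s. f s (Y (Suc n) s) - f s (Y n s)))"
      using integral_diff[OF i i, of "Suc n" n] unfolding YS[of "Suc n"]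
      by (simp only: YS[of n] real_norm_def add_diff_cancel_left)
    also have "\<dots> \<le> integral {0..x} (\<lambda>s. L * (B * (L * s) ^ n / fact n))"
    proof (rule integral_norm_bound_integral)
      show "(\<lambda>s. f s (Y (Suc n) s) - f s (Y n s)) integrable_on {0..x}"
        by (intro integrable_diff i)
      show "(\<lambda>s. L * (B * (L * s) ^ n / fact n)) integrable_on {0..x}" using hi by blast
      fix s assume "s \<in> {0..x}"
      then have s: "s \<in> {0..T}" using sub by auto
      show "norm (f s (Y (Suc n) s) - f s (Y n s)) \<le> L * (B * (L * s) ^ n / fact n)"
        using order_trans[OF lip[OF s] mult_left_mono[OF Suc.IH[OF s] L]] by simp
    qed
    also have "\<dots> = B * (L * x) ^ Suc n / fact (Suc n)"
      using integral_unique[OF hi] by simp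
    finally show ?case .
  qed
  have B0: "0 \<le> B" using B[of 0] T by auto
  have "summable (\<lambda>n. (L * T) ^ n /\<^sub>R fact n)" using summable_exp_generic .
  then have sm: "summable (\<lambda>n. B * (L * T) ^ n / fact n)"
    using summable_mult[of "\<lambda>n. (L * T) ^ n /\<^sub>R fact n" B] by (simp add: field_simps)
  define y where "y x = a + (\<Sum>n. Y (Suc n) x - Y n x)" for x
  have "uniform_limit {0..T} (\<lambda>n x. \<Sum>i<n. Y (Suc i) x - Y i x) (\<lambda>x. \<Sum>i. Y (Suc i) x - Y i x) sequentially"
  proof (rule Weierstrass_m_test[OF _ sm])
    fix n x assume x: "x \<in> {0..T}"
    have "B * (L * x) ^ n / fact n \<le> B * (L * T) ^ n / fact n"
      using x B0 L by (intro divide_right_mono mult_left_mono power_mono) auto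
    then show "norm (Y (Suc n) x - Y n x) \<le> B * (L * T) ^ n / fact n"
      using bound[OF x, of n] by simp
  qed
  then have "uniform_limit {0..T} (\<lambda>n x. a + (\<Sum>i<n. Y (Suc i) x - Y i x)) y sequentially"
    unfolding y_def by (intro uniform_limit_intros)
  moreover have "(\<lambda>n x. a + (\<Sum>i<n. Y (Suc i) x - Y i x)) = Y"
    by (intro ext) (simp add: sum_lessThan_telescope[where f="\<lambda>i. Y i _"] Y0)
  ultimately have ul: "uniform_limit {0..T} Y y sequentially" by simp
  have cy: "continuous_on {0..T} y"
    using uniform_limit_theorem[OF _ ul] cY by simp
  have ulf: "uniform_limit {0..T} (\<lambda>n s. f s (Y n s)) (\<lambda>s. f s (y s)) sequentially"
  proof (rule uniform_limitI)
    fix e :: real assume e: "e > 0"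
    have "\<forall>\<^sub>F n in sequentially. \<forall>x\<in>{0..T}. dist (Y n x) (y x) < e / (L + 1)"
      using e L by (intro uniform_limitD[OF ul]) auto
    then show "\<forall>\<^sub>F n in sequentially. \<forall>x\<in>{0..T}. dist (f x (Y n x)) (f x (y x)) < e"
    proof eventually_elim
      case (elim n)
      show ?case
      proof
        fix x assume x: "x \<in> {0..T}"
        have "\<bar>f x (Y n x) - f x (y x)\<bar> \<le> L * \<bar>Y n x - y x\<bar>" using lip[OF x] .
        also have "\<dots> \<le> L * (e / (L + 1))"
          using elim x L by (intro mult_left_mono) (auto simp: dist_norm intro: less_imp_le)
        also have "\<dots> < e" using e L by (simp add: field_simps)
        finally show "dist (f x (Y n x)) (f x (y x)) < e" by (simp add: dist_norm)
      qed
    qed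
  qed
  have eq: "y x = a + integral {0..x} (\<lambda>s. f s (y s))" if x: "x \<in> {0..T}" for x
  proof (rule LIMSEQ_unique)
    show "(\<lambda>n. Y (Suc n) x) \<longlonglongrightarrow> y x"
      using tendsto_uniform_limitI[OF ul x] by (rule LIMSEQ_Suc)
    show "(\<lambda>n. Y (Suc n) x) \<longlonglongrightarrow> a + integral {0..x} (\<lambda>s. f s (y s))"
      unfolding YS
      using tendsto_uniform_limitI[OF uniform_limit_indefinite_integral[OF ulf cfY cont[OF cy]] x]
      by (intro tendsto_intros)
  qed
  show ?thesis
  proof (rule that)
    show "y 0 = a" using eq[of 0] T by simp
    fix x assume x: "x \<in> {0..T}"
    have "((\<lambda>x. a + integral {0..x} (\<lambda>s. f s (y s))) has_real_derivative f x (y x)) (at x within {0..T})"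
      using integral_has_real_derivative[OF cont[OF cy] x]
      by (auto intro!: derivative_eq_intros)
    then show "(y has_real_derivative f x (y x)) (at x within {0..T})"
      by (rule has_field_derivative_transform_within[OF _ zero_less_one x]) (use eq in auto)
  qed
qed

text \<open>If \<open>d x < 0\<close>, let \<open>s\<close> be the last point before
  \<open>x\<close> with \<open>d s \<ge> 0\<close>. Beyond \<open>s\<close> the function is
  negative, so the hypothesis reads \<open>d' \<ge> L * d\<close> and
  \<open>exp (- L * x) * d x\<close> cannot decrease.\<close>

lemma comparison_nonneg:
  fixes d :: "real \<Rightarrow> real"
  assumes der: "\<And>x. x \<in> {a..b} \<Longrightarrow> (d has_real_derivative d' x) (at x within {a..b})"
    and ge: "\<And>x. x \<in> {a..b} \<Longrightarrow> d' x \<ge> - L * \<bar>d x\<bar>"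
    and "d a \<ge> 0" and x: "x \<in> {a..b}"
  shows "d x \<ge> 0"
proof (rule ccontr)
  assume neg: "\<not> d x \<ge> 0"
  have cd: "continuous_on {a..b} d"
    using der by (intro DERIV_continuous_on) auto
  define S where "S = {a..x} \<inter> d -` {0..}"
  have "closed S"
    unfolding S_def using x
    by (intro continuous_closed_preimage continuous_on_subset[OF cd]) auto
  moreover have "bounded S" unfolding S_def by (rule bounded_subset[of "{a..x}"]) auto
  moreover have "a \<in> S" using assms(3) x by (auto simp: S_def)
  ultimately obtain s where s: "s \<in> S" "\<And>t. t \<in> S \<Longrightarrow> t \<le> s"
    using compact_attains_sup[of S] by (auto simp: compact_eq_bounded_closed)
  have sx: "s < x" and sa: "a \<le> s" and ds: "d s \<ge> 0"
    using s(1) neg by (auto simp: S_def less_le)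
  have below: "d y < 0" if "s < y" "y \<le> x" for y
    using s(2)[of y] that sa by (force simp: S_def)
  have "exp (- L * s) * d s \<le> exp (- L * x) * d x"
  proof (rule DERIV_nonneg_imp_increasing_open[where f = "\<lambda>x. exp (- L * x) * d x"])
    show "s \<le> x" using sx by simp
    show "continuous_on {s..x} (\<lambda>x. exp (- L * x) * d x)"
      using sa x by (intro continuous_intros continuous_on_subset[OF cd]) auto
    fix y assume y: "s < y" "y < x"
    then have y': "y \<in> {a..b}" "y \<in> {a<..<b}" using sa x by auto
    then have "(d has_real_derivative d' y) (at y)"
      using der[OF y'(1)] at_within_Icc_at[of a y b] by simp
    then have "((\<lambda>x. exp (- L * x) * d x) has_real_derivative exp (- L * y) * (d' y - L * d y)) (at y)"
      by (auto intro!: derivative_eq_intros simp: algebra_simps)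
    moreover have "exp (- L * y) * (d' y - L * d y) \<ge> 0"
      using ge[OF y'(1)] below[of y] y by (intro mult_nonneg_nonneg) auto
    ultimately show "\<exists>z. ((\<lambda>x. exp (- L * x) * d x) has_real_derivative z) (at y) \<and> z \<ge> 0" by blast
  qed
  moreover have "exp (- L * x) * d x < 0" using neg by (simp add: mult_pos_neg)
  moreover have "exp (- L * s) * d s \<ge> 0" using ds by simp
  ultimately show False by simp
qed

text \<open>Integrating factor. Read from right to left it is backward uniqueness: a nonnegative
  \<open>d\<close> that vanishes at \<open>y\<close> vanishes at every earlier point.\<close>

lemma exp_weighted_mono:
  fixes d :: "real \<Rightarrow> real"
  assumes der: "\<And>x. x \<in> {a..b} \<Longrightarrow> (d has_real_derivative d' x) (at x within {a..b})"
    and ge: "\<And>x. x \<in> {a..b} \<Longrightarrow> d' x \<ge> - L * d x"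
    and xy: "x \<in> {a..b}" "y \<in> {a..b}" "x \<le> y"
  shows "exp (L * x) * d x \<le> exp (L * y) * d y"
proof (rule DERIV_nonneg_imp_increasing_open[where f = "\<lambda>x. exp (L * x) * d x"])
  have cd: "continuous_on {a..b} d"
    using der by (intro DERIV_continuous_on) auto
  show "x \<le> y" by fact
  show "continuous_on {x..y} (\<lambda>x. exp (L * x) * d x)"
    using xy by (intro continuous_intros continuous_on_subset[OF cd]) auto
  fix z assume z: "x < z" "z < y"
  then have z': "z \<in> {a..b}" "z \<in> {a<..<b}" using xy by auto
  then have "(d has_real_derivative d' z) (at z)"
    using der[OF z'(1)] at_within_Icc_at[of a z b] by simp
  then have "((\<lambda>x. exp (L * x) * d x) has_real_derivative exp (L * z) * (d' z + L * d z)) (at z)"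
    by (auto intro!: derivative_eq_intros simp: algebra_simps)
  moreover have "exp (L * z) * (d' z + L * d z) \<ge> 0"
    using ge[OF z'(1)] by (intro mult_nonneg_nonneg) auto
  ultimately show "\<exists>w. ((\<lambda>x. exp (L * x) * d x) has_real_derivative w) (at z) \<and> w \<ge> 0" by blast
qed

text \<open>The bound solves \<open>z' = L * z + e\<close> with \<open>z 0 = 0\<close>; comparison
  applies to \<open>z - d\<close> and to \<open>z + d\<close>.\<close>

lemma gronwall_abs:
  fixes d :: "real \<Rightarrow> real"
  assumes L: "0 < L" and e: "0 \<le> e"
    and der: "\<And>x. x \<in> {0..b} \<Longrightarrow> (d has_real_derivative d' x) (at x within {0..b})"
    and le: "\<And>x. x \<in> {0..b} \<Longrightarrow> \<bar>d' x\<bar> \<le> L * \<bar>d x\<bar> + e"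
    and d0: "d 0 = 0" and x: "x \<in> {0..b}"
  shows "\<bar>d x\<bar> \<le> e * ((exp (L * x) - 1) / L)"
proof -
  define z where "z x = e * ((exp (L * x) - 1) / L)" for x
  have z0: "z 0 = 0" by (simp add: z_def)
  have zpos: "z x \<ge> 0" if "x \<ge> 0" for x
    unfolding z_def using L e that by (intro mult_nonneg_nonneg divide_nonneg_nonneg) auto
  have dz: "(z has_real_derivative L * z x + e) (at x within {0..b})" for x
    unfolding z_def using L by (auto intro!: derivative_eq_intros simp: field_simps)
  have "z x - s * d x \<ge> 0" if s: "s = 1 \<or> s = -1" for s
  proof (rule comparison_nonneg[where a=0 and b=b and L=L and d="\<lambda>x. z x - s * d x"
        and d' = "\<lambda>x. L * z x + e - s * d' x"])
    fix y assume y: "y \<in> {0..b}"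
    show "((\<lambda>x. z x - s * d x) has_real_derivative L * z y + e - s * d' y) (at y within {0..b})"
      by (intro derivative_intros dz der[OF y] DERIV_cmult)
    have "L * z y - L * \<bar>d y\<bar> \<ge> - (L * \<bar>z y - s * d y\<bar>)"
    proof -
      have "z y - \<bar>d y\<bar> \<ge> - \<bar>z y - s * d y\<bar>" using zpos[of y] y s by auto
      then have "L * (z y - \<bar>d y\<bar>) \<ge> L * (- \<bar>z y - s * d y\<bar>)" using L by (intro mult_left_mono) auto
      then show ?thesis by (simp add: algebra_simps)
    qed
    moreover have "s * d' y \<le> \<bar>d' y\<bar>" using s by auto
    ultimately show "L * z y + e - s * d' y \<ge> - L * \<bar>z y - s * d y\<bar>" using le[OF y] by auto
  qed (use z0 d0 x in auto)
  from this[of 1] this[of "-1"] show ?thesis unfolding z_def by auto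
qed

section \<open>The Pruefer angle\<close>

text \<open>With \<open>u = r sin y\<close> and \<open>v = r cos y\<close>, this is
  \<open>(u' v - u v') / r^2\<close> for the system satisfied by \<open>u\<close> and
  \<open>v\<close>. Zeros of \<open>u\<close> are thus the angles in \<open>pi\<close> times the
  integers.\<close>

definition pr_rhs :: "(real \<Rightarrow> real) \<Rightarrow> real \<Rightarrow> real \<Rightarrow> real \<Rightarrow> real" where
  "pr_rhs P c x y = (cos y - P x * sin y)\<^sup>2 + c * (sin y)\<^sup>2"

definition pr_sol :: "(real \<Rightarrow> real) \<Rightarrow> real \<Rightarrow> (real \<Rightarrow> real) \<Rightarrow> bool" where
  "pr_sol P c \<theta> \<longleftrightarrow>
     (\<forall>x\<in>{0..pi}. (\<theta> has_real_derivative pr_rhs P c x (\<theta> x)) (at x within {0..pi}))"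

definition pruefer :: "real \<Rightarrow> (real \<Rightarrow> real) \<Rightarrow> real \<Rightarrow> real \<Rightarrow> real" where
  "pruefer a P c = (SOME \<theta>. \<theta> 0 = a \<and> pr_sol P c \<theta>)"

lemma continuous_on_Icc_bound:
  fixes f :: "real \<Rightarrow> real"
  assumes "continuous_on {a..b} f"
  obtains M where "M \<ge> 0" "\<And>x. x \<in> {a..b} \<Longrightarrow> \<bar>f x\<bar> \<le> M"
proof -
  have "bounded (f ` {a..b})"
    using assms by (intro compact_imp_bounded compact_continuous_image) auto
  then obtain M where "\<forall>x\<in>{a..b}. \<bar>f x\<bar> \<le> M" by (auto simp: bounded_iff)
  then have "max M 0 \<ge> 0" "\<And>x. x \<in> {a..b} \<Longrightarrow> \<bar>f x\<bar> \<le> max M 0" by force+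
  then show ?thesis using that by blast
qed

lemma pr_rhs_lipschitz:
  assumes "\<bar>P x\<bar> \<le> M"
  shows "\<bar>pr_rhs P c x y - pr_rhs P c x z\<bar> \<le> (2 * (1 + M)\<^sup>2 + 2 * \<bar>c\<bar>) * \<bar>y - z\<bar>"
proof -
  let ?D = "\<lambda>y. 2 * (cos y - P x * sin y) * (- sin y - P x * cos y) + 2 * c * (sin y * cos y)"
  have M: "0 \<le> M" using assms by linarith
  have "norm (pr_rhs P c x y - pr_rhs P c x z) \<le> (2 * (1 + M)\<^sup>2 + 2 * \<bar>c\<bar>) * norm (y - z)"
  proof (rule field_differentiable_bound[of UNIV _ ?D])
    fix y :: real
    show "(pr_rhs P c x has_field_derivative ?D y) (at y within UNIV)"
      unfolding pr_rhs_def by (auto intro!: derivative_eq_intros simp: algebra_simps)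
    have "\<bar>cos y - P x * sin y\<bar> \<le> \<bar>cos y\<bar> + \<bar>P x\<bar> * \<bar>sin y\<bar>"
      by (simp add: abs_mult[symmetric])
    also have "\<dots> \<le> 1 + M * 1" by (intro add_mono mult_mono) (use assms M in auto)
    finally have 1: "\<bar>cos y - P x * sin y\<bar> \<le> 1 + M" by simp
    have "\<bar>- sin y - P x * cos y\<bar> \<le> \<bar>sin y\<bar> + \<bar>P x\<bar> * \<bar>cos y\<bar>"
      by (simp add: abs_mult[symmetric])
    also have "\<dots> \<le> 1 + M * 1" by (intro add_mono mult_mono) (use assms M in auto)
    finally have 2: "\<bar>- sin y - P x * cos y\<bar> \<le> 1 + M" by simp
    have 3: "\<bar>sin y * cos y\<bar> \<le> 1 * 1" unfolding abs_mult by (intro mult_mono) auto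
    have "norm (?D y) \<le> 2 * (\<bar>cos y - P x * sin y\<bar> * \<bar>- sin y - P x * cos y\<bar>) + 2 * (\<bar>c\<bar> * \<bar>sin y * cos y\<bar>)"
      unfolding real_norm_def
      by (rule order_trans[OF abs_triangle_ineq]) (simp only: abs_mult abs_numeral mult.assoc order_refl)
    also have "\<dots> \<le> 2 * ((1 + M) * (1 + M)) + 2 * (\<bar>c\<bar> * 1)"
      using 1 2 3 M by (intro add_mono mult_left_mono mult_mono) auto
    finally show "norm (?D y) \<le> 2 * (1 + M)\<^sup>2 + 2 * \<bar>c\<bar>" by (simp add: power2_eq_square)
  qed auto
  then show ?thesis by simp
qed

lemma pr_rhs_lipschitz_ex:
  assumes "continuous_on {0..pi} P"
  obtains L where "L > 0"
    "\<And>x y z. x \<in> {0..pi} \<Longrightarrow> \<bar>pr_rhs P c x y - pr_rhs P c x z\<bar> \<le> L * \<bar>y - z\<bar>"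
proof -
  obtain M where M: "M \<ge> 0" "\<And>x. x \<in> {0..pi} \<Longrightarrow> \<bar>P x\<bar> \<le> M"
    using continuous_on_Icc_bound[OF assms] by blast
  show ?thesis
  proof (rule that[of "2 * (1 + M)\<^sup>2 + 2 * \<bar>c\<bar>"])
    have "(1 + M)\<^sup>2 > 0" using M(1) by simp
    then show "2 * (1 + M)\<^sup>2 + 2 * \<bar>c\<bar> > 0" by linarith
    show "\<bar>pr_rhs P c x y - pr_rhs P c x z\<bar> \<le> (2 * (1 + M)\<^sup>2 + 2 * \<bar>c\<bar>) * \<bar>y - z\<bar>"
      if "x \<in> {0..pi}" for x y z
      by (rule pr_rhs_lipschitz) (rule M(2)[OF that])
  qed
qed

text \<open>The difference factors through \<open>Q x - P x\<close> and \<open>c' - c\<close>. The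
  constant is the sum of 2 from the mixed term, \<open>2 * M + 1\<close> from
  \<open>Q x + P x\<close> (here \<open>\<eta> \<le> 1\<close> enters) and 1 from
  \<open>c' - c\<close>.\<close>

lemma pr_rhs_perturb:
  assumes M: "\<bar>P x\<bar> \<le> M" and Q: "\<bar>Q x - P x\<bar> \<le> \<eta>" "\<eta> \<le> 1" and c: "\<bar>c' - c\<bar> \<le> \<eta>"
  shows "\<bar>pr_rhs Q c' x y - pr_rhs P c x y\<bar> \<le> \<eta> * (2 * M + 4)"
proof -
  have M0: "0 \<le> M" using M by linarith
  have e0: "0 \<le> \<eta>" using c by linarith
  have "pr_rhs Q c' x y - pr_rhs P c x y
      = (Q x - P x) * (- 2 * (sin y * cos y) + (Q x + P x) * (sin y)\<^sup>2) + (c' - c) * (sin y)\<^sup>2"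
    unfolding pr_rhs_def by (simp add: power2_eq_square algebra_simps)
  also have "\<bar>\<dots>\<bar> \<le> \<bar>Q x - P x\<bar> * \<bar>- 2 * (sin y * cos y) + (Q x + P x) * (sin y)\<^sup>2\<bar> + \<bar>c' - c\<bar> * (sin y)\<^sup>2"
    by (rule order_trans[OF abs_triangle_ineq]) (simp add: abs_mult)
  also have "\<dots> \<le> \<eta> * (2 * 1 + (2 * M + 1) * 1) + \<eta> * 1"
  proof (intro add_mono mult_mono Q c)
    have "\<bar>- 2 * (sin y * cos y) + (Q x + P x) * (sin y)\<^sup>2\<bar> \<le> 2 * \<bar>sin y * cos y\<bar> + \<bar>Q x + P x\<bar> * (sin y)\<^sup>2"
      by (rule order_trans[OF abs_triangle_ineq]) (simp add: abs_mult)
    also have "\<dots> \<le> 2 * 1 + (2 * M + 1) * 1"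
    proof (intro add_mono mult_mono)
      have "\<bar>sin y\<bar> * \<bar>cos y\<bar> \<le> 1 * 1" by (intro mult_mono) auto
      then show "\<bar>sin y * cos y\<bar> \<le> 1" by (simp add: abs_mult)
      show "\<bar>Q x + P x\<bar> \<le> 2 * M + 1" using M Q by linarith
      show "(sin y)\<^sup>2 \<le> 1" by (simp add: abs_square_le_1)
    qed (use M0 in auto)
    finally show "\<bar>- 2 * (sin y * cos y) + (Q x + P x) * (sin y)\<^sup>2\<bar> \<le> 2 * 1 + (2 * M + 1) * 1" .
    show "(sin y)\<^sup>2 \<le> 1" by (simp add: abs_square_le_1)
  qed (use e0 in auto)
  finally show ?thesis by (simp add: algebra_simps)
qed

text \<open>At a zero of \<open>u\<close> the angle moves with speed 1, whatever \<open>P\<close>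
  and \<open>c\<close> are. All one-sided crossing arguments rest on this.\<close>

lemma pr_rhs_int_multiple:
  "sin y = 0 \<Longrightarrow> pr_rhs P c x y = 1"
  using sin_cos_squared_add[of y] by (simp add: pr_rhs_def)

lemma pruefer:
  assumes P: "continuous_on {0..pi} P"
  shows pruefer_0: "pruefer a P c 0 = a" and pr_sol_pruefer: "pr_sol P c (pruefer a P c)"
proof -
  obtain L where L: "L > 0"
    "\<And>x y z. x \<in> {0..pi} \<Longrightarrow> \<bar>pr_rhs P c x y - pr_rhs P c x z\<bar> \<le> L * \<bar>y - z\<bar>"
    using pr_rhs_lipschitz_ex[OF P] by blast
  have "\<exists>\<theta>. \<theta> 0 = a \<and> pr_sol P c \<theta>"
  proof (rule picard_lindelof_real[of pi L "pr_rhs P c" a])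
    fix y :: "real \<Rightarrow> real" assume "continuous_on {0..pi} y"
    then show "continuous_on {0..pi} (\<lambda>s. pr_rhs P c s (y s))"
      unfolding pr_rhs_def by (intro continuous_intros P)
  qed (use L in \<open>auto simp: pr_sol_def\<close>)
  then have "pruefer a P c 0 = a \<and> pr_sol P c (pruefer a P c)"
    unfolding pruefer_def by (rule someI_ex)
  then show "pruefer a P c 0 = a" "pr_sol P c (pruefer a P c)" by auto
qed

lemma pr_sol_deriv:
  assumes "pr_sol P c \<theta>" "x \<in> {0..pi}"
  shows "(\<theta> has_real_derivative pr_rhs P c x (\<theta> x)) (at x within {0..pi})"
  using assms by (auto simp: pr_sol_def)

lemma pr_sol_continuous: "pr_sol P c \<theta> \<Longrightarrow> continuous_on {0..pi} \<theta>"
  by (rule DERIV_continuous_on) (auto dest: pr_sol_deriv)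

lemma continuous_on_pruefer:
  "continuous_on {0..pi} P \<Longrightarrow> continuous_on {0..pi} (pruefer a P c)"
  by (rule pr_sol_continuous[OF pr_sol_pruefer])

text \<open>The right-hand side equals 1 on the level and is Lipschitz, so the distance
  \<open>d\<close> from the level satisfies \<open>d' \<ge> 1 - L * \<bar>d\<bar>\<close>.
  Comparison first gives \<open>d \<ge> 0\<close>; then \<open>exp (L * x) * d x\<close> increases
  strictly.\<close>

lemma pr_sol_crossing:
  assumes P: "continuous_on {0..pi} P" and sol: "pr_sol P c \<theta>"
    and x: "x0 \<in> {0..pi}" "x \<in> {0..pi}" "x0 < x" and m: "\<theta> x0 \<ge> of_int m * pi"
  shows "\<theta> x > of_int m * pi"
proof -
  obtain L where L: "L > 0"
    "\<And>x y z. x \<in> {0..pi} \<Longrightarrow> \<bar>pr_rhs P c x y - pr_rhs P c x z\<bar> \<le> L * \<bar>y - z\<bar>"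
    using pr_rhs_lipschitz_ex[OF P] by blast
  define d where "d x = \<theta> x - of_int m * pi" for x
  have sub: "{x0..x} \<subseteq> {0..pi}" using x by auto
  have der: "(d has_real_derivative pr_rhs P c y (\<theta> y)) (at y within {x0..x})"
    if "y \<in> {x0..x}" for y
    using DERIV_subset[OF pr_sol_deriv[OF sol] sub] that sub unfolding d_def
    by (auto intro!: derivative_eq_intros)
  have ge: "pr_rhs P c y (\<theta> y) \<ge> 1 - L * \<bar>d y\<bar>" if "y \<in> {x0..x}" for y
  proof -
    have "pr_rhs P c y (of_int m * pi) = 1" by (intro pr_rhs_int_multiple) (simp add: sin_zero_iff_int2)
    then show ?thesis using L(2)[of y "\<theta> y" "of_int m * pi"] that sub by (auto simp: d_def)
  qed
  have nn: "d y \<ge> 0" if "y \<in> {x0..x}" for y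
  proof (rule comparison_nonneg[OF der _ _ that, where L = L])
    show "pr_rhs P c z (\<theta> z) \<ge> - L * \<bar>d z\<bar>" if "z \<in> {x0..x}" for z
      using ge[OF that] by simp
  qed (use m in \<open>auto simp: d_def\<close>)
  have cd: "continuous_on {x0..x} d"
    using der by (intro DERIV_continuous_on) auto
  have "exp (L * x0) * d x0 < exp (L * x) * d x"
  proof (rule DERIV_pos_imp_increasing_open[where f = "\<lambda>x. exp (L * x) * d x"])
    show "continuous_on {x0..x} (\<lambda>x. exp (L * x) * d x)" by (intro continuous_intros cd)
    fix z assume z: "x0 < z" "z < x"
    then have "(d has_real_derivative pr_rhs P c z (\<theta> z)) (at z)"
      using der[of z] at_within_Icc_at[of x0 z x] by simp
    then have "((\<lambda>x. exp (L * x) * d x) has_real_derivative exp (L * z) * (pr_rhs P c z (\<theta> z) + L * d z)) (at z)"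
      by (auto intro!: derivative_eq_intros simp: algebra_simps)
    moreover have "exp (L * z) * (pr_rhs P c z (\<theta> z) + L * d z) > 0"
      using ge[of z] nn[of z] z by (intro mult_pos_pos) auto
    ultimately show "\<exists>w. ((\<lambda>x. exp (L * x) * d x) has_real_derivative w) (at z) \<and> w > 0" by blast
  qed fact
  moreover have "exp (L * x0) * d x0 \<ge> 0" using nn[of x0] x by simp
  ultimately have "exp (L * x) * d x > 0" by linarith
  then show ?thesis by (simp add: zero_less_mult_iff d_def)
qed

text \<open>Interior zeros correspond to the levels \<open>j * pi\<close> with
  \<open>1 \<le> j \<le> k - 1\<close>: each is attained by the intermediate value theorem, and only
  once because levels are crossed upwards.\<close>

lemma pr_sol_card_zeros:
  assumes P: "continuous_on {0..pi} P" and sol: "pr_sol P c \<theta>"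
    and a: "0 \<le> \<theta> 0" "\<theta> 0 < pi" and b: "0 < b" "b \<le> pi" and k: "k \<ge> 1"
    and end_: "\<theta> pi = b + real (k - 1) * pi"
  shows "finite {x \<in> {0<..<pi}. sin (\<theta> x) = 0} \<and> card {x \<in> {0<..<pi}. sin (\<theta> x) = 0} = k - 1"
proof -
  let ?Z = "{x \<in> {0<..<pi}. sin (\<theta> x) = 0}"
  have "\<forall>j\<in>{1..k-1}. \<exists>x. x \<in> {0<..<pi} \<and> \<theta> x = real j * pi"
  proof
    fix j assume j: "j \<in> {1..k-1}"
    have 1: "\<theta> 0 < real j * pi" 
    proof -
      have "real j \<ge> 1" using j by simp
      then have "real j * pi \<ge> 1 * pi" by (intro mult_right_mono) auto
      then show ?thesis using a by linarith
    qed
    have "real j * pi \<le> real (k - 1) * pi" using j by simp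
    then have 2: "real j * pi < \<theta> pi" using end_ b by linarith
    obtain x where "0 \<le> x" "x \<le> pi" "\<theta> x = real j * pi"
      using IVT'[of \<theta> 0 "real j * pi" pi] pr_sol_continuous[OF sol] 1 2 by auto
    moreover have "x \<noteq> 0" "x \<noteq> pi" using 1 2 \<open>\<theta> x = real j * pi\<close> by auto
    ultimately show "\<exists>x. x \<in> {0<..<pi} \<and> \<theta> x = real j * pi" by (intro exI[of _ x]) auto
  qed
  then obtain g where g: "\<And>j. j \<in> {1..k-1} \<Longrightarrow> g j \<in> {0<..<pi} \<and> \<theta> (g j) = real j * pi"
    by metis
  have "bij_betw g {1..k-1} ?Z"
    unfolding bij_betw_def
  proof
    show "inj_on g {1..k-1}" by (rule inj_onI) (metis g mult_cancel_right of_nat_eq_iff pi_neq_zero)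
    show "g ` {1..k-1} = ?Z"
    proof (intro equalityI subsetI)
      fix y assume "y \<in> g ` {1..k-1}"
      then show "y \<in> ?Z" using g by auto
    next
      fix x assume x: "x \<in> ?Z"
      then obtain m where m: "\<theta> x = of_int m * pi" by (auto simp: sin_zero_iff_int2)
      have xi: "x \<in> {0..pi}" "0 < x" "x < pi" using x by auto
      \<comment> \<open>Level 0 is left at once even if \<open>\<theta> 0 = 0\<close>, the Dirichlet
        case.\<close>
      have "\<theta> x > of_int 0 * pi"
        using a by (intro pr_sol_crossing[OF P sol _ xi(1,2)]) auto
      then have m1: "m \<ge> 1" using m by (simp add: zero_less_mult_iff)
      have m2: "m \<le> int (k - 1)"
      proof (rule ccontr)
        \<comment> \<open>Attaining level \<open>k * pi\<close> or a higher one inside would push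
          the terminal angle strictly above \<open>k * pi\<close>, against
          \<open>b \<le> pi\<close>.\<close>
        assume "\<not> m \<le> int (k - 1)"
        then have "int k \<le> m" by linarith
        then have "of_int (int k) \<le> (of_int m :: real)" by (simp only: of_int_le_iff)
        then have "real k * pi \<le> of_int m * pi" by (intro mult_right_mono) auto
        then have "\<theta> pi > of_int (int k) * pi"
          using m by (intro pr_sol_crossing[OF P sol xi(1) _ xi(3)]) auto
        moreover have "real k * pi = real (k - 1) * pi + pi" using k by (simp add: algebra_simps of_nat_diff)
        ultimately show False using end_ b by simp
      qed
      define j where "j = nat m"
      have j: "j \<in> {1..k-1}" "m = int j" using m1 m2 by (auto simp: j_def)
      have "g j = x"
      proof (rule ccontr)
        assume "g j \<noteq> x"
        then consider "g j < x" | "x < g j" by linarith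
        then show False
        proof cases
          case 1
          then show False
            using pr_sol_crossing[OF P sol _ xi(1) 1, of "int j"] g[OF j(1)] m j(2) by auto
        next
          case 2
          then show False
            using pr_sol_crossing[OF P sol xi(1) _ 2, of "int j"] g[OF j(1)] m j(2) by auto
        qed
      qed
      then show "x \<in> g ` {1..k-1}" using j by blast
    qed
  qed
  then show ?thesis
    using bij_betw_finite[of g] bij_betw_same_card[of g] by fastforce
qed

text \<open>Raising \<open>c\<close> adds a nonnegative multiple of the squared sine to the
  right-hand side, so comparison gives the weak inequality. Equality at \<open>pi\<close> would
  propagate backwards and force \<open>sin (\<theta>1 x) = 0\<close> throughout, which is impossible
  since the angle has speed 1 where its sine vanishes.\<close>

lemma pruefer_strict_mono:
  assumes P: "continuous_on {0..pi} P" and c: "c1 < c2"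
  shows "pruefer a P c1 pi < pruefer a P c2 pi"
proof -
  define \<theta>1 where "\<theta>1 = pruefer a P c1"
  define \<theta>2 where "\<theta>2 = pruefer a P c2"
  note s1 = pr_sol_pruefer[OF P, of c1 a, folded \<theta>1_def]
  note s2 = pr_sol_pruefer[OF P, of c2 a, folded \<theta>2_def]
  obtain L where L: "L > 0"
    "\<And>x y z. x \<in> {0..pi} \<Longrightarrow> \<bar>pr_rhs P c2 x y - pr_rhs P c2 x z\<bar> \<le> L * \<bar>y - z\<bar>"
    using pr_rhs_lipschitz_ex[OF P] by blast
  define d where "d x = \<theta>2 x - \<theta>1 x" for x
  have d0: "d 0 = 0" by (simp add: d_def \<theta>1_def \<theta>2_def pruefer_0[OF P])
  have der: "(d has_real_derivative pr_rhs P c2 x (\<theta>2 x) - pr_rhs P c1 x (\<theta>1 x)) (at x within {0..pi})"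
    if "x \<in> {0..pi}" for x
    unfolding d_def using that by (intro derivative_intros pr_sol_deriv s1 s2)
  have ge: "pr_rhs P c2 x (\<theta>2 x) - pr_rhs P c1 x (\<theta>1 x) \<ge> - L * \<bar>d x\<bar>" if "x \<in> {0..pi}" for x
  proof -
    have "pr_rhs P c2 x (\<theta>1 x) - pr_rhs P c1 x (\<theta>1 x) = (c2 - c1) * (sin (\<theta>1 x))\<^sup>2"
      by (simp add: pr_rhs_def algebra_simps)
    also have "\<dots> \<ge> 0" using c by simp
    finally show ?thesis using L(2)[OF that, of "\<theta>2 x" "\<theta>1 x"] by (auto simp: d_def)
  qed
  have nn: "d x \<ge> 0" if "x \<in> {0..pi}" for x
    using comparison_nonneg[OF der ge _ that] d0 by simp
  have "d pi \<noteq> 0"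
  proof
    assume dpi: "d pi = 0"
    have dz: "d x = 0" if "x \<in> {0..pi}" for x
    proof -
      have "exp (L * x) * d x \<le> exp (L * pi) * d pi"
        by (rule exp_weighted_mono[OF der]) (use ge nn that in force)+
      then show ?thesis using dpi nn[OF that] by (simp add: mult_le_0_iff)
    qed
    have s0: "sin (\<theta>1 x) = 0" if "x \<in> {0<..<pi}" for x
    proof -
      have x: "x \<in> {0..pi}" using that by auto
      have "(d has_real_derivative pr_rhs P c2 x (\<theta>2 x) - pr_rhs P c1 x (\<theta>1 x)) (at x)"
        using der[OF x] that at_within_Icc_at[of 0 x pi] by simp
      moreover have "(d has_real_derivative 0) (at x)"
        by (rule has_field_derivative_transform_within_open[where S="{0<..<pi}" and f="\<lambda>_. 0"])
          (use that dz in auto)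
      ultimately have "pr_rhs P c2 x (\<theta>2 x) - pr_rhs P c1 x (\<theta>1 x) = 0" by (rule DERIV_unique)
      moreover have "\<theta>2 x = \<theta>1 x" using dz[OF x] by (simp add: d_def)
      ultimately have "(c2 - c1) * (sin (\<theta>1 x))\<^sup>2 = 0" by (simp add: pr_rhs_def algebra_simps)
      then show ?thesis using c by simp
    qed
    have x: "pi / 2 \<in> {0<..<pi}" by auto
    have "(\<theta>1 has_real_derivative 1) (at (pi / 2))"
      using pr_sol_deriv[OF s1, of "pi / 2"] at_within_Icc_at[of 0 "pi/2" pi]
        pr_rhs_int_multiple[OF s0[OF x], of P c1] by simp
    then have "((\<lambda>x. sin (\<theta>1 x)) has_real_derivative cos (\<theta>1 (pi / 2))) (at (pi / 2))"
      by (auto intro!: derivative_eq_intros)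
    moreover have "((\<lambda>x. sin (\<theta>1 x)) has_real_derivative 0) (at (pi / 2))"
      by (rule has_field_derivative_transform_within_open[where S="{0<..<pi}" and f="\<lambda>_. 0"])
        (use s0 in auto)
    ultimately have "cos (\<theta>1 (pi / 2)) = 0" by (rule DERIV_unique)
    then show False using s0[OF x] sin_cos_squared_add[of "\<theta>1 (pi / 2)"] by simp
  qed
  then show ?thesis using nn[of pi] by (simp add: d_def \<theta>1_def \<theta>2_def)
qed

text \<open>Gronwall estimate for the difference of two angles, whose equations differ by the error
  of \<open>pr_rhs_perturb\<close>; \<open>\<eta>\<close> is chosen such that this error, amplified
  over \<open>{0..pi}\<close>, stays below \<open>e\<close>.\<close>

lemma pruefer_uniform_limit:
  assumes P: "continuous_on {0..pi} P" and Q: "\<And>n. continuous_on {0..pi} (Q n)"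
    and lim: "uniform_limit {0..pi} Q P F" and c: "(c' \<longlongrightarrow> c) F"
  shows "uniform_limit {0..pi} (\<lambda>n. pruefer a (Q n) (c' n)) (pruefer a P c) F"
proof (rule uniform_limitI)
  fix e :: real assume e: "e > 0"
  obtain M where M: "M \<ge> 0" "\<And>x. x \<in> {0..pi} \<Longrightarrow> \<bar>P x\<bar> \<le> M"
    using continuous_on_Icc_bound[OF P] by blast
  obtain L where L: "L > 0"
    "\<And>x y z. x \<in> {0..pi} \<Longrightarrow> \<bar>pr_rhs P c x y - pr_rhs P c x z\<bar> \<le> L * \<bar>y - z\<bar>"
    using pr_rhs_lipschitz_ex[OF P] by blast
  define K where "K = (2 * M + 4) * ((exp (L * pi) - 1) / L)"
  have K: "K \<ge> 0" unfolding K_def using L M by (intro mult_nonneg_nonneg divide_nonneg_pos) auto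
  define \<eta> where "\<eta> = min 1 (e / (K + 1))"
  have \<eta>: "\<eta> > 0" "\<eta> \<le> 1" using e K by (auto simp: \<eta>_def)
  have "\<eta> * K \<le> e / (K + 1) * K" using K by (intro mult_right_mono) (auto simp: \<eta>_def)
  also have "\<dots> < e" using e K by (simp add: field_simps)
  finally have \<eta>K: "\<eta> * K < e" .
  have "\<forall>\<^sub>F n in F. (\<forall>x\<in>{0..pi}. dist (Q n x) (P x) < \<eta>) \<and> dist (c' n) c < \<eta>"
    using uniform_limitD[OF lim \<eta>(1)] tendstoD[OF c \<eta>(1)] by eventually_elim auto
  then show "\<forall>\<^sub>F n in F. \<forall>x\<in>{0..pi}. dist (pruefer a (Q n) (c' n) x) (pruefer a P c x) < e"
  proof eventually_elim
    case (elim n)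
    show ?case
    proof
      fix x assume x: "x \<in> {0..pi}"
      let ?t = "pruefer a (Q n) (c' n)" and ?s = "pruefer a P c"
      have "\<bar>?t x - ?s x\<bar> \<le> \<eta> * (2 * M + 4) * ((exp (L * x) - 1) / L)"
      proof (rule gronwall_abs[where b = pi and d = "\<lambda>x. ?t x - ?s x"
            and d' = "\<lambda>x. pr_rhs (Q n) (c' n) x (?t x) - pr_rhs P c x (?s x)"])
        fix y assume y: "y \<in> {0..pi}"
        show "((\<lambda>x. ?t x - ?s x) has_real_derivative
            pr_rhs (Q n) (c' n) y (?t y) - pr_rhs P c y (?s y)) (at y within {0..pi})"
          using y by (intro derivative_intros pr_sol_deriv pr_sol_pruefer P Q)
        have "\<bar>pr_rhs (Q n) (c' n) y (?t y) - pr_rhs P c y (?t y)\<bar> \<le> \<eta> * (2 * M + 4)"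
          using elim y \<eta> M by (intro pr_rhs_perturb) (auto simp: dist_norm intro: less_imp_le)
        then show "\<bar>pr_rhs (Q n) (c' n) y (?t y) - pr_rhs P c y (?s y)\<bar>
            \<le> L * \<bar>?t y - ?s y\<bar> + \<eta> * (2 * M + 4)"
          using L(2)[OF y, of "?t y" "?s y"] by linarith
      qed (use L M \<eta> x in \<open>auto simp: pruefer_0 P Q\<close>)
      also have "\<dots> \<le> \<eta> * (2 * M + 4) * ((exp (L * pi) - 1) / L)"
        using L M \<eta> x by (intro mult_left_mono divide_right_mono) auto
      also have "\<dots> < e" using \<eta>K by (simp add: K_def mult.assoc)
      finally show "dist (?t x) (?s x) < e" by (simp add: dist_norm)
    qed
  qed
qed

lemma continuous_on_pruefer_parameter:
  assumes P: "continuous_on {0..pi} P"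
  shows "continuous_on UNIV (\<lambda>c. pruefer a P c pi)"
  unfolding continuous_on_def
proof
  fix c
  have "uniform_limit {0..pi} (\<lambda>c. pruefer a P c) (pruefer a P c) (at c within UNIV)"
    by (rule pruefer_uniform_limit[OF P P]) (auto simp: uniform_limit_const)
  then show "((\<lambda>c. pruefer a P c pi) \<longlongrightarrow> pruefer a P c pi) (at c within UNIV)"
    by (rule tendsto_uniform_limitI) auto
qed

text \<open>A straight line \<open>\<psi>\<close> descending from above \<open>a\<close> to below
  \<open>b\<close> is an upper barrier. It stays where the sine is bounded away from 0, so for very
  negative \<open>c\<close> the right-hand side along it is at most its slope
  \<open>- g\<close>.\<close>

lemma pruefer_lower:
  assumes P: "continuous_on {0..pi} P" and a: "0 \<le> a" "a < pi" and b: "0 < b"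
  shows "\<exists>c. pruefer a P c pi < b"
proof -
  obtain M where M: "M \<ge> 0" "\<And>x. x \<in> {0..pi} \<Longrightarrow> \<bar>P x\<bar> \<le> M"
    using continuous_on_Icc_bound[OF P] by blast
  \<comment> \<open>The barrier starts midway between \<open>a\<close> and \<open>pi\<close> and
    ends at \<open>a2\<close>, positive and below both \<open>b\<close> and \<open>a1\<close>, so
    its values stay inside the open interval from 0 to \<open>pi\<close>.\<close>
  define a1 where "a1 = (a + pi) / 2"
  define a2 where "a2 = min b a1 / 2"
  have a1: "a < a1" "a1 < pi" "0 < a1" using a by (auto simp: a1_def)
  have a2: "0 < a2" "a2 < a1" "a2 < b" using a1 b by (auto simp: a2_def)
  have "\<exists>y\<in>{a2..a1}. \<forall>z\<in>{a2..a1}. sin y \<le> sin z"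
    using a2 by (intro continuous_attains_inf continuous_intros) auto
  then obtain y where y: "y \<in> {a2..a1}" "\<And>z. z \<in> {a2..a1} \<Longrightarrow> sin y \<le> sin z"
    by blast
  have sy: "sin y > 0" using y(1) a1 a2 by (intro sin_gt_zero) auto
  define g where "g = (a1 - a2) / pi"
  have g: "g > 0" using a2 by (simp add: g_def)
  \<comment> \<open>With \<open>(cos - P sin)^2 \<le> 2 cos^2 + 2 M^2 sin^2\<close>, this choice
    leaves at most \<open>2 - (2 + g) = - g\<close> along the barrier.\<close>
  define c where "c = 2 - 2 * M\<^sup>2 - (2 + g) / (sin y)\<^sup>2"
  obtain L where L: "L > 0"
    "\<And>x y z. x \<in> {0..pi} \<Longrightarrow> \<bar>pr_rhs P c x y - pr_rhs P c x z\<bar> \<le> L * \<bar>y - z\<bar>"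
    using pr_rhs_lipschitz_ex[OF P] by blast
  define \<psi> where "\<psi> x = a1 - g * x" for x
  let ?t = "pruefer a P c"
  have up: "pr_rhs P c x (\<psi> x) \<le> - g" if x: "x \<in> {0..pi}" for x
  proof -
    let ?s = "sin (\<psi> x)"
    have "g * x \<le> g * pi" using x g by (intro mult_left_mono) auto
    moreover have "0 \<le> g * x" using x g by simp
    moreover have "g * pi = a1 - a2" by (simp add: g_def)
    ultimately have "\<psi> x \<in> {a2..a1}" by (simp add: \<psi>_def)
    then have "sin y \<le> ?s" by (rule y)
    then have s2: "?s\<^sup>2 \<ge> (sin y)\<^sup>2" using sy by (intro power_mono) auto
    have "P x ^ 2 \<le> M\<^sup>2" using power_mono[OF M(2)[OF x], of 2] by simp
    then have PM: "P x ^ 2 * ?s\<^sup>2 \<le> M\<^sup>2 * ?s\<^sup>2" by (intro mult_right_mono) auto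
    have "(cos (\<psi> x) - P x * ?s)\<^sup>2 = 2 * (cos (\<psi> x))\<^sup>2 + 2 * ((P x)\<^sup>2 * ?s\<^sup>2) - (cos (\<psi> x) + P x * ?s)\<^sup>2"
      by (simp add: power2_eq_square algebra_simps)
    also have "\<dots> \<le> 2 * (cos (\<psi> x))\<^sup>2 + 2 * ((P x)\<^sup>2 * ?s\<^sup>2)" by simp
    also have "\<dots> \<le> 2 * (1 - ?s\<^sup>2) + 2 * (M\<^sup>2 * ?s\<^sup>2)" using PM by (simp add: cos_squared_eq)
    finally have "pr_rhs P c x (\<psi> x) \<le> 2 - (2 + g) / (sin y)\<^sup>2 * ?s\<^sup>2"
      unfolding pr_rhs_def c_def by (simp add: algebra_simps)
    moreover have "(2 + g) / (sin y)\<^sup>2 * ?s\<^sup>2 \<ge> (2 + g) / (sin y)\<^sup>2 * (sin y)\<^sup>2"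
      using g by (intro mult_left_mono s2) auto
    moreover have "(2 + g) / (sin y)\<^sup>2 * (sin y)\<^sup>2 = 2 + g" using sy by simp
    ultimately show ?thesis by linarith
  qed
  have "0 \<le> \<psi> pi - ?t pi"
  proof (rule comparison_nonneg[where a=0 and b=pi and L=L and d="\<lambda>x. \<psi> x - ?t x"
        and d'="\<lambda>x. - g - pr_rhs P c x (?t x)"])
    fix x assume x: "x \<in> {0..pi}"
    show "((\<lambda>x. \<psi> x - ?t x) has_real_derivative - g - pr_rhs P c x (?t x)) (at x within {0..pi})"
      unfolding \<psi>_def
      by (rule derivative_eq_intros refl pr_sol_deriv[OF pr_sol_pruefer[OF P] x] | simp)+
    show "- L * \<bar>\<psi> x - ?t x\<bar> \<le> - g - pr_rhs P c x (?t x)"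
      using L(2)[OF x, of "\<psi> x" "?t x"] up[OF x] by linarith
  qed (use a1 in \<open>auto simp: \<psi>_def pruefer_0[OF P]\<close>)
  moreover have "\<psi> pi = a2" by (simp add: \<psi>_def g_def)
  ultimately show ?thesis using a2 by (intro exI[of _ c]) linarith
qed

text \<open>The substitution \<open>tan \<phi> = \<kappa> tan \<theta>\<close> turns \<open>\<theta>' \<ge> (cos\<^sup>2 \<theta> + \<kappa>\<^sup>2 sin\<^sup>2 \<theta>) / 2\<close> into
  \<open>\<phi>' \<ge> \<kappa> / 2\<close>; the function \<open>H\<close> below is the branch of this substitution that stays within
  \<open>pi / 2\<close> of the identity.\<close>

lemma pruefer_upper:
  assumes P: "continuous_on {0..pi} P"
  shows "\<exists>c. pruefer a P c pi > b"
proof -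
  obtain M where M: "M \<ge> 0" "\<And>x. x \<in> {0..pi} \<Longrightarrow> \<bar>P x\<bar> \<le> M"
    using continuous_on_Icc_bound[OF P] by blast
  \<comment> \<open>Chosen so that \<open>\<kappa> / 2 * pi\<close> is
    \<open>\<bar>b - a\<bar>\<close> plus \<open>3 / 2 * pi\<close>; the passage to \<open>H\<close>
    and back costs less than \<open>pi / 2\<close> at either end.\<close>
  define \<kappa> where "\<kappa> = 3 + 2 * \<bar>b - a\<bar> / pi"
  have \<kappa>: "\<kappa> \<ge> 3" by (simp add: \<kappa>_def)
  \<comment> \<open>The summand \<open>M\<^sup>2\<close> absorbs the terms in \<open>P\<close>, and
    \<open>\<kappa>\<^sup>2 / 2\<close> makes the right-hand side at least
    \<open>D y / 2\<close>.\<close>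
  define c where "c = \<kappa>\<^sup>2 / 2 + M\<^sup>2"
  define H where "H y = y + arctan ((\<kappa> - 1) * (sin y * cos y) / ((cos y)\<^sup>2 + \<kappa> * (sin y)\<^sup>2))" for y :: real
  define D where "D y = (cos y)\<^sup>2 + \<kappa>\<^sup>2 * (sin y)\<^sup>2" for y :: real
  have pos: "(cos y)\<^sup>2 + r * (sin y)\<^sup>2 > 0" if "r > 0" for y r :: real
  proof (cases "sin y = 0")
    case True
    then show ?thesis using sin_cos_squared_add[of y] by simp
  next
    case False
    then have "r * (sin y)\<^sup>2 > 0" using that by simp
    then show ?thesis by (intro add_nonneg_pos) auto
  qed
  have D: "D y > 0" for y using pos[of "\<kappa>\<^sup>2" y] \<kappa> by (simp add: D_def)
  have dH: "(H has_real_derivative \<kappa> / D y) (at y)" for y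
  proof -
    let ?s = "sin y" and ?c = "cos y"
    let ?E = "?c\<^sup>2 + \<kappa> * ?s\<^sup>2" and ?n = "(\<kappa> - 1) * (?s * ?c)"
    let ?n' = "(\<kappa> - 1) * (?c * ?c - ?s * ?s)" and ?E' = "2 * (\<kappa> - 1) * (?s * ?c)"
    have E: "?E > 0" using pos[of \<kappa> y] \<kappa> by simp
    have c2: "?c\<^sup>2 = 1 - ?s\<^sup>2" by (simp add: cos_squared_eq)
    have "((\<lambda>y. (\<kappa> - 1) * (sin y * cos y)) has_real_derivative ?n') (at y)"
      by (auto intro!: derivative_eq_intros)
    moreover have "((\<lambda>y. (cos y)\<^sup>2 + \<kappa> * (sin y)\<^sup>2) has_real_derivative ?E') (at y)"
      by (auto intro!: derivative_eq_intros simp: algebra_simps)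
    ultimately have "((\<lambda>y. (\<kappa> - 1) * (sin y * cos y) / ((cos y)\<^sup>2 + \<kappa> * (sin y)\<^sup>2))
        has_real_derivative (?n' * ?E - ?n * ?E') / (?E * ?E)) (at y)"
      using E by (intro DERIV_divide) auto
    from DERIV_chain2[OF DERIV_arctan this]
    have "(H has_real_derivative 1 + inverse (1 + (?n / ?E)\<^sup>2) * ((?n' * ?E - ?n * ?E') / (?E * ?E))) (at y)"
      unfolding H_def by (rule DERIV_add[OF DERIV_ident])
    also have "1 + inverse (1 + (?n / ?E)\<^sup>2) * ((?n' * ?E - ?n * ?E') / (?E * ?E)) = \<kappa> / D y"
    proof -
      have n2: "?E\<^sup>2 + ?n\<^sup>2 = D y"
      proof -
        have "?E\<^sup>2 + ?n\<^sup>2 = (?c\<^sup>2 + \<kappa> * ?s\<^sup>2)\<^sup>2 + (\<kappa> - 1)\<^sup>2 * (?s\<^sup>2 * ?c\<^sup>2)"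
          by (simp add: power_mult_distrib)
        also have "\<dots> = D y" unfolding D_def c2 by (simp add: power2_eq_square algebra_simps)
        finally show ?thesis .
      qed
      have num: "?n' * ?E - ?n * ?E' = \<kappa> - D y"
      proof -
        have "?n' * ?E - ?n * ?E' = (\<kappa> - 1) * (?c\<^sup>2 - ?s\<^sup>2) * ?E - 2 * (\<kappa> - 1)\<^sup>2 * (?s\<^sup>2 * ?c\<^sup>2)"
          by (simp add: power2_eq_square algebra_simps)
        also have "\<dots> = \<kappa> - D y" unfolding D_def c2 by (simp add: power2_eq_square algebra_simps)
        finally show ?thesis .
      qed
      have "1 + inverse (1 + (n / E)\<^sup>2) * ((\<kappa> - d) / (E * E)) = \<kappa> / d"
        if "E > 0" "d > 0" "E\<^sup>2 + n\<^sup>2 = d" for E n d :: real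
      proof -
        have "1 + (n / E)\<^sup>2 = d / E\<^sup>2" using that by (auto simp: divide_simps)
        then show ?thesis using that by (simp add: divide_simps power2_eq_square)
      qed
      from this[OF E D n2] show ?thesis unfolding num .
    qed
    finally show ?thesis .
  qed
  let ?t = "pruefer a P c"
  have ge: "pr_rhs P c x y \<ge> D y / 2" if x: "x \<in> {0..pi}" for x y
  proof -
    have "P x ^ 2 \<le> M\<^sup>2" using power_mono[OF M(2)[OF x], of 2] by simp
    then have PM: "P x ^ 2 * (sin y)\<^sup>2 \<le> M\<^sup>2 * (sin y)\<^sup>2" by (intro mult_right_mono) auto
    \<comment> \<open>Completing the square isolates a loss of \<open>(P sin)^2\<close> while
      keeping half of the squared cosine.\<close>
    have "(cos y - P x * sin y)\<^sup>2 = (cos y)\<^sup>2 / 2 - P x ^ 2 * (sin y)\<^sup>2 + (cos y - 2 * (P x * sin y))\<^sup>2 / 2"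
      by (simp add: power2_eq_square field_simps)
    also have "\<dots> \<ge> (cos y)\<^sup>2 / 2 - M\<^sup>2 * (sin y)\<^sup>2" using PM by (simp add: add_increasing2)
    finally show ?thesis unfolding pr_rhs_def D_def c_def by (simp add: algebra_simps)
  qed
  have "exp (0 * 0) * (H (?t 0) - \<kappa> / 2 * 0) \<le> exp (0 * pi) * (H (?t pi) - \<kappa> / 2 * pi)"
  proof (rule exp_weighted_mono[where a=0 and b=pi and d="\<lambda>x. H (?t x) - \<kappa> / 2 * x"
      and d'="\<lambda>x. \<kappa> / D (?t x) * pr_rhs P c x (?t x) - \<kappa> / 2"])
    fix x assume x: "x \<in> {0..pi}"
    show "((\<lambda>x. H (?t x) - \<kappa> / 2 * x) has_real_derivative
        \<kappa> / D (?t x) * pr_rhs P c x (?t x) - \<kappa> / 2) (at x within {0..pi})"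
      by (rule derivative_eq_intros refl DERIV_chain2[OF dH pr_sol_deriv[OF pr_sol_pruefer[OF P] x]] | simp)+
    have "\<kappa> / D (?t x) * pr_rhs P c x (?t x) \<ge> \<kappa> / D (?t x) * (D (?t x) / 2)"
      using ge[OF x, of "?t x"] \<kappa> D[of "?t x"] by (intro mult_left_mono) auto
    then show "\<kappa> / D (?t x) * pr_rhs P c x (?t x) - \<kappa> / 2 \<ge> - 0 * (H (?t x) - \<kappa> / 2 * x)"
      using D[of "?t x"] by simp
  qed auto
  then have "H (?t pi) \<ge> H a + \<kappa> / 2 * pi" by (simp add: pruefer_0[OF P])
  moreover have "H (?t pi) < ?t pi + pi / 2"
    unfolding H_def by (intro add_strict_left_mono arctan_ubound)
  moreover have "a + - (pi / 2) < H a"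
    unfolding H_def by (intro add_strict_left_mono arctan_lbound)
  moreover have "\<kappa> / 2 * pi = 3 / 2 * pi + \<bar>b - a\<bar>" by (simp add: \<kappa>_def field_simps)
  moreover have "pi > 0" by simp
  ultimately have "?t pi > b" by linarith
  then show ?thesis by blast
qed

lemma pruefer_hits:
  assumes P: "continuous_on {0..pi} P" and a: "0 \<le> a" "a < pi" and b: "0 < b"
  shows "\<exists>!c. pruefer a P c pi = b"
proof -
  obtain c1 c2 where c: "pruefer a P c1 pi < b" "pruefer a P c2 pi > b"
    using pruefer_lower[OF P a b] pruefer_upper[OF P] by metis
  have "c1 \<le> c2" using pruefer_strict_mono[OF P, of c2 c1 a] c by (meson less_trans not_le order_less_irrefl)
  then obtain c where "pruefer a P c pi = b"
    using IVT'[of "\<lambda>c. pruefer a P c pi" c1 b c2] c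
      continuous_on_subset[OF continuous_on_pruefer_parameter[OF P]] by auto
  moreover have "c = c'" if "pruefer a P c pi = b" "pruefer a P c' pi = b" for c c'
    using pruefer_strict_mono[OF P, of c c' a] pruefer_strict_mono[OF P, of c' c a] that by force
  ultimately show ?thesis by blast
qed

section \<open>Regularisation of the Sturm-Liouville equation\<close>

abbreviation (input) "leb0 \<equiv> lebesgue_on {0<..<pi}"

lemma absolutely_integrable_mult_continuous:
  fixes f g :: "real \<Rightarrow> real"
  assumes "f absolutely_integrable_on {a..b}" "continuous_on {a..b} g"
  shows "(\<lambda>x. f x * g x) absolutely_integrable_on {a..b}"
proof -
  have "(\<lambda>x. g x * f x) absolutely_integrable_on {a..b}"
    using assms
    by (intro absolutely_integrable_bounded_measurable_product_real
        continuous_imp_measurable_on_sets_lebesgue compact_imp_bounded compact_continuous_image) auto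
  then show ?thesis by (simp add: mult.commute)
qed

text \<open>Integration by parts for an absolutely continuous and a \<open>C\<^sup>1\<close> factor: the difference of the
  two sides has increments of size \<open>o(\<bar>y - x\<bar>)\<close>, so it is constant.\<close>

lemma indefinite_integral_times:
  fixes Q u u' :: "real \<Rightarrow> real"
  assumes Q: "Q absolutely_integrable_on {a..b}"
    and du: "\<And>x. x \<in> {a..b} \<Longrightarrow> (u has_real_derivative u' x) (at x within {a..b})"
    and cu': "continuous_on {a..b} u'" and x: "x \<in> {a..b}"
  shows "integral {a..x} Q * u x
    = integral {a..x} (\<lambda>s. Q s * u s) + integral {a..x} (\<lambda>s. integral {a..s} Q * u' s)"
proof -
  define P where "P x = integral {a..x} Q" for x
  define A where "A x = integral {a..x} (\<lambda>s. \<bar>Q s\<bar>)" for x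
  define F where "F x = P x * u x - integral {a..x} (\<lambda>s. Q s * u s) - integral {a..x} (\<lambda>s. P s * u' s)" for x
  have cu: "continuous_on {a..b} u" using du by (rule DERIV_continuous_on)
  have iQ: "Q integrable_on {a..b}" and iA: "(\<lambda>s. \<bar>Q s\<bar>) integrable_on {a..b}"
    using Q by (auto simp: absolutely_integrable_on_def)
  have iQu: "(\<lambda>s. Q s * u s) integrable_on {a..b}"
    using absolutely_integrable_mult_continuous[OF Q cu] by (auto simp: absolutely_integrable_on_def)
  have cP: "continuous_on {a..b} P" unfolding P_def by (intro indefinite_integral_continuous_1 iQ)
  have cA: "continuous_on {a..b} A" unfolding A_def by (intro indefinite_integral_continuous_1 iA)
  have iPu: "(\<lambda>s. P s * u' s) integrable_on {a..b}"
    by (intro integrable_continuous_real continuous_intros cP cu')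
  obtain C where C: "C \<ge> 0" "\<And>x. x \<in> {a..b} \<Longrightarrow> \<bar>u' x\<bar> \<le> C"
    using continuous_on_Icc_bound[OF cu'] by blast
  have ulip: "\<bar>u x - u s\<bar> \<le> C * \<bar>x - s\<bar>" if "x \<in> {a..b}" "s \<in> {a..b}" for x s
    using field_differentiable_bound[of "{a..b}" u u' C x s] du C that by auto
  have comb: "integral {a..y} f - integral {a..x} f = integral {x..y} f"
    if "f integrable_on {a..b}" "x \<in> {a..b}" "y \<in> {a..b}" "x \<le> y" for f :: "real \<Rightarrow> real" and x y
    using Henstock_Kurzweil_Integration.integral_combine[of a x y f]
      integrable_on_subinterval[OF that(1), of a y] that by auto
  \<comment> \<open>The increment of \<open>F\<close> is at most \<open>y - x\<close> times a
    multiple of the increment of \<open>A\<close>. As \<open>A\<close> is continuous, the difference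
    quotients of \<open>F\<close> tend to 0, although \<open>P\<close> itself need not be
    differentiable.\<close>
  have est: "\<bar>F y - F x\<bar> \<le> 2 * C * (A y - A x) * (y - x)"
    if xy: "x \<in> {a..b}" "y \<in> {a..b}" "x \<le> y" for x y
  proof -
    have sub: "{x..y} \<subseteq> {a..b}" using xy by auto
    have int: "f integrable_on {x..y}" if "f integrable_on {a..b}" for f :: "real \<Rightarrow> real"
      using integrable_on_subinterval[OF that] sub .
    have PQ: "P z - P w = integral {w..z} Q" "\<bar>P z - P w\<bar> \<le> A z - A w"
      if "w \<in> {a..b}" "z \<in> {a..b}" "w \<le> z" for w z
    proof -
      show 1: "P z - P w = integral {w..z} Q" unfolding P_def by (rule comb[OF iQ that])
      have "norm (integral {w..z} Q) \<le> integral {w..z} (\<lambda>s. \<bar>Q s\<bar>)"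
      proof (rule integral_norm_bound_integral)
        have "{w..z} \<subseteq> {a..b}" using that by auto
        then show "Q integrable_on {w..z}" "(\<lambda>s. \<bar>Q s\<bar>) integrable_on {w..z}"
          using integrable_on_subinterval[OF iQ] integrable_on_subinterval[OF iA] by blast+
      qed simp
      moreover have "A z - A w = integral {w..z} (\<lambda>s. \<bar>Q s\<bar>)" unfolding A_def by (rule comb[OF iA that])
      ultimately show "\<bar>P z - P w\<bar> \<le> A z - A w" using 1 by simp
    qed
    have Amono: "A w \<le> A z" if "w \<in> {a..b}" "z \<in> {a..b}" "w \<le> z" for w z
      using PQ(2)[OF that] by linarith
    have iu': "(u' has_integral u y - u x) {x..y}"
    proof (rule fundamental_theorem_of_calculus[OF xy(3)])
      fix s assume "s \<in> {x..y}"
      then have "(u has_real_derivative u' s) (at s within {x..y})"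
        using sub by (intro DERIV_subset[OF du sub]) auto
      then show "(u has_vector_derivative u' s) (at s within {x..y})"
        by (simp add: has_real_derivative_iff_has_vector_derivative)
    qed
    have 1: "((\<lambda>s. (P y - P s) * u' s) has_integral
        (P y * (u y - u x) - (integral {a..y} (\<lambda>s. P s * u' s) - integral {a..x} (\<lambda>s. P s * u' s)))) {x..y}"
      unfolding comb[OF iPu xy] left_diff_distrib
      by (intro has_integral_diff has_integral_mult_right iu' integrable_integral int iPu)
    have 2: "((\<lambda>s. Q s * (u x - u s)) has_integral
        ((P y - P x) * u x - (integral {a..y} (\<lambda>s. Q s * u s) - integral {a..x} (\<lambda>s. Q s * u s)))) {x..y}"
      unfolding comb[OF iQu xy] right_diff_distrib PQ(1)[OF xy]
      by (intro has_integral_diff has_integral_mult_left integrable_integral int iQu iQ)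
    \<comment> \<open>Each integrand contains one small difference: of \<open>P\<close>, controlled
      by \<open>A\<close>, or of \<open>u\<close>, controlled by the Lipschitz constant
      \<open>C\<close>.\<close>
    have "F y - F x = integral {x..y} (\<lambda>s. (P y - P s) * u' s) + integral {x..y} (\<lambda>s. Q s * (u x - u s))"
      unfolding integral_unique[OF 1] integral_unique[OF 2] F_def by (simp add: algebra_simps)
    also have "\<bar>\<dots>\<bar> \<le> \<bar>integral {x..y} (\<lambda>s. (P y - P s) * u' s)\<bar> + \<bar>integral {x..y} (\<lambda>s. Q s * (u x - u s))\<bar>"
      by (rule abs_triangle_ineq)
    also have "\<bar>integral {x..y} (\<lambda>s. (P y - P s) * u' s)\<bar> \<le> integral {x..y} (\<lambda>s. (A y - A x) * C)"
      unfolding real_norm_def[symmetric]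
    proof (rule integral_norm_bound_integral)
      fix s assume s: "s \<in> {x..y}"
      have "\<bar>P y - P s\<bar> \<le> A y - A x" using PQ(2)[of s y] Amono[of x s] s xy by auto
      then show "norm ((P y - P s) * u' s) \<le> (A y - A x) * C"
        unfolding real_norm_def abs_mult
        using s sub C Amono[OF xy] by (intro mult_mono) auto
    qed (use 1 in auto)
    also have "\<bar>integral {x..y} (\<lambda>s. Q s * (u x - u s))\<bar> \<le> integral {x..y} (\<lambda>s. \<bar>Q s\<bar> * (C * (y - x)))"
      unfolding real_norm_def[symmetric]
    proof (rule integral_norm_bound_integral)
      fix s assume s: "s \<in> {x..y}"
      have "\<bar>u x - u s\<bar> \<le> C * \<bar>x - s\<bar>" using ulip[of x s] s sub xy by auto
      also have "\<dots> \<le> C * (y - x)" using s C by (intro mult_left_mono) auto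
      finally show "norm (Q s * (u x - u s)) \<le> norm (Q s) * (C * (y - x))"
        unfolding real_norm_def abs_mult by (intro mult_left_mono) auto
    qed (use 2 int[OF iA] in \<open>auto intro: integrable_on_mult_left\<close>)
    also have "integral {x..y} (\<lambda>s. \<bar>Q s\<bar> * (C * (y - x))) = (A y - A x) * (C * (y - x))"
      unfolding A_def comb[OF iA xy] by simp
    also have "integral {x..y} (\<lambda>s. (A y - A x) * C) = (y - x) * ((A y - A x) * C)" using xy by simp
    finally show ?thesis by (simp add: algebra_simps)
  qed
  have dF: "(F has_real_derivative 0) (at x within {a..b})" if x: "x \<in> {a..b}" for x
    unfolding has_field_derivative_iff
  proof (rule Lim_null_comparison)
    show "\<forall>\<^sub>F y in at x within {a..b}. norm ((F y - F x) / (y - x)) \<le> 2 * C * \<bar>A y - A x\<bar>"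
      unfolding eventually_at_filter
    proof (intro always_eventually allI impI)
      fix y assume y: "y \<noteq> x" "y \<in> {a..b}"
      have "\<bar>F y - F x\<bar> \<le> 2 * C * \<bar>A y - A x\<bar> * \<bar>y - x\<bar>"
      proof (cases "x \<le> y")
        case True
        have "2 * C * (A y - A x) * (y - x) \<le> 2 * C * \<bar>A y - A x\<bar> * (y - x)"
          using C True by (intro mult_right_mono mult_left_mono) auto
        then have "2 * C * (A y - A x) * (y - x) \<le> 2 * C * \<bar>A y - A x\<bar> * \<bar>y - x\<bar>"
          using True by simp
        then show ?thesis using est[OF x y(2) True] by linarith
      next
        case False
        have "2 * C * (A x - A y) * (x - y) \<le> 2 * C * \<bar>A y - A x\<bar> * (x - y)"
          using C False by (intro mult_right_mono mult_left_mono) auto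
        also have "x - y = \<bar>y - x\<bar>" using False by simp
        finally have "2 * C * (A x - A y) * (x - y) \<le> 2 * C * \<bar>A y - A x\<bar> * \<bar>y - x\<bar>"
          using False by simp
        then show ?thesis using est[OF y(2) x] False by (simp add: abs_minus_commute)
      qed
      then show "norm ((F y - F x) / (y - x)) \<le> 2 * C * \<bar>A y - A x\<bar>"
        using y by (simp add: abs_divide divide_simps)
    qed
    have "(A \<longlongrightarrow> A x) (at x within {a..b})" using cA x by (auto simp: continuous_on_def)
    then have "((\<lambda>y. 2 * C * \<bar>A y - A x\<bar>) \<longlongrightarrow> 2 * C * \<bar>A x - A x\<bar>) (at x within {a..b})"
      by (intro tendsto_intros)
    then show "((\<lambda>y. 2 * C * \<bar>A y - A x\<bar>) \<longlongrightarrow> 0) (at x within {a..b})" by simp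
  qed
  obtain K where K: "\<And>x. x \<in> {a..b} \<Longrightarrow> F x = K"
    using has_field_derivative_zero_constant[of "{a..b}" F] dF by auto
  have "F a = 0" by (simp add: F_def P_def)
  moreover have "a \<in> {a..b}" using x by auto
  ultimately have "F x = 0" using K x by metis
  then show ?thesis by (simp add: F_def P_def)
qed

section \<open>The space L2 on the interval, and passage between the two integrals\<close>

lemma L2_I:
  "f \<in> borel_measurable leb0 \<Longrightarrow> integrable leb0 (\<lambda>x. (f x)\<^sup>2) \<Longrightarrow> f \<in> L2"
  unfolding L2_def by blast

lemma L2_measurable: "f \<in> L2 \<Longrightarrow> f \<in> borel_measurable leb0"
  and L2_square_integrable: "f \<in> L2 \<Longrightarrow> integrable leb0 (\<lambda>x. (f x)\<^sup>2)"
  unfolding L2_def by blast+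

lemma finite_measure_leb0: "finite_measure leb0"
  by (rule finite_measureI) (simp add: emeasure_restrict_space)

lemma integrable_leb0_const [simp]: "integrable leb0 (\<lambda>x. c :: real)"
  using finite_measure_leb0 by (rule finite_measure.integrable_const)

lemma L2_mult_integrable:
  assumes "f \<in> L2" "g \<in> L2"
  shows "integrable leb0 (\<lambda>x. f x * g x)"
proof (rule Bochner_Integration.integrable_bound)
  show "integrable leb0 (\<lambda>x. (f x)\<^sup>2 + (g x)\<^sup>2)"
    using assms by (intro Bochner_Integration.integrable_add L2_square_integrable)
  show "(\<lambda>x. f x * g x) \<in> borel_measurable leb0"
    using assms by (intro borel_measurable_times L2_measurable)
  have "\<bar>s * t\<bar> \<le> s\<^sup>2 + t\<^sup>2" for s t :: real
  proof -
    have "2 * (\<bar>s\<bar> * \<bar>t\<bar>) \<le> s\<^sup>2 + t\<^sup>2"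
      using zero_le_power2[of "\<bar>s\<bar> - \<bar>t\<bar>"] by (simp add: power2_diff)
    moreover have "0 \<le> \<bar>s\<bar> * \<bar>t\<bar>" by simp
    ultimately show ?thesis unfolding abs_mult by linarith
  qed
  then show "AE x in leb0. norm (f x * g x) \<le> norm ((f x)\<^sup>2 + (g x)\<^sup>2)" by simp
qed

lemma L2_const: "(\<lambda>x. c) \<in> L2"
  by (intro L2_I) auto

lemma L2_scale:
  assumes "f \<in> L2"
  shows "(\<lambda>x. c * f x) \<in> L2"
proof (rule L2_I)
  show "(\<lambda>x. c * f x) \<in> borel_measurable leb0"
    using assms by (intro borel_measurable_times borel_measurable_const L2_measurable)
  show "integrable leb0 (\<lambda>x. (c * f x)\<^sup>2)"
    unfolding power_mult_distrib using assms by (intro integrable_mult_right L2_square_integrable)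
qed

lemma L2_add:
  assumes "f \<in> L2" "g \<in> L2"
  shows "(\<lambda>x. f x + g x) \<in> L2"
proof (rule L2_I)
  show "(\<lambda>x. f x + g x) \<in> borel_measurable leb0"
    using assms by (intro borel_measurable_add L2_measurable)
  have "integrable leb0 (\<lambda>x. (f x)\<^sup>2 + (g x)\<^sup>2 + 2 * (f x * g x))"
    using assms
    by (intro Bochner_Integration.integrable_add integrable_mult_right L2_square_integrable L2_mult_integrable)
  then show "integrable leb0 (\<lambda>x. (f x + g x)\<^sup>2)" by (simp add: power2_sum mult.assoc)
qed

lemma L2_diff: "f \<in> L2 \<Longrightarrow> g \<in> L2 \<Longrightarrow> (\<lambda>x. f x - g x) \<in> L2"
  using L2_add[OF _ L2_scale[of g "-1"]] by simp

lemma L2_integrable: "f \<in> L2 \<Longrightarrow> integrable leb0 f"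
  using L2_mult_integrable[OF _ L2_const[of 1]] by simp

lemma L2_mult_continuous:
  assumes f: "f \<in> L2" and g: "continuous_on {0..pi} g"
  shows "(\<lambda>x. f x * g x) \<in> L2"
proof (rule L2_I)
  have gm: "g \<in> borel_measurable leb0"
    by (rule continuous_imp_measurable_on_sets_lebesgue[OF continuous_on_subset[OF g]]) auto
  then show m: "(\<lambda>x. f x * g x) \<in> borel_measurable leb0"
    by (intro borel_measurable_times L2_measurable[OF f] gm)
  obtain C where C: "\<And>x. x \<in> {0..pi} \<Longrightarrow> \<bar>g x\<bar> \<le> C"
    using continuous_on_Icc_bound[OF g] by blast
  show "integrable leb0 (\<lambda>x. (f x * g x)\<^sup>2)"
  proof (rule Bochner_Integration.integrable_bound)
    show "integrable leb0 (\<lambda>x. C\<^sup>2 * (f x)\<^sup>2)"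
      using f by (intro integrable_mult_right L2_square_integrable)
    show "(\<lambda>x. (f x * g x)\<^sup>2) \<in> borel_measurable leb0" using m by measurable
    have "norm ((f x * g x)\<^sup>2) \<le> norm (C\<^sup>2 * (f x)\<^sup>2)" if "x \<in> {0<..<pi}" for x
    proof -
      have "\<bar>g x\<bar>\<^sup>2 \<le> C\<^sup>2" using C[of x] that by (intro power_mono) auto
      from mult_right_mono[OF this, of "(f x)\<^sup>2"] show ?thesis
        by (simp add: power_mult_distrib mult.commute)
    qed
    then show "AE x in leb0. norm ((f x * g x)\<^sup>2) \<le> norm (C\<^sup>2 * (f x)\<^sup>2)"
      by (intro AE_I2) simp
  qed
qed

lemma continuous_imp_L2: "continuous_on {0..pi} g \<Longrightarrow> g \<in> L2"
  using L2_mult_continuous[OF L2_const[of 1]] by simp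

text \<open>Bridge from the Lebesgue integral on the open interval, used in the definitions, to the
  gauge integral on the closed one, used for calculus; the endpoints are negligible.\<close>

lemma integrable_leb0_iff: "integrable leb0 f \<longleftrightarrow> f absolutely_integrable_on {0..pi}"
  for f :: "real \<Rightarrow> real"
  by (subst absolutely_integrable_on_Icc_iff_Ioo)
    (simp add: set_integrable_def integrable_restrict_space)

lemma integral_leb0:
  fixes f :: "real \<Rightarrow> real"
  assumes "integrable leb0 f"
  shows "integral\<^sup>L leb0 f = integral {0..pi} f"
  using lebesgue_integral_eq_integral[OF assms] integral_open_interval_real[of 0 pi f] by simp

lemma L2_absolutely_integrable: "f \<in> L2 \<Longrightarrow> f absolutely_integrable_on {0..pi}"
  unfolding integrable_leb0_iff[symmetric] by (rule L2_integrable)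

lemma L2_integrable_on: "f \<in> L2 \<Longrightarrow> f integrable_on {0..pi}"
  by (drule L2_absolutely_integrable) (simp add: absolutely_integrable_on_def)

lemma integral_leb0_initial:
  assumes "f \<in> L2" "x \<in> {0..pi}"
  shows "(LINT t|lebesgue_on {0..x}. f t) = integral {0..x} f"
proof -
  have "f absolutely_integrable_on {0..x}"
    by (rule absolutely_integrable_on_subinterval[OF L2_absolutely_integrable]) (use assms in auto)
  then show ?thesis
    by (intro lebesgue_integral_eq_integral absolutely_integrable_imp_integrable) auto
qed

lemma integral_cong_AE_leb0:
  fixes f g :: "real \<Rightarrow> real"
  assumes "AE x in leb0. f x = g x" and x: "x \<in> {0..pi}"
  shows "integral {0..x} f = integral {0..x} g"
proof -
  have "AE x in lebesgue. x \<in> {0<..<pi} \<longrightarrow> f x = g x"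
    using assms by (subst (asm) AE_restrict_space_iff) auto
  then obtain N where N: "N \<in> null_sets lebesgue" "{x. \<not> (x \<in> {0<..<pi} \<longrightarrow> f x = g x)} \<subseteq> N"
    unfolding eventually_ae_filter by auto
  show ?thesis
  proof (rule integral_spike)
    show "negligible (N \<union> {0, pi})"
      using N(1) negligible_iff_null_sets by (auto intro!: negligible_Un)
    show "g y = f y" if "y \<in> {0..x} - (N \<union> {0, pi})" for y
    proof -
      have "y \<in> {0<..<pi}" using that x by (auto simp: less_le)
      moreover have "y \<notin> {x. \<not> (x \<in> {0<..<pi} \<longrightarrow> f x = g x)}" using that N(2) by blast
      ultimately show ?thesis by simp
    qed
  qed
qed

section \<open>The equivalent first-order system with continuous coefficients\<close>

definition sl_mean :: "(real \<Rightarrow> real) \<Rightarrow> real" where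
  "sl_mean q = integral {0..pi} q / pi"

definition sl_prim :: "(real \<Rightarrow> real) \<Rightarrow> real \<Rightarrow> real" where
  "sl_prim q x = integral {0..x} (\<lambda>t. sl_mean q - q t)"

definition sl_system :: "(real \<Rightarrow> real) \<Rightarrow> real \<Rightarrow> (real \<Rightarrow> real) \<Rightarrow> (real \<Rightarrow> real) \<Rightarrow> bool" where
  "sl_system P c u v \<longleftrightarrow> (\<forall>x\<in>{0..pi}.
     (u has_real_derivative v x - P x * u x) (at x within {0..pi}) \<and>
     (v has_real_derivative P x * v x - ((P x)\<^sup>2 + c) * u x) (at x within {0..pi}))"

lemma sl_system_u: "sl_system P c u v \<Longrightarrow> x \<in> {0..pi} \<Longrightarrow>
    (u has_real_derivative v x - P x * u x) (at x within {0..pi})"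
  and sl_system_v: "sl_system P c u v \<Longrightarrow> x \<in> {0..pi} \<Longrightarrow>
    (v has_real_derivative P x * v x - ((P x)\<^sup>2 + c) * u x) (at x within {0..pi})"
  by (auto simp: sl_system_def)

lemma sl_system_continuous:
  assumes "sl_system P c u v"
  shows "continuous_on {0..pi} u" "continuous_on {0..pi} v"
  by (rule DERIV_continuous_on, erule sl_system_u[OF assms])
    (rule DERIV_continuous_on, erule sl_system_v[OF assms])

lemma sl_prim_integrand_L2: "q \<in> L2 \<Longrightarrow> (\<lambda>t. sl_mean q - q t) \<in> L2"
  by (intro L2_diff L2_const)

lemma sl_prim_continuous: "q \<in> L2 \<Longrightarrow> continuous_on {0..pi} (sl_prim q)"
  unfolding sl_prim_def
  by (intro indefinite_integral_continuous_1 L2_integrable_on sl_prim_integrand_L2)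

lemma sl_prim_0 [simp]: "sl_prim q 0 = 0"
  by (simp add: sl_prim_def)

lemma sl_prim_pi: "q \<in> L2 \<Longrightarrow> sl_prim q pi = 0"
  unfolding sl_prim_def
  by (subst integral_diff) (auto simp: L2_integrable_on sl_mean_def)

text \<open>Integrating by parts, \<open>P u\<close> is the integral of
  \<open>(m - q) u + P u'\<close>, where \<open>m\<close> is the mean, while \<open>u'\<close> is a
  constant plus the integral of \<open>(q - lam) u\<close>. In the sum the terms with
  \<open>q\<close> cancel, so \<open>u' + P u\<close> has the continuous derivative
  \<open>w\<close>.\<close>

lemma W22_imp_sl_system:
  assumes q: "q \<in> L2" and W: "W22 u u' u''"
    and eq: "AE x in leb0. - u'' x + q x * u x = lam * u x"
  shows "sl_system (sl_prim q) (lam - sl_mean q) u (\<lambda>x. u' x + sl_prim q x * u x)"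
proof -
  define P where "P = sl_prim q"
  define c where "c = lam - sl_mean q"
  have cP: "continuous_on {0..pi} P" unfolding P_def by (rule sl_prim_continuous[OF q])
  have du: "\<And>x. x \<in> {0..pi} \<Longrightarrow> (u has_real_derivative u' x) (at x within {0..pi})"
    and u''L2: "u'' \<in> L2"
    and u'0: "\<And>x. x \<in> {0..pi} \<Longrightarrow> u' x = u' 0 + (LINT t|lebesgue_on {0..x}. u'' t)"
    using W unfolding W22_def by blast+
  have u': "u' x = u' 0 + integral {0..x} u''" if "x \<in> {0..pi}" for x
    using u'0[OF that] integral_leb0_initial[OF u''L2 that] by simp
  have cu: "continuous_on {0..pi} u" using du by (rule DERIV_continuous_on)
  have "continuous_on {0..pi} (\<lambda>x. u' 0 + integral {0..x} u'')"
    by (intro continuous_intros indefinite_integral_continuous_1 L2_integrable_on u''L2)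
  then have cu': "continuous_on {0..pi} u'" by (rule continuous_on_eq) (rule u'[symmetric])
  define w where "w x = - c * u x + P x * u' x" for x
  have cw: "continuous_on {0..pi} w" unfolding w_def by (intro continuous_intros cu cP cu')
  have v: "u' x + P x * u x = u' 0 + integral {0..x} w" if x: "x \<in> {0..pi}" for x
  proof -
    have sub: "{0..x} \<subseteq> {0..pi}" using x by auto
    have int: "f integrable_on {0..x}" if "f \<in> L2" for f
      using integrable_on_subinterval[OF L2_integrable_on[OF that]] sub by auto
    have qu: "(\<lambda>s. q s * u s) \<in> L2" by (rule L2_mult_continuous[OF q cu])
    have uL: "u \<in> L2" by (rule continuous_imp_L2[OF cu])
    have PuL: "(\<lambda>s. P s * u' s) \<in> L2" by (intro continuous_imp_L2 continuous_intros cP cu')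
    have "P x * u x = integral {0..x} (\<lambda>s. (sl_mean q - q s) * u s) + integral {0..x} (\<lambda>s. P s * u' s)"
      unfolding P_def sl_prim_def
      by (rule indefinite_integral_times[OF L2_absolutely_integrable[OF sl_prim_integrand_L2[OF q]] du cu' x])
    moreover have "integral {0..x} (\<lambda>s. (sl_mean q - q s) * u s)
        = sl_mean q * integral {0..x} u - integral {0..x} (\<lambda>s. q s * u s)"
      unfolding left_diff_distrib
      using int[OF qu] int[OF L2_scale[OF uL]] by (subst integral_diff) auto
    moreover have "integral {0..x} u'' = integral {0..x} (\<lambda>s. q s * u s - lam * u s)"
      by (rule integral_cong_AE_leb0[OF _ x], rule AE_mp[OF eq]) (auto simp: algebra_simps)
    moreover have "\<dots> = integral {0..x} (\<lambda>s. q s * u s) - lam * integral {0..x} u"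
      using int[OF qu] int[OF L2_scale[OF uL]] by (subst integral_diff) auto
    moreover have "integral {0..x} w = - c * integral {0..x} u + integral {0..x} (\<lambda>s. P s * u' s)"
      unfolding w_def using int[OF PuL] int[OF L2_scale[OF uL, of "-c"]] by (subst integral_add) auto
    ultimately show ?thesis using u'[OF x] by (simp add: c_def algebra_simps)
  qed
  have dv: "((\<lambda>x. u' x + P x * u x) has_real_derivative w x) (at x within {0..pi})"
    if x: "x \<in> {0..pi}" for x
  proof (rule has_field_derivative_transform_within[OF _ zero_less_one x])
    show "((\<lambda>x. u' 0 + integral {0..x} w) has_real_derivative w x) (at x within {0..pi})"
      using integral_has_real_derivative[OF cw x] by (auto intro!: derivative_eq_intros)
  qed (use v in auto)
  show ?thesis
    unfolding sl_system_def P_def[symmetric] c_def[symmetric]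
  proof (intro ballI conjI)
    fix x assume x: "x \<in> {0..pi}"
    show "(u has_real_derivative u' x + P x * u x - P x * u x) (at x within {0..pi})"
      using du[OF x] by simp
    have "P x * (u' x + P x * u x) - ((P x)\<^sup>2 + c) * u x = w x"
      by (simp add: w_def algebra_simps power2_eq_square)
    from DERIV_cong[OF dv[OF x] this[symmetric]]
    show "((\<lambda>x. u' x + P x * u x) has_real_derivative
        P x * (u' x + P x * u x) - ((P x)\<^sup>2 + c) * u x) (at x within {0..pi})" .
  qed
qed

text \<open>The same cancellation read backwards: subtracting the integrated product
  \<open>P u\<close> from \<open>v\<close> restores the term with \<open>q\<close>.\<close>

lemma sl_system_imp_W22:
  assumes q: "q \<in> L2" and S: "sl_system (sl_prim q) (lam - sl_mean q) u v"
  shows "W22 u (\<lambda>x. v x - sl_prim q x * u x) (\<lambda>x. (q x - lam) * u x)"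
proof -
  define P where "P = sl_prim q"
  define c where "c = lam - sl_mean q"
  have S: "sl_system P c u v" using S unfolding P_def c_def .
  have cP: "continuous_on {0..pi} P" unfolding P_def by (rule sl_prim_continuous[OF q])
  note cu = sl_system_continuous(1)[OF S] and cv = sl_system_continuous(2)[OF S]
  define u' where "u' x = v x - P x * u x" for x
  have du: "\<And>x. x \<in> {0..pi} \<Longrightarrow> (u has_real_derivative u' x) (at x within {0..pi})"
    unfolding u'_def by (rule sl_system_u[OF S])
  have cu': "continuous_on {0..pi} u'" unfolding u'_def by (intro continuous_intros cu cP cv)
  have L: "(\<lambda>x. (q x - lam) * u x) \<in> L2"
    by (intro L2_mult_continuous L2_diff q L2_const cu)
  have "u' x = u' 0 + integral {0..x} (\<lambda>s. (q s - lam) * u s)" if x: "x \<in> {0..pi}" for x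
  proof -
    have sub: "{0..x} \<subseteq> {0..pi}" using x by auto
    have int: "f integrable_on {0..x}" if "f \<in> L2" for f
      using integrable_on_subinterval[OF L2_integrable_on[OF that]] sub by auto
    have qu: "(\<lambda>s. q s * u s) \<in> L2" by (rule L2_mult_continuous[OF q cu])
    have uL: "u \<in> L2" by (rule continuous_imp_L2[OF cu])
    have PuL: "(\<lambda>s. P s * u' s) \<in> L2" by (intro continuous_imp_L2 continuous_intros cP cu')
    have "P x * u x = integral {0..x} (\<lambda>s. (sl_mean q - q s) * u s) + integral {0..x} (\<lambda>s. P s * u' s)"
      unfolding P_def sl_prim_def
      by (rule indefinite_integral_times[OF L2_absolutely_integrable[OF sl_prim_integrand_L2[OF q]] du cu' x])
    moreover have "integral {0..x} (\<lambda>s. (sl_mean q - q s) * u s)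
        = sl_mean q * integral {0..x} u - integral {0..x} (\<lambda>s. q s * u s)"
      unfolding left_diff_distrib
      using int[OF qu] int[OF L2_scale[OF uL]] by (subst integral_diff) auto
    moreover have "integral {0..x} (\<lambda>s. (q s - lam) * u s) = integral {0..x} (\<lambda>s. q s * u s) - lam * integral {0..x} u"
      unfolding left_diff_distrib
      using int[OF qu] int[OF L2_scale[OF uL]] by (subst integral_diff) auto
    moreover have "v x = v 0 + (- c * integral {0..x} u + integral {0..x} (\<lambda>s. P s * u' s))"
    proof -
      have "((\<lambda>s. - c * u s + P s * u' s) has_integral v x - v 0) {0..x}"
      proof (rule fundamental_theorem_of_calculus)
        fix s assume s: "s \<in> {0..x}"
        then have "(v has_real_derivative - c * u s + P s * u' s) (at s within {0..x})"
          using DERIV_subset[OF sl_system_v[OF S] sub, of s] sub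
          by (auto simp: u'_def algebra_simps power2_eq_square)
        then show "(v has_vector_derivative - c * u s + P s * u' s) (at s within {0..x})"
          by (simp add: has_real_derivative_iff_has_vector_derivative)
      qed (use x in auto)
      from integral_unique[OF this] show ?thesis
        using int[OF PuL] int[OF L2_scale[OF uL, of "-c"]] by (subst (asm) integral_add) auto
    qed
    moreover have "P 0 = 0" by (simp add: P_def)
    ultimately show ?thesis unfolding u'_def by (simp add: c_def algebra_simps)
  qed
  then have "\<forall>x\<in>{0..pi}. u' x = u' 0 + (LINT t|lebesgue_on {0..x}. (q t - lam) * u t)"
    using integral_leb0_initial[OF L] by presburger
  then show ?thesis
    using du L unfolding W22_def P_def[symmetric] u'_def[symmetric] by blast
qed

section \<open>Eigenvalues and eigenfunctions\<close>

text \<open>Eventually all values lie within distance 1 of the bounded range of \<open>l\<close>, in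
  a compact interval on which \<open>f\<close> is uniformly continuous.\<close>

lemma uniform_limit_compose_continuous:
  fixes f :: "real \<Rightarrow> real" and a b :: real
  assumes ul: "uniform_limit {a..b} g l F" and cl: "continuous_on {a..b} l"
    and cf: "continuous_on UNIV f"
  shows "uniform_limit {a..b} (\<lambda>n x. f (g n x)) (\<lambda>x. f (l x)) F"
proof -
  obtain M where M: "\<And>x. x \<in> {a..b} \<Longrightarrow> \<bar>l x\<bar> \<le> M"
    using continuous_on_Icc_bound[OF cl] by blast
  have "uniformly_continuous_on {- M - 1..M + 1} f"
    by (rule compact_uniformly_continuous[OF continuous_on_subset[OF cf]]) auto
  moreover have "\<forall>\<^sub>F n in F. g n ` {a..b} \<subseteq> {- M - 1..M + 1}"
    using uniform_limitD[OF ul zero_less_one]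
  proof eventually_elim
    case (elim n)
    then show ?case using M by (force simp: dist_norm abs_le_iff abs_less_iff)
  qed
  moreover have "l ` {a..b} \<subseteq> {- M - 1..M + 1}" using M by (force simp: abs_le_iff)
  ultimately have "uniform_limit {a..b} (\<lambda>n x. f (g n x)) (f \<circ> l) F"
    by (rule uniform_limit_compose[OF ul])
  then show ?thesis by (simp add: o_def)
qed

lemma uniform_limit_times_continuous:
  fixes f g :: "'i \<Rightarrow> real \<Rightarrow> real" and a b :: real
  assumes "uniform_limit {a..b} f l F" "uniform_limit {a..b} g m F"
    and "continuous_on {a..b} l" "continuous_on {a..b} m"
  shows "uniform_limit {a..b} (\<lambda>n x. f n x * g n x) (\<lambda>x. l x * m x) F"
  using assms by (intro uniform_lim_mult compact_imp_bounded compact_continuous_image) auto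

lemma uniform_limit_const_seq:
  assumes "(c' \<longlongrightarrow> c) F"
  shows "uniform_limit S (\<lambda>n x. c' n) (\<lambda>x. c) F"
  using assms unfolding uniform_limit_iff tendsto_iff by (auto elim: eventually_mono)

text \<open>This is \<open>(u u' + v v') / r^2\<close>, the logarithmic derivative of the amplitude
  \<open>r\<close>, at angle \<open>y\<close>. Squares are written as products so that limits can be
  taken factor by factor.\<close>

definition pr_log_deriv :: "(real \<Rightarrow> real) \<Rightarrow> real \<Rightarrow> real \<Rightarrow> real \<Rightarrow> real" where
  "pr_log_deriv P c x y = sin y * cos y * (1 - P x * P x - c) + P x * (cos y * cos y - sin y * sin y)"

text \<open>The amplitude equals 1 at 0, so the solution built from it starts at
  \<open>(sin a, cos a)\<close>; as an exponential it never vanishes, and \<open>u\<close> has the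
  zeros of the sine.\<close>

definition pr_rad :: "real \<Rightarrow> (real \<Rightarrow> real) \<Rightarrow> real \<Rightarrow> real \<Rightarrow> real" where
  "pr_rad a P c x = exp (integral {0..x} (\<lambda>s. pr_log_deriv P c s (pruefer a P c s)))"

definition pr_u :: "real \<Rightarrow> (real \<Rightarrow> real) \<Rightarrow> real \<Rightarrow> real \<Rightarrow> real" where
  "pr_u a P c x = pr_rad a P c x * sin (pruefer a P c x)"

definition pr_v :: "real \<Rightarrow> (real \<Rightarrow> real) \<Rightarrow> real \<Rightarrow> real \<Rightarrow> real" where
  "pr_v a P c x = pr_rad a P c x * cos (pruefer a P c x)"

lemma pr_rad_pos [simp]: "pr_rad a P c x > 0"
  by (simp add: pr_rad_def)

lemma continuous_on_pr_log_deriv: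
  assumes "continuous_on {0..pi} P"
  shows "continuous_on {0..pi} (\<lambda>s. pr_log_deriv P c s (pruefer a P c s))"
  unfolding pr_log_deriv_def by (intro continuous_intros continuous_on_pruefer assms)

lemma pr_sl_system:
  assumes P: "continuous_on {0..pi} P"
  shows "sl_system P c (pr_u a P c) (pr_v a P c)"
  unfolding sl_system_def
proof
  fix x assume x: "x \<in> {0..pi}"
  let ?t = "pruefer a P c" and ?R = "pr_rad a P c"
  let ?G = "pr_log_deriv P c x (?t x)" and ?F = "pr_rhs P c x (?t x)"
  have dt: "(?t has_real_derivative ?F) (at x within {0..pi})"
    by (rule pr_sol_deriv[OF pr_sol_pruefer[OF P] x])
  have dR: "(?R has_real_derivative ?R x * ?G) (at x within {0..pi})"
    unfolding pr_rad_def
    by (rule DERIV_chain2[OF DERIV_exp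
        integral_has_real_derivative[OF continuous_on_pr_log_deriv[OF P] x]])
  have s2: "sin y * sin y = 1 - cos y * cos y" for y :: real
    using sin_squared_eq[of y] by (simp add: power2_eq_square)
  have 1: "?G * sin (?t x) + cos (?t x) * ?F = cos (?t x) - P x * sin (?t x)"
  proof -
    \<comment> \<open>Before \<open>sin^2 + cos^2 = 1\<close> is used, the claim is a polynomial
      identity with the factor \<open>s * s + c' * c'\<close> on the right.\<close>
    have "?G * s + c' * ((c' - p * s)\<^sup>2 + c * s\<^sup>2) = (c' - p * s) * (s * s + c' * c')"
      if "?G = s * c' * (1 - p * p - c) + p * (c' * c' - s * s)" for s c' p
      unfolding that by (simp add: power2_eq_square algebra_simps)
    from this[of "sin (?t x)" "cos (?t x)" "P x"] show ?thesis
      by (simp add: pr_log_deriv_def pr_rhs_def s2)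
  qed
  have 2: "?G * cos (?t x) - sin (?t x) * ?F = P x * cos (?t x) - ((P x)\<^sup>2 + c) * sin (?t x)"
  proof -
    have "?G * c' - s * ((c' - p * s)\<^sup>2 + c * s\<^sup>2) = (p * c' - (p\<^sup>2 + c) * s) * (s * s + c' * c')"
      if "?G = s * c' * (1 - p * p - c) + p * (c' * c' - s * s)" for s c' p
      unfolding that by (simp add: power2_eq_square algebra_simps)
    from this[of "sin (?t x)" "cos (?t x)" "P x"] show ?thesis
      by (simp add: pr_log_deriv_def pr_rhs_def s2)
  qed
  show "(pr_u a P c has_real_derivative pr_v a P c x - P x * pr_u a P c x) (at x within {0..pi}) \<and>
    (pr_v a P c has_real_derivative P x * pr_v a P c x - ((P x)\<^sup>2 + c) * pr_u a P c x) (at x within {0..pi})"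
  proof
    have "((\<lambda>x. ?R x * sin (?t x)) has_real_derivative
        ?R x * ?G * sin (?t x) + cos (?t x) * ?F * ?R x) (at x within {0..pi})"
      by (rule DERIV_mult[OF dR DERIV_chain2[OF DERIV_sin dt]])
    moreover have "?R x * ?G * sin (?t x) + cos (?t x) * ?F * ?R x = pr_v a P c x - P x * pr_u a P c x"
      using arg_cong[OF 1, of "\<lambda>z. ?R x * z"] unfolding pr_u_def pr_v_def by (simp add: algebra_simps)
    ultimately show "(pr_u a P c has_real_derivative pr_v a P c x - P x * pr_u a P c x) (at x within {0..pi})"
      unfolding pr_u_def[abs_def] by simp
    have "((\<lambda>x. ?R x * cos (?t x)) has_real_derivative
        ?R x * ?G * cos (?t x) + - sin (?t x) * ?F * ?R x) (at x within {0..pi})"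
      by (rule DERIV_mult[OF dR DERIV_chain2[OF DERIV_cos dt]])
    moreover have "?R x * ?G * cos (?t x) + - sin (?t x) * ?F * ?R x
        = P x * pr_v a P c x - ((P x)\<^sup>2 + c) * pr_u a P c x"
      using arg_cong[OF 2, of "\<lambda>z. ?R x * z"] unfolding pr_u_def pr_v_def by (simp add: algebra_simps)
    ultimately show "(pr_v a P c has_real_derivative P x * pr_v a P c x - ((P x)\<^sup>2 + c) * pr_u a P c x) (at x within {0..pi})"
      unfolding pr_v_def[abs_def] by simp
  qed
qed

lemma pr_uv_uniform_limit:
  assumes P: "continuous_on {0..pi} P" and Q: "\<And>n. continuous_on {0..pi} (Q n)"
    and lim: "uniform_limit {0..pi} Q P F" and c: "(c' \<longlongrightarrow> c) F"
  shows "uniform_limit {0..pi} (\<lambda>n. pr_u a (Q n) (c' n)) (pr_u a P c) F"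
    and "uniform_limit {0..pi} (\<lambda>n. pr_v a (Q n) (c' n)) (pr_v a P c) F"
proof -
  let ?t = "\<lambda>n. pruefer a (Q n) (c' n)" and ?s = "pruefer a P c"
  have t: "uniform_limit {0..pi} ?t ?s F" by (rule pruefer_uniform_limit[OF P Q lim c])
  have cs: "continuous_on {0..pi} ?s" by (rule continuous_on_pruefer[OF P])
  have css: "continuous_on {0..pi} (\<lambda>x. sin (?s x))" "continuous_on {0..pi} (\<lambda>x. cos (?s x))"
    by (intro continuous_intros cs)+
  have sin: "uniform_limit {0..pi} (\<lambda>n x. sin (?t n x)) (\<lambda>x. sin (?s x)) F"
    by (rule uniform_limit_compose_continuous[OF t cs]) (intro continuous_intros)
  have cos: "uniform_limit {0..pi} (\<lambda>n x. cos (?t n x)) (\<lambda>x. cos (?s x)) F"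
    by (rule uniform_limit_compose_continuous[OF t cs]) (intro continuous_intros)
  have G: "uniform_limit {0..pi} (\<lambda>n x. pr_log_deriv (Q n) (c' n) x (?t n x)) (\<lambda>x. pr_log_deriv P c x (?s x)) F"
    unfolding pr_log_deriv_def
    by (intro uniform_limit_add uniform_limit_minus uniform_limit_times_continuous sin cos lim
        uniform_limit_const uniform_limit_const_seq c continuous_intros css P)
  have "uniform_limit {0..pi} (\<lambda>n. pr_rad a (Q n) (c' n)) (pr_rad a P c) F"
    unfolding pr_rad_def[abs_def]
    by (rule uniform_limit_compose_continuous[OF uniform_limit_indefinite_integral[OF G]])
      (intro continuous_on_pr_log_deriv Q P indefinite_integral_continuous_1
        integrable_continuous_real continuous_intros)+
  note rad = this
  have crad: "continuous_on {0..pi} (pr_rad a P c)"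
    unfolding pr_rad_def[abs_def]
    by (intro continuous_intros indefinite_integral_continuous_1 integrable_continuous_real
        continuous_on_pr_log_deriv P)
  show "uniform_limit {0..pi} (\<lambda>n. pr_u a (Q n) (c' n)) (pr_u a P c) F"
    unfolding pr_u_def[abs_def] by (intro uniform_limit_times_continuous sin css rad crad)
  show "uniform_limit {0..pi} (\<lambda>n. pr_v a (Q n) (c' n)) (pr_v a P c) F"
    unfolding pr_v_def[abs_def] by (intro uniform_limit_times_continuous cos css rad crad)
qed

text \<open>The coefficient matrix of the system has trace \<open>- P + P = 0\<close>.\<close>

lemma sl_system_wronskian:
  assumes S: "sl_system P c u v" and T: "sl_system P c U V" and x: "x \<in> {0..pi}"
  shows "u x * V x - v x * U x = u 0 * V 0 - v 0 * U 0"
proof -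
  have "\<exists>K. \<forall>x\<in>{0..pi}. u x * V x - v x * U x = K"
  proof (rule has_field_derivative_zero_constant)
    fix y assume y: "y \<in> {0..pi}"
    have "((\<lambda>x. u x * V x - v x * U x) has_real_derivative
        ((v y - P y * u y) * V y + (P y * V y - ((P y)\<^sup>2 + c) * U y) * u y) -
        ((P y * v y - ((P y)\<^sup>2 + c) * u y) * U y + (V y - P y * U y) * v y)) (at y within {0..pi})"
      by (intro DERIV_diff DERIV_mult sl_system_u[OF S y] sl_system_v[OF S y]
          sl_system_u[OF T y] sl_system_v[OF T y])
    then show "((\<lambda>x. u x * V x - v x * U x) has_real_derivative 0) (at y within {0..pi})"
      by (rule DERIV_cong) (simp add: algebra_simps)
  qed auto
  then show ?thesis using x by (metis atLeastAtMost_iff order_refl pi_ge_zero)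
qed

lemma sl_system_diff_scale:
  assumes S: "sl_system P c u v" and T: "sl_system P c U V"
  shows "sl_system P c (\<lambda>x. u x - r * U x) (\<lambda>x. v x - r * V x)"
  unfolding sl_system_def
proof (intro ballI conjI)
  fix x assume x: "x \<in> {0..pi}"
  have "((\<lambda>x. u x - r * U x) has_real_derivative (v x - P x * u x) - r * (V x - P x * U x)) (at x within {0..pi})"
    by (intro DERIV_diff DERIV_cmult sl_system_u[OF S x] sl_system_u[OF T x])
  then show "((\<lambda>x. u x - r * U x) has_real_derivative
      (v x - r * V x) - P x * (u x - r * U x)) (at x within {0..pi})"
    by (rule DERIV_cong) (simp add: algebra_simps)
  have "((\<lambda>x. v x - r * V x) has_real_derivative (P x * v x - ((P x)\<^sup>2 + c) * u x)
      - r * (P x * V x - ((P x)\<^sup>2 + c) * U x)) (at x within {0..pi})"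
    by (intro DERIV_diff DERIV_cmult sl_system_v[OF S x] sl_system_v[OF T x])
  then show "((\<lambda>x. v x - r * V x) has_real_derivative
      P x * (v x - r * V x) - ((P x)\<^sup>2 + c) * (u x - r * U x)) (at x within {0..pi})"
    by (rule DERIV_cong) (simp add: algebra_simps)
qed

text \<open>The energy \<open>r = u^2 + v^2\<close> satisfies \<open>r' \<ge> - L * r\<close>, so
  vanishing at \<open>pi\<close> propagates to the left.\<close>

lemma sl_system_zero:
  assumes P: "continuous_on {0..pi} P" and S: "sl_system P c u v"
    and z: "u pi = 0" "v pi = 0" and x: "x \<in> {0..pi}"
  shows "u x = 0"
proof -
  obtain M where M: "M \<ge> 0" "\<And>x. x \<in> {0..pi} \<Longrightarrow> \<bar>P x\<bar> \<le> M"
    using continuous_on_Icc_bound[OF P] by blast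
  \<comment> \<open>Bounds the two coefficients of \<open>r'\<close>: \<open>1 - P^2 - c\<close>
    multiplies \<open>2 u v\<close>, and \<open>2 P\<close> multiplies \<open>v^2 - u^2\<close>;
    both of these quadratic terms are at most \<open>r\<close> in modulus.\<close>
  define L where "L = 1 + M * M + \<bar>c\<bar> + 2 * M"
  define r where "r x = u x * u x + v x * v x" for x
  define r' where "r' x = 2 * (u x * v x) * (1 - P x * P x - c) + 2 * P x * (v x * v x - u x * u x)" for x
  have "exp (L * x) * r x \<le> exp (L * pi) * r pi"
  proof (rule exp_weighted_mono[where a=0 and b=pi and d'=r'])
    fix y assume y: "y \<in> {0..pi}"
    have "(r has_real_derivative ((v y - P y * u y) * u y + (v y - P y * u y) * u y) +
        ((P y * v y - ((P y)\<^sup>2 + c) * u y) * v y + (P y * v y - ((P y)\<^sup>2 + c) * u y) * v y)) (at y within {0..pi})"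
      unfolding r_def by (intro DERIV_add DERIV_mult sl_system_u[OF S y] sl_system_v[OF S y])
    then show "(r has_real_derivative r' y) (at y within {0..pi})"
      by (rule DERIV_cong) (simp add: r'_def power2_eq_square algebra_simps)
    have uv: "\<bar>2 * (u y * v y)\<bar> \<le> r y"
    proof -
      have "0 \<le> (u y - v y)\<^sup>2" "0 \<le> (u y + v y)\<^sup>2" by simp_all
      then show ?thesis unfolding r_def power2_diff power2_sum by (simp add: abs_le_iff power2_eq_square)
    qed
    have vv: "\<bar>v y * v y - u y * u y\<bar> \<le> r y" unfolding r_def
      by (smt (verit) zero_le_square)
    have r0: "r y \<ge> 0" by (simp add: r_def)
    have "P y * P y \<le> M * M"
      using mult_mono[OF M(2)[OF y] M(2)[OF y]] M(1) by (simp add: abs_mult[symmetric])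
    moreover have "0 \<le> P y * P y" by simp
    ultimately have "\<bar>1 - P y * P y - c\<bar> \<le> 1 + M * M + \<bar>c\<bar>" by linarith
    then have 1: "\<bar>2 * (u y * v y) * (1 - P y * P y - c)\<bar> \<le> r y * (1 + M * M + \<bar>c\<bar>)"
      unfolding abs_mult[of "2 * (u y * v y)"] using uv r0 by (intro mult_mono) auto
    have 2: "\<bar>2 * P y * (v y * v y - u y * u y)\<bar> \<le> 2 * M * r y"
      unfolding abs_mult[of "2 * P y"] using M(1) M(2)[OF y] vv by (intro mult_mono) (auto simp: abs_mult)
    have "\<bar>r' y\<bar> \<le> r y * (1 + M * M + \<bar>c\<bar>) + 2 * M * r y"
      unfolding r'_def by (rule order_trans[OF abs_triangle_ineq add_mono[OF 1 2]])
    also have "\<dots> = L * r y" by (simp add: L_def algebra_simps)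
    finally show "r' y \<ge> - L * r y" by linarith
  qed (use x in auto)
  then have "exp (L * x) * r x \<le> 0" using z by (simp add: r_def)
  then have "r x \<le> 0" by (simp add: mult_le_0_iff)
  then have "u x * u x \<le> 0" unfolding r_def by (smt (verit) zero_le_square)
  then show ?thesis by (auto simp: mult_le_0_iff)
qed

section \<open>Boundary conditions and the enumeration of the eigenvalues\<close>

lemma orthogonal_imp_parallel:
  fixes s t :: real
  assumes "x1 * s + y1 * t = 0" "x2 * s + y2 * t = 0" "s\<^sup>2 + t\<^sup>2 = 1"
  shows "x1 * y2 - y1 * x2 = 0"
proof -
  have "s * (x1 * y2 - y1 * x2) = y2 * (x1 * s + y1 * t) - y1 * (x2 * s + y2 * t)"
    "t * (x1 * y2 - y1 * x2) = x1 * (x2 * s + y2 * t) - x2 * (x1 * s + y1 * t)"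
    by (simp_all add: algebra_simps)
  then have "s * (x1 * y2 - y1 * x2) = 0" "t * (x1 * y2 - y1 * x2) = 0" using assms by simp_all
  moreover have "s \<noteq> 0 \<or> t \<noteq> 0" using assms(3) by auto
  ultimately show ?thesis by auto
qed

text \<open>The vectors \<open>(sin a, cos a)\<close> and \<open>(sin b, cos b)\<close> both span the directions \<open>(u, u')\<close> allowed by
  the boundary condition; \<open>a\<close> is the initial Pruefer angle and \<open>b\<close> the smallest admissible value at
  \<open>pi\<close>, which differs from \<open>a\<close> only for the Dirichlet condition.\<close>

locale sl_bc =
  fixes \<alpha> a b :: real
  assumes a: "0 \<le> a" "a < pi" and a_bc: "sin (a + \<alpha>) = 0"
    and b: "b = (if a > 0 then a else pi)"
begin

lemma b_pos: "0 < b" and b_le: "b \<le> pi"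
  using a by (auto simp: b)

lemma b_bc: "sin (b + \<alpha>) = 0"
  using a a_bc by (auto simp: b sin_add)

text \<open>Admissible angles differ by multiples of \<open>pi\<close>, and \<open>b\<close>, lying
  above 0 and not above \<open>pi\<close>, is the smallest positive one. The index starts at 1,
  hence \<open>k - 1\<close> half-turns beyond \<open>b\<close>.\<close>

lemma bc_angle_iff:
  assumes "y > 0"
  shows "sin (y + \<alpha>) = 0 \<longleftrightarrow> (\<exists>k\<ge>1. y = b + real (k - 1) * pi)"
proof
  assume "sin (y + \<alpha>) = 0"
  then obtain i where i: "y + \<alpha> = of_int i * pi" by (auto simp: sin_zero_iff_int2)
  obtain j where j: "b + \<alpha> = of_int j * pi" using b_bc by (auto simp: sin_zero_iff_int2)
  have eq: "y = b + of_int (i - j) * pi" using i j by (simp add: algebra_simps)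
  have "i - j \<ge> 0"
  proof (rule ccontr)
    assume "\<not> i - j \<ge> 0"
    then have "of_int (i - j) \<le> (-1 :: real)" by linarith
    then have "of_int (i - j) * pi \<le> -1 * pi" by (intro mult_right_mono) auto
    then show False using eq assms b_le by linarith
  qed
  then have "real (nat (i - j) + 1 - 1) = of_int (i - j)" by simp
  then show "\<exists>k\<ge>1. y = b + real (k - 1) * pi" using eq by (intro exI[of _ "nat (i - j) + 1"]) simp
next
  assume "\<exists>k\<ge>1. y = b + real (k - 1) * pi"
  then obtain k where "y = b + real (k - 1) * pi" by blast
  then have y: "y + \<alpha> = (b + \<alpha>) + real (k - 1) * pi" by simp
  show "sin (y + \<alpha>) = 0" unfolding y by (subst sin_add) (simp add: b_bc)
qed

lemma pruefer_pi_pos: "continuous_on {0..pi} P \<Longrightarrow> pruefer a P c pi > 0"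
  using pr_sol_crossing[of P c "pruefer a P c" 0 pi 0] pr_sol_pruefer[of P c a] a
  by (simp add: pruefer_0)

definition ev :: "nat \<Rightarrow> (real \<Rightarrow> real) \<Rightarrow> real" where
  "ev k P = (THE c. pruefer a P c pi = b + real (k - 1) * pi)"

lemma ev:
  assumes P: "continuous_on {0..pi} P"
  shows ev_eq: "pruefer a P (ev k P) pi = b + real (k - 1) * pi"
    and ev_unique: "pruefer a P c pi = b + real (k - 1) * pi \<Longrightarrow> c = ev k P"
proof -
  have "b + real (k - 1) * pi > 0" using b_pos by (simp add: add_pos_nonneg)
  note ex = pruefer_hits[OF P a this]
  show 1: "pruefer a P (ev k P) pi = b + real (k - 1) * pi"
    unfolding ev_def by (rule theI'[OF ex])
  show "pruefer a P c pi = b + real (k - 1) * pi \<Longrightarrow> c = ev k P"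
    using ex 1 by blast
qed

lemma pruefer_less_iff:
  "continuous_on {0..pi} P \<Longrightarrow> pruefer a P c pi < pruefer a P d pi \<longleftrightarrow> c < d"
  using pruefer_strict_mono[of P c d a] pruefer_strict_mono[of P d c a] by (cases c d rule: linorder_cases) auto

lemma ev_less_iff:
  assumes P: "continuous_on {0..pi} P" and "j \<ge> 1" "k \<ge> 1"
  shows "ev j P < ev k P \<longleftrightarrow> j < k"
proof -
  have "ev j P < ev k P \<longleftrightarrow> real (j - 1) * pi < real (k - 1) * pi"
    using pruefer_less_iff[OF P, of "ev j P" "ev k P"] by (simp add: ev_eq[OF P])
  then show ?thesis using assms by auto
qed

text \<open>A strict inequality between \<open>l\<close> and \<open>ev k P\<close> is equivalent to
  a strict inequality between the terminal angle for the fixed parameter \<open>l\<close> and the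
  target angle. The latter persists under uniform convergence of the coefficients.\<close>

lemma ev_tendsto:
  assumes P: "continuous_on {0..pi} P" and Q: "\<And>n. continuous_on {0..pi} (Q n)"
    and lim: "uniform_limit {0..pi} Q P F"
  shows "((\<lambda>n. ev k (Q n)) \<longlongrightarrow> ev k P) F"
proof -
  have lim': "((\<lambda>n. pruefer a (Q n) c pi) \<longlongrightarrow> pruefer a P c pi) F" for c
    using pruefer_uniform_limit[OF P Q lim, of "\<lambda>_. c" c a] by (auto intro: tendsto_uniform_limitI)
  show ?thesis
  proof (rule order_tendstoI)
    fix l assume "l < ev k P"
    then have "pruefer a P l pi < b + real (k - 1) * pi"
      using pruefer_less_iff[OF P, of l "ev k P"] by (simp add: ev_eq[OF P])
    from order_tendstoD(2)[OF lim' this] show "\<forall>\<^sub>F n in F. l < ev k (Q n)"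
    proof eventually_elim
      case (elim n)
      then show ?case using pruefer_less_iff[OF Q, of n l "ev k (Q n)"] by (simp add: ev_eq[OF Q])
    qed
  next
    fix l assume "ev k P < l"
    then have "b + real (k - 1) * pi < pruefer a P l pi"
      using pruefer_less_iff[OF P, of "ev k P" l] by (simp add: ev_eq[OF P])
    from order_tendstoD(1)[OF lim' this] show "\<forall>\<^sub>F n in F. ev k (Q n) < l"
    proof eventually_elim
      case (elim n)
      then show ?case using pruefer_less_iff[OF Q, of n "ev k (Q n)" l] by (simp add: ev_eq[OF Q])
    qed
  qed
qed

text \<open>Normalised by its initial amplitude, not by its norm; this is why the derivative of the
  eigenvalue carries the integral of the square as denominator.\<close>

definition eigfun :: "nat \<Rightarrow> (real \<Rightarrow> real) \<Rightarrow> real \<Rightarrow> real" where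
  "eigfun k q = pr_u a (sl_prim q) (ev k (sl_prim q))"

definition eigfun_v :: "nat \<Rightarrow> (real \<Rightarrow> real) \<Rightarrow> real \<Rightarrow> real" where
  "eigfun_v k q = pr_v a (sl_prim q) (ev k (sl_prim q))"

lemma eigfun_system:
  "q \<in> L2 \<Longrightarrow> sl_system (sl_prim q) (ev k (sl_prim q)) (eigfun k q) (eigfun_v k q)"
  unfolding eigfun_def eigfun_v_def by (intro pr_sl_system sl_prim_continuous)

lemma pr_bc_left:
  "continuous_on {0..pi} P \<Longrightarrow> pr_u a P c 0 * cos \<alpha> + pr_v a P c 0 * sin \<alpha> = 0"
proof -
  assume P: "continuous_on {0..pi} P"
  have "pr_u a P c 0 * cos \<alpha> + pr_v a P c 0 * sin \<alpha> = pr_rad a P c 0 * sin (a + \<alpha>)"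
    by (simp add: pr_u_def pr_v_def pruefer_0[OF P] sin_add algebra_simps)
  then show ?thesis using a_bc by simp
qed

lemma pr_bc_right:
  "pr_u a P c pi * cos \<alpha> + pr_v a P c pi * sin \<alpha> = pr_rad a P c pi * sin (pruefer a P c pi + \<alpha>)"
  by (simp add: pr_u_def pr_v_def sin_add algebra_simps)

lemma eigfun_bc:
  assumes q: "q \<in> L2" and k: "k \<ge> 1"
  shows "eigfun k q 0 * cos \<alpha> + eigfun_v k q 0 * sin \<alpha> = 0"
    and "eigfun k q pi * cos \<alpha> + eigfun_v k q pi * sin \<alpha> = 0"
proof -
  note P = sl_prim_continuous[OF q]
  show "eigfun k q 0 * cos \<alpha> + eigfun_v k q 0 * sin \<alpha> = 0"
    unfolding eigfun_def eigfun_v_def by (rule pr_bc_left[OF P])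
  have "sin (pruefer a (sl_prim q) (ev k (sl_prim q)) pi + \<alpha>) = 0"
    using bc_angle_iff[OF pruefer_pi_pos[OF P]] ev_eq[OF P] k by blast
  then show "eigfun k q pi * cos \<alpha> + eigfun_v k q pi * sin \<alpha> = 0"
    unfolding eigfun_def eigfun_v_def pr_bc_right by simp
qed

lemma eigfun_zeros:
  assumes q: "q \<in> L2" and k: "k \<ge> 1"
  shows "finite {x \<in> {0<..<pi}. eigfun k q x = 0}" "card {x \<in> {0<..<pi}. eigfun k q x = 0} = k - 1"
proof -
  note P = sl_prim_continuous[OF q]
  have "pr_rad a P c x \<noteq> 0" for P c x using pr_rad_pos[of a P c x] by linarith
  then have "{x \<in> {0<..<pi}. eigfun k q x = 0}
      = {x \<in> {0<..<pi}. sin (pruefer a (sl_prim q) (ev k (sl_prim q)) x) = 0}"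
    by (simp add: eigfun_def pr_u_def)
  moreover note pr_sol_card_zeros[OF P pr_sol_pruefer[OF P] _ _ b_pos b_le k, of a "ev k (sl_prim q)"]
  ultimately show "finite {x \<in> {0<..<pi}. eigfun k q x = 0}"
    "card {x \<in> {0<..<pi}. eigfun k q x = 0} = k - 1"
    using a ev_eq[OF P] by (simp_all add: pruefer_0[OF P])
qed

lemma eigfun_nonzero:
  assumes q: "q \<in> L2" and k: "k \<ge> 1"
  shows "\<exists>x\<in>{0<..<pi}. eigfun k q x \<noteq> 0"
proof (rule ccontr)
  assume "\<not> ?thesis"
  then have "{x \<in> {0<..<pi}. eigfun k q x = 0} = {0<..<pi}" by auto
  then have "finite {0<..<pi}" using eigfun_zeros(1)[OF q k] by simp
  then show False using infinite_Ioo[of 0 pi] by simp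
qed

lemma eigfun_eigenfunction:
  assumes q: "q \<in> L2" and k: "k \<ge> 1"
  defines "u' \<equiv> \<lambda>x. eigfun_v k q x - sl_prim q x * eigfun k q x"
    and "u'' \<equiv> \<lambda>x. (q x - (sl_mean q + ev k (sl_prim q))) * eigfun k q x"
  shows "W22 (eigfun k q) u' u''" "separated_bc \<alpha> (eigfun k q) u'"
    "SL_eigenfunction \<alpha> q (sl_mean q + ev k (sl_prim q)) (eigfun k q)"
proof -
  show W: "W22 (eigfun k q) u' u''"
    unfolding u'_def u''_def by (rule sl_system_imp_W22[OF q]) (simp add: eigfun_system[OF q])
  show B: "separated_bc \<alpha> (eigfun k q) u'"
    using eigfun_bc[OF q k] by (simp add: separated_bc_def u'_def sl_prim_pi[OF q])
  have "nonzero (eigfun k q)" using eigfun_nonzero[OF q k] by (force simp: nonzero_def)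
  moreover have "AE x in leb0. - u'' x + q x * eigfun k q x = (sl_mean q + ev k (sl_prim q)) * eigfun k q x"
    by (rule AE_I2) (simp add: u''_def algebra_simps)
  ultimately show "SL_eigenfunction \<alpha> q (sl_mean q + ev k (sl_prim q)) (eigfun k q)"
    using W B unfolding SL_eigenfunction_def by blast
qed

text \<open>The left condition makes the Wronskian with the shooting solution \<open>U\<close>
  vanish at 0, hence at \<open>pi\<close>. So \<open>(u, v)\<close> is a multiple of
  \<open>(U, V)\<close> at \<open>pi\<close>, and by backward uniqueness \<open>u\<close> is that
  multiple of \<open>U\<close> everywhere; the multiple is non-zero, so \<open>U\<close> inherits
  the right condition.\<close>

lemma SL_eigenfunction_imp_bc:
  assumes q: "q \<in> L2" and E: "SL_eigenfunction \<alpha> q lam u"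
  shows "sin (pruefer a (sl_prim q) (lam - sl_mean q) pi + \<alpha>) = 0"
proof -
  define P where "P = sl_prim q"
  define c where "c = lam - sl_mean q"
  have P: "continuous_on {0..pi} P" unfolding P_def by (rule sl_prim_continuous[OF q])
  obtain u' u'' where nz: "nonzero u" and W: "W22 u u' u''" and B: "separated_bc \<alpha> u u'"
    and eq: "AE x in leb0. - u'' x + q x * u x = lam * u x"
    using E unfolding SL_eigenfunction_def by blast
  define v where "v x = u' x + P x * u x" for x
  have S: "sl_system P c u v"
    unfolding v_def P_def c_def by (rule W22_imp_sl_system[OF q W eq])
  have bc: "u 0 * cos \<alpha> + v 0 * sin \<alpha> = 0" "u pi * cos \<alpha> + v pi * sin \<alpha> = 0"
    using B unfolding separated_bc_def v_def P_def by (simp_all add: sl_prim_pi[OF q])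
  define U where "U = pr_u a P c"
  define V where "V = pr_v a P c"
  have T: "sl_system P c U V" unfolding U_def V_def by (rule pr_sl_system[OF P])
  have "u 0 * V 0 - v 0 * U 0 = 0"
    using bc(1) pr_bc_left[OF P] unfolding U_def V_def by (rule orthogonal_imp_parallel) simp
  then have w: "u pi * V pi = v pi * U pi"
    using sl_system_wronskian[OF S T, of pi] by simp
  define R where "R = pr_rad a P c pi"
  have R: "R > 0" by (simp add: R_def)
  have UV: "U pi * U pi + V pi * V pi = R * R"
  proof -
    have "(R * s) * (R * s) + (R * t) * (R * t) = R * R * (s\<^sup>2 + t\<^sup>2)" for s t
      by (simp add: power2_eq_square algebra_simps)
    then show ?thesis unfolding U_def V_def pr_u_def pr_v_def R_def[symmetric] by simp
  qed
  \<comment> \<open>Projection coefficient of \<open>(u, v)\<close> on \<open>(U, V)\<close> at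
    \<open>pi\<close>, exact because the two vectors are parallel.\<close>
  define r where "r = (u pi * U pi + v pi * V pi) / (R * R)"
  have "u pi * (U pi * U pi + V pi * V pi) = (u pi * U pi + v pi * V pi) * U pi"
    "v pi * (U pi * U pi + V pi * V pi) = (u pi * U pi + v pi * V pi) * V pi"
    using w by algebra+
  then have "u pi = r * U pi" "v pi = r * V pi"
    using R unfolding r_def UV by (simp_all add: field_simps)
  then have ur: "u x = r * U x" if "x \<in> {0..pi}" for x
    using sl_system_zero[OF P sl_system_diff_scale[OF S T, of r] _ _ that] by simp
  have "r \<noteq> 0" using nz ur unfolding nonzero_def by auto
  moreover have "r * (U pi * cos \<alpha> + V pi * sin \<alpha>) = 0"
    using bc(2) \<open>u pi = r * U pi\<close> \<open>v pi = r * V pi\<close> by (simp add: algebra_simps)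
  ultimately have "R * sin (pruefer a P c pi + \<alpha>) = 0"
    using pr_bc_right[of P c] unfolding U_def V_def R_def by simp
  then show ?thesis using R unfolding P_def c_def by simp
qed

lemma SL_eigenvalues_eq:
  assumes q: "q \<in> L2"
  shows "SL_eigenvalues \<alpha> q = (\<lambda>k. sl_mean q + ev k (sl_prim q)) ` {1..}"
proof (intro equalityI subsetI)
  note P = sl_prim_continuous[OF q]
  fix lam assume "lam \<in> SL_eigenvalues \<alpha> q"
  then have "sin (pruefer a (sl_prim q) (lam - sl_mean q) pi + \<alpha>) = 0"
    using SL_eigenfunction_imp_bc[OF q] unfolding SL_eigenvalues_def by blast
  then obtain k where k: "k \<ge> 1" "pruefer a (sl_prim q) (lam - sl_mean q) pi = b + real (k - 1) * pi"
    using bc_angle_iff[OF pruefer_pi_pos[OF P]] by blast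
  have "lam = sl_mean q + ev k (sl_prim q)" using ev_unique[OF P k(2)] by simp
  then show "lam \<in> (\<lambda>k. sl_mean q + ev k (sl_prim q)) ` {1..}" using k(1) by auto
next
  fix lam assume "lam \<in> (\<lambda>k. sl_mean q + ev k (sl_prim q)) ` {1..}"
  then show "lam \<in> SL_eigenvalues \<alpha> q"
    using eigfun_eigenfunction(3)[OF q] unfolding SL_eigenvalues_def by auto
qed

text \<open>As \<open>ev\<close> is strictly increasing in the index, the eigenvalues below the k-th
  are those with indices 1 to \<open>k - 1\<close>. The count determines the index, so the definite
  description picks a single number.\<close>

lemma SL_eigenvalue_eq:
  assumes q: "q \<in> L2" and k: "k \<ge> 1"
  shows "SL_eigenvalue \<alpha> k q = sl_mean q + ev k (sl_prim q)"
proof -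
  note P = sl_prim_continuous[OF q]
  let ?e = "\<lambda>k. sl_mean q + ev k (sl_prim q)"
  have below: "{\<mu> \<in> SL_eigenvalues \<alpha> q. \<mu> < ?e k} = ?e ` {1..<k}" if "k \<ge> 1" for k
    using ev_less_iff[OF P _ that] unfolding SL_eigenvalues_eq[OF q] by auto
  have inj: "inj_on ?e {1..<k}" for k
  proof (rule inj_onI)
    fix i j assume "i \<in> {1..<k}" "j \<in> {1..<k}" "?e i = ?e j"
    then show "i = j"
      using ev_less_iff[OF P, of i j] ev_less_iff[OF P, of j i] by (cases i j rule: linorder_cases) auto
  qed
  have card: "card {\<mu> \<in> SL_eigenvalues \<alpha> q. \<mu> < ?e k} = k - 1" if "k \<ge> 1" for k
    unfolding below[OF that] card_image[OF inj] by simp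
  show ?thesis
    unfolding SL_eigenvalue_def
  proof (rule the_equality)
    show "?e k \<in> SL_eigenvalues \<alpha> q \<and> finite {\<mu> \<in> SL_eigenvalues \<alpha> q. \<mu> < ?e k} \<and>
        card {\<mu> \<in> SL_eigenvalues \<alpha> q. \<mu> < ?e k} = k - 1"
      using card[OF k] below[OF k] k unfolding SL_eigenvalues_eq[OF q] by auto
  next
    fix lam assume L: "lam \<in> SL_eigenvalues \<alpha> q \<and> finite {\<mu> \<in> SL_eigenvalues \<alpha> q. \<mu> < lam} \<and>
        card {\<mu> \<in> SL_eigenvalues \<alpha> q. \<mu> < lam} = k - 1"
    then obtain j where j: "j \<ge> 1" "lam = ?e j" unfolding SL_eigenvalues_eq[OF q] by auto
    then have "j - 1 = k - 1" using L card[OF j(1)] by simp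
    then have "j = k" using j k by simp
    then show "lam = ?e k" using j by simp
  qed
qed

end

section \<open>The derivative of an eigenvalue\<close>

lemma sl_prim_add_scale:
  assumes q: "q \<in> L2" and h: "h \<in> L2"
  shows "sl_mean (\<lambda>x. q x + t * h x) = sl_mean q + t * sl_mean h"
    and "x \<in> {0..pi} \<Longrightarrow> sl_prim (\<lambda>x. q x + t * h x) x = sl_prim q x + t * sl_prim h x"
proof -
  show m: "sl_mean (\<lambda>x. q x + t * h x) = sl_mean q + t * sl_mean h"
    using L2_integrable_on[OF q] L2_integrable_on[OF L2_scale[OF h]]
    unfolding sl_mean_def by (subst integral_add) (simp_all add: add_divide_distrib)
  assume x: "x \<in> {0..pi}"
  then have int: "f integrable_on {0..x}" if "f \<in> L2" for f
    using integrable_on_subinterval[OF L2_integrable_on[OF that]] by auto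
  have "sl_prim (\<lambda>x. q x + t * h x) x = integral {0..x} (\<lambda>s. (sl_mean q - q s) + t * (sl_mean h - h s))"
    unfolding sl_prim_def m by (simp add: algebra_simps)
  also have "\<dots> = sl_prim q x + t * sl_prim h x"
    unfolding sl_prim_def
    using int[OF sl_prim_integrand_L2[OF q]] int[OF L2_scale[OF sl_prim_integrand_L2[OF h]]]
    by (subst integral_add) auto
  finally show "sl_prim (\<lambda>x. q x + t * h x) x = sl_prim q x + t * sl_prim h x" .
qed

text \<open>Integrate the derivative of the Wronskian of solutions of two different systems. Only
  the differences of \<open>P\<close> and \<open>Q\<close> and of \<open>c\<close> and
  \<open>d\<close> survive, so no potential appears.\<close>

lemma sl_system_green:
  assumes P: "continuous_on {0..pi} P" and Q: "continuous_on {0..pi} Q"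
    and S: "sl_system P c u v" and T: "sl_system Q d U V"
    and bc: "u 0 * V 0 - v 0 * U 0 = 0" "u pi * V pi - v pi * U pi = 0"
  shows "(d - c) * integral {0..pi} (\<lambda>x. u x * U x)
    = integral {0..pi} (\<lambda>x. (Q x - P x) * ((v x - P x * u x) * U x + u x * (V x - Q x * U x)))"
proof -
  note cont = sl_system_continuous[OF S] sl_system_continuous[OF T]
  let ?w = "\<lambda>x. (Q x - P x) * ((v x - P x * u x) * U x + u x * (V x - Q x * U x))"
  have "((\<lambda>x. ?w x - (d - c) * (u x * U x)) has_integral
      ((u pi * V pi - v pi * U pi) - (u 0 * V 0 - v 0 * U 0))) {0..pi}"
  proof (rule fundamental_theorem_of_calculus)
    fix y assume y: "y \<in> {0..pi}"
    have "((\<lambda>x. u x * V x - v x * U x) has_real_derivative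
        ((v y - P y * u y) * V y + (Q y * V y - ((Q y)\<^sup>2 + d) * U y) * u y) -
        ((P y * v y - ((P y)\<^sup>2 + c) * u y) * U y + (V y - Q y * U y) * v y)) (at y within {0..pi})"
      by (intro DERIV_diff DERIV_mult sl_system_u[OF S y] sl_system_v[OF S y]
          sl_system_u[OF T y] sl_system_v[OF T y])
    then have "((\<lambda>x. u x * V x - v x * U x) has_real_derivative ?w y - (d - c) * (u y * U y)) (at y within {0..pi})"
      by (rule DERIV_cong) (simp add: algebra_simps power2_eq_square)
    then show "((\<lambda>x. u x * V x - v x * U x) has_vector_derivative ?w y - (d - c) * (u y * U y)) (at y within {0..pi})"
      by (simp add: has_real_derivative_iff_has_vector_derivative)
  qed simp
  then have "integral {0..pi} (\<lambda>x. ?w x - (d - c) * (u x * U x)) = 0"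
    using bc by (simp add: integral_unique)
  moreover have "integral {0..pi} (\<lambda>x. ?w x - (d - c) * (u x * U x))
      = integral {0..pi} ?w - (d - c) * integral {0..pi} (\<lambda>x. u x * U x)"
    by (subst integral_diff) (auto intro!: integrable_continuous_real continuous_intros cont P Q)
  ultimately show ?thesis by simp
qed

lemma integral_tendsto_uniform:
  fixes f :: "'i \<Rightarrow> real \<Rightarrow> real"
  assumes "uniform_limit {0..pi} f g F" "\<And>n. continuous_on {0..pi} (f n)" "continuous_on {0..pi} g"
  shows "((\<lambda>n. integral {0..pi} (f n)) \<longlongrightarrow> integral {0..pi} g) F"
  using tendsto_uniform_limitI[OF uniform_limit_indefinite_integral[OF assms], of pi] by simp

context sl_bc
begin

lemma eigfun_continuous:
  assumes "q \<in> L2"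
  shows "continuous_on {0..pi} (eigfun k q)" "continuous_on {0..pi} (eigfun_v k q)"
  using sl_system_continuous[OF eigfun_system[OF assms]] by auto

lemma eigfun_square_integral_pos:
  assumes q: "q \<in> L2" and k: "k \<ge> 1"
  shows "integral {0..pi} (\<lambda>x. (eigfun k q x)\<^sup>2) > 0"
proof -
  have c: "continuous_on {0..pi} (\<lambda>x. (eigfun k q x)\<^sup>2)"
    by (intro continuous_intros eigfun_continuous[OF q])
  have "integral {0..pi} (\<lambda>x. (eigfun k q x)\<^sup>2) \<noteq> 0"
    using integral_eq_0_iff[OF c] eigfun_nonzero[OF q k] by force
  moreover have "integral {0..pi} (\<lambda>x. (eigfun k q x)\<^sup>2) \<ge> 0"
    by (intro integral_nonneg integrable_continuous_real c) auto
  ultimately show ?thesis by simp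
qed

text \<open>Green's identity between the parameters 0 and \<open>t\<close> reads
  \<open>(ct t - c) * A t = t * B t\<close>. Uniform convergence of the eigenfunctions gives limits
  of \<open>A\<close> and \<open>B\<close>, that of \<open>A\<close> being positive, so the
  difference quotient of \<open>ct\<close> tends to \<open>B0 / A0\<close>. The mean of the
  potential contributes \<open>sl_mean h\<close>, which cancels against the mean contained in
  \<open>B0\<close>.\<close>

lemma SL_eigenvalue_has_derivative_0:
  assumes q: "q \<in> L2" and h: "h \<in> L2" and k: "k \<ge> 1"
  shows "((\<lambda>t. SL_eigenvalue \<alpha> k (\<lambda>x. q x + t * h x)) has_real_derivative
    integral {0..pi} (\<lambda>x. h x * (eigfun k q x)\<^sup>2) / integral {0..pi} (\<lambda>x. (eigfun k q x)\<^sup>2)) (at 0)"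
proof -
  define qt where "qt t = (\<lambda>x. q x + t * h x)" for t
  define P where "P = sl_prim q"
  define H where "H = sl_prim h"
  define Pt where "Pt t = sl_prim (qt t)" for t
  define c where "c = ev k P"
  define ct where "ct t = ev k (Pt t)" for t
  define u where "u = eigfun k q"
  define v where "v = eigfun_v k q"
  define ut where "ut t = eigfun k (qt t)" for t
  define vt where "vt t = eigfun_v k (qt t)" for t
  have qt: "qt t \<in> L2" for t unfolding qt_def by (intro L2_add L2_scale q h)
  have cP: "continuous_on {0..pi} P" and cH: "continuous_on {0..pi} H" and cPt: "\<And>t. continuous_on {0..pi} (Pt t)"
    unfolding P_def H_def Pt_def by (intro sl_prim_continuous q h qt)+
  have Pt: "Pt t x = P x + t * H x" if "x \<in> {0..pi}" for t x
    unfolding Pt_def P_def H_def qt_def by (rule sl_prim_add_scale(2)[OF q h that])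
  have lim: "uniform_limit {0..pi} Pt P (at 0)"
  proof -
    have "uniform_limit {0..pi} (\<lambda>t x. P x + t * H x) (\<lambda>x. P x + 0 * H x) (at 0)"
      by (intro uniform_limit_add uniform_limit_const uniform_limit_times_continuous
          uniform_limit_const_seq tendsto_ident_at continuous_on_const cH)
    then show ?thesis by (subst uniform_limit_cong'[where g = "\<lambda>t x. P x + t * H x" and i = "\<lambda>x. P x + 0 * H x"]) (auto simp: Pt)
  qed
  have limc: "(ct \<longlongrightarrow> c) (at 0)"
    unfolding ct_def c_def by (rule ev_tendsto[OF cP cPt lim])
  have limu: "uniform_limit {0..pi} ut u (at 0)" and limv: "uniform_limit {0..pi} vt v (at 0)"
    using pr_uv_uniform_limit[OF cP cPt lim limc]
    unfolding ut_def u_def vt_def v_def eigfun_def eigfun_v_def Pt_def[symmetric] P_def[symmetric]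
      c_def[symmetric] ct_def[symmetric] by auto
  have cu: "continuous_on {0..pi} u" and cv: "continuous_on {0..pi} v"
    and cut: "\<And>t. continuous_on {0..pi} (ut t)" and cvt: "\<And>t. continuous_on {0..pi} (vt t)"
    unfolding u_def v_def ut_def vt_def by (intro eigfun_continuous q qt)+
  define A where "A t = integral {0..pi} (\<lambda>x. u x * ut t x)" for t
  define B where "B t = integral {0..pi} (\<lambda>x. H x * ((v x - P x * u x) * ut t x + u x * (vt t x - Pt t x * ut t x)))" for t
  define A0 where "A0 = integral {0..pi} (\<lambda>x. u x * u x)"
  define B0 where "B0 = integral {0..pi} (\<lambda>x. H x * ((v x - P x * u x) * u x + u x * (v x - P x * u x)))"
  have AB: "(ct t - c) * A t = t * B t" for t
  proof -
    have "u x * vt t x - v x * ut t x = 0" if "x = 0 \<or> x = pi" for x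
      unfolding u_def v_def ut_def vt_def
      by (rule orthogonal_imp_parallel[of _ "cos \<alpha>" _ "sin \<alpha>"])
        (use that eigfun_bc[OF q k] eigfun_bc[OF qt k, of t] in auto)
    then have "(ct t - c) * A t =
        integral {0..pi} (\<lambda>x. (Pt t x - P x) * ((v x - P x * u x) * ut t x + u x * (vt t x - Pt t x * ut t x)))"
      unfolding A_def
      using eigfun_system[OF q, of k] eigfun_system[OF qt, of t k]
      by (intro sl_system_green[OF cP cPt])
        (simp_all add: u_def v_def ut_def vt_def c_def ct_def P_def Pt_def)
    also have "\<dots> = integral {0..pi} (\<lambda>x. t * (H x * ((v x - P x * u x) * ut t x + u x * (vt t x - Pt t x * ut t x))))"
      by (rule integral_cong) (simp add: Pt algebra_simps)
    also have "\<dots> = t * B t" unfolding B_def by simp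
    finally show ?thesis .
  qed
  have limA: "(A \<longlongrightarrow> A0) (at 0)"
    unfolding A_def A0_def
    by (rule integral_tendsto_uniform)
      (intro uniform_limit_times_continuous uniform_limit_const limu continuous_intros cu cut)+
  have limB: "(B \<longlongrightarrow> B0) (at 0)"
    unfolding B_def B0_def
    by (rule integral_tendsto_uniform)
      (intro uniform_limit_times_continuous uniform_limit_const uniform_limit_add uniform_limit_minus
        limu limv lim continuous_intros cu cut cv cvt cP cPt cH)+
  have A0: "A0 > 0"
    using eigfun_square_integral_pos[OF q k] unfolding A0_def u_def by (simp add: power2_eq_square)
  \<comment> \<open>Integration by parts of the primitive \<open>H\<close> against the derivative of
    \<open>u * u\<close>; the boundary terms vanish since \<open>H\<close> is 0 at both
    ends.\<close>
  have B0: "B0 = integral {0..pi} (\<lambda>x. h x * (u x * u x)) - sl_mean h * A0"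
  proof -
    have S: "sl_system P c u v" unfolding P_def c_def u_def v_def by (rule eigfun_system[OF q])
    have "integral {0..pi} (\<lambda>t. sl_mean h - h t) * (u pi * u pi)
        = integral {0..pi} (\<lambda>s. (sl_mean h - h s) * (u s * u s)) +
          integral {0..pi} (\<lambda>s. integral {0..s} (\<lambda>t. sl_mean h - h t) * ((v s - P s * u s) * u s + (v s - P s * u s) * u s))"
      by (rule indefinite_integral_times[OF L2_absolutely_integrable[OF sl_prim_integrand_L2[OF h]]])
        (rule DERIV_mult sl_system_u[OF S] | intro continuous_intros cu cv cP | simp)+
    moreover have "integral {0..pi} (\<lambda>t. sl_mean h - h t) = 0"
      using sl_prim_pi[OF h] by (simp add: sl_prim_def)
    moreover have "integral {0..pi} (\<lambda>s. (sl_mean h - h s) * (u s * u s))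
        = sl_mean h * A0 - integral {0..pi} (\<lambda>x. h x * (u x * u x))"
    proof -
      have c2: "continuous_on {0..pi} (\<lambda>x. u x * u x)" by (intro continuous_intros cu)
      show ?thesis unfolding A0_def left_diff_distrib
        using L2_integrable_on[OF L2_mult_continuous[OF h c2]]
          L2_integrable_on[OF L2_scale[OF continuous_imp_L2[OF c2], of "sl_mean h"]]
        by (subst integral_diff) auto
    qed
    ultimately have "integral {0..pi} (\<lambda>x. h x * (u x * u x)) - sl_mean h * A0
        = integral {0..pi} (\<lambda>s. H s * ((v s - P s * u s) * u s + (v s - P s * u s) * u s))"
      unfolding H_def sl_prim_def by simp
    also have "\<dots> = B0" unfolding B0_def by (simp add: mult.commute)
    finally show ?thesis by simp
  qed
  have ev_t: "SL_eigenvalue \<alpha> k (qt t) = sl_mean q + t * sl_mean h + ct t" for t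
    unfolding SL_eigenvalue_eq[OF qt k] ct_def Pt_def
    using sl_prim_add_scale(1)[OF q h] by (simp add: qt_def)
  have ct0: "ct 0 = c" unfolding ct_def c_def Pt_def P_def qt_def by simp
  have "((\<lambda>t. sl_mean h + B t / A t) \<longlongrightarrow> sl_mean h + B0 / A0) (at 0)"
    using A0 by (intro tendsto_intros limA limB) auto
  also have "sl_mean h + B0 / A0 = integral {0..pi} (\<lambda>x. h x * (u x * u x)) / A0"
    unfolding B0 using A0 by (simp add: field_simps)
  finally have lim1: "((\<lambda>t. sl_mean h + B t / A t) \<longlongrightarrow> integral {0..pi} (\<lambda>x. h x * (u x * u x)) / A0) (at 0)" .
  have "\<forall>\<^sub>F t in at 0. sl_mean h + B t / A t = (SL_eigenvalue \<alpha> k (qt (0 + t)) - SL_eigenvalue \<alpha> k (qt 0)) / t"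
    using order_tendstoD(1)[OF limA A0] eventually_neq_at_within[of 0 "0::real" UNIV]
  proof eventually_elim
    case (elim t)
    then have "B t / A t = (ct t - c) / t" using AB[of t] by (simp add: field_simps)
    then show ?case using elim unfolding ev_t ct0 by (simp add: field_simps)
  qed
  from Lim_transform_eventually[OF lim1 this]
  have "((\<lambda>t. SL_eigenvalue \<alpha> k (qt t)) has_real_derivative integral {0..pi} (\<lambda>x. h x * (u x * u x)) / A0) (at 0)"
    unfolding DERIV_def .
  then show ?thesis unfolding qt_def A0_def u_def power2_eq_square .
qed

text \<open>The segment through \<open>q\<close> at parameter \<open>t\<close> is a segment starting
  at \<open>q + t h\<close>, so the derivative at 0 suffices.\<close>

lemma SL_eigenvalue_has_derivative:
  assumes q: "q \<in> L2" and h: "h \<in> L2" and k: "k \<ge> 1"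
  defines "u \<equiv> \<lambda>t. eigfun k (\<lambda>x. q x + t * h x)"
  shows "((\<lambda>t. SL_eigenvalue \<alpha> k (\<lambda>x. q x + t * h x)) has_real_derivative
    integral {0..pi} (\<lambda>x. h x * (u t x)\<^sup>2) / integral {0..pi} (\<lambda>x. (u t x)\<^sup>2)) (at t)"
proof -
  have "(\<lambda>x. q x + t * h x) \<in> L2" by (intro L2_add L2_scale q h)
  from SL_eigenvalue_has_derivative_0[OF this h k]
  have "((\<lambda>s. SL_eigenvalue \<alpha> k (\<lambda>x. q x + (s + t) * h x)) has_real_derivative
    integral {0..pi} (\<lambda>x. h x * (u t x)\<^sup>2) / integral {0..pi} (\<lambda>x. (u t x)\<^sup>2)) (at 0)"
    unfolding u_def by (simp add: algebra_simps)
  then show ?thesis using DERIV_shift[of "\<lambda>s. SL_eigenvalue \<alpha> k (\<lambda>x. q x + s * h x)" _ 0 t] by simp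
qed

end

section \<open>Completeness and weak compactness\<close>

lemma integral_nonneg_everywhere:
  fixes f :: "real \<Rightarrow> real"
  assumes "\<And>x. 0 \<le> f x"
  shows "0 \<le> integral S f"
  using assms by (cases "f integrable_on S") (auto simp: integral_nonneg not_integrable_integral)

text \<open>Cauchy-Schwarz against the constant 1, from the nonnegative integral of
  \<open>(f - m)^2\<close> with \<open>m\<close> the mean over \<open>{x..y}\<close>. It makes
  primitives Hoelder continuous of exponent 1/2.\<close>

lemma integral_square_le:
  assumes f: "f \<in> L2" and xy: "0 \<le> x" "x \<le> y" "y \<le> pi"
  shows "(integral {x..y} f)\<^sup>2 \<le> (y - x) * integral {0..pi} (\<lambda>x. (f x)\<^sup>2)"
proof (cases "x = y")
  case True
  then show ?thesis by simp
next
  case False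
  then have d: "y - x > 0" using xy by simp
  have sub: "{x..y} \<subseteq> {0..pi}" using xy by auto
  have i0: "(\<lambda>x. (f x)\<^sup>2) integrable_on {0..pi}"
    using L2_square_integrable[OF f] by (simp add: integrable_leb0_iff absolutely_integrable_on_def)
  note i1 = integrable_on_subinterval[OF i0 sub] and i2 = integrable_on_subinterval[OF L2_integrable_on[OF f] sub]
  define m where "m = integral {x..y} f / (y - x)"
  have "0 \<le> integral {x..y} (\<lambda>s. (f s - m)\<^sup>2)"
    by (rule integral_nonneg_everywhere) simp
  also have "integral {x..y} (\<lambda>s. (f s - m)\<^sup>2) = integral {x..y} (\<lambda>s. ((f s)\<^sup>2 - (2 * m) * f s) + m\<^sup>2)"
    by (rule integral_cong) (simp add: power2_diff)
  also have "\<dots> = integral {x..y} (\<lambda>s. (f s)\<^sup>2) - 2 * m * integral {x..y} f + m\<^sup>2 * (y - x)"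
    using i1 i2 integrable_on_mult_right[OF i2, of "2 * m"] xy
    by (subst integral_add) (auto intro!: integrable_diff simp: integral_diff)
  finally have "0 \<le> integral {x..y} (\<lambda>s. (f s)\<^sup>2) - 2 * m * integral {x..y} f + m\<^sup>2 * (y - x)" .
  moreover have "m * (y - x) = integral {x..y} f" using d by (simp add: m_def)
  then have "2 * m * integral {x..y} f - m\<^sup>2 * (y - x) = m * integral {x..y} f"
    by (simp add: power2_eq_square algebra_simps)
  ultimately have "m * integral {x..y} f \<le> integral {x..y} (\<lambda>s. (f s)\<^sup>2)" by simp
  also have "\<dots> \<le> integral {0..pi} (\<lambda>s. (f s)\<^sup>2)"
    by (rule integral_subset_le[OF sub i1 i0]) simp
  finally have "(y - x) * (m * integral {x..y} f) \<le> (y - x) * integral {0..pi} (\<lambda>s. (f s)\<^sup>2)"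
    using d by (intro mult_left_mono) auto
  moreover have "(y - x) * (m * integral {x..y} f) = (integral {x..y} f)\<^sup>2"
    using d by (simp add: m_def power2_eq_square)
  ultimately show ?thesis by simp
qed

lemma L2_square_integrable_on: "f \<in> L2 \<Longrightarrow> (\<lambda>x. (f x)\<^sup>2) integrable_on {0..pi}"
  using L2_square_integrable by (simp add: integrable_leb0_iff absolutely_integrable_on_def)

lemma L2_mult_integrable_on: "f \<in> L2 \<Longrightarrow> g \<in> L2 \<Longrightarrow> (\<lambda>x. f x * g x) integrable_on {0..pi}"
  using L2_mult_integrable[of f g] by (simp add: integrable_leb0_iff absolutely_integrable_on_def)

lemma L2_square_integral_nonneg: "0 \<le> integral {0..pi} (\<lambda>x. (f x)\<^sup>2)" for f :: "real \<Rightarrow> real"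
  by (rule integral_nonneg_everywhere) simp

lemma L2_norm_eq: "f \<in> L2 \<Longrightarrow> L2_norm f = sqrt (integral {0..pi} (\<lambda>x. (f x)\<^sup>2))"
  unfolding L2_norm_def by (subst integral_leb0) (auto intro: L2_square_integrable)

lemma integral_square_add_scale:
  assumes f: "f \<in> L2" and g: "g \<in> L2"
  shows "integral {0..pi} (\<lambda>x. (f x + t * g x)\<^sup>2)
    = integral {0..pi} (\<lambda>x. (f x)\<^sup>2) + 2 * t * integral {0..pi} (\<lambda>x. f x * g x) + t\<^sup>2 * integral {0..pi} (\<lambda>x. (g x)\<^sup>2)"
proof -
  have "integral {0..pi} (\<lambda>x. (f x + t * g x)\<^sup>2)
      = integral {0..pi} (\<lambda>x. ((f x)\<^sup>2 + 2 * t * (f x * g x)) + t\<^sup>2 * (g x)\<^sup>2)"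
    by (rule integral_cong) (simp add: power2_sum power_mult_distrib)
  also have "\<dots> = integral {0..pi} (\<lambda>x. (f x)\<^sup>2) + 2 * t * integral {0..pi} (\<lambda>x. f x * g x) + t\<^sup>2 * integral {0..pi} (\<lambda>x. (g x)\<^sup>2)"
    using L2_square_integrable_on[OF f] integrable_on_mult_right[OF L2_mult_integrable_on[OF f g], of "2 * t"]
      integrable_on_mult_right[OF L2_square_integrable_on[OF g], of "t\<^sup>2"]
    by (subst integral_add, (auto intro!: integrable_add)[2], subst integral_add) auto
  finally show ?thesis .
qed

lemma L2_parallelogram:
  assumes f: "f \<in> L2" and g: "g \<in> L2"
  shows "integral {0..pi} (\<lambda>x. (f x - g x)\<^sup>2)
    = 2 * integral {0..pi} (\<lambda>x. (f x)\<^sup>2) + 2 * integral {0..pi} (\<lambda>x. (g x)\<^sup>2)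
      - 4 * integral {0..pi} (\<lambda>x. (1 / 2 * (f x + g x))\<^sup>2)"
proof -
  have "integral {0..pi} (\<lambda>x. (1 / 2 * (f x + g x))\<^sup>2) = integral {0..pi} (\<lambda>x. 1 / 4 * (f x + 1 * g x)\<^sup>2)"
    by (rule integral_cong) (simp add: power2_eq_square)
  then have "integral {0..pi} (\<lambda>x. (1 / 2 * (f x + g x))\<^sup>2) = 1 / 4 * integral {0..pi} (\<lambda>x. (f x + 1 * g x)\<^sup>2)"
    by simp
  then show ?thesis
    using integral_square_add_scale[OF f g, of 1] integral_square_add_scale[OF f g, of "-1"] by simp
qed

lemma fatou_square:
  fixes f :: "nat \<Rightarrow> 'a \<Rightarrow> real"
  assumes f: "\<And>i. f i \<in> borel_measurable M" and g: "g \<in> borel_measurable M"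
    and int: "\<And>i. integrable M (\<lambda>x. (f i x)\<^sup>2)"
    and bound: "\<And>i. (LINT x|M. (f i x)\<^sup>2) \<le> B"
    and lim: "AE x in M. (\<lambda>i. f i x) \<longlonglongrightarrow> g x"
  shows "integrable M (\<lambda>x. (g x)\<^sup>2)" "(LINT x|M. (g x)\<^sup>2) \<le> B"
proof -
  have B: "0 \<le> B" using bound[of 0] by (rule order_trans[rotated]) (rule integral_nonneg_AE, simp)
  have "(\<integral>\<^sup>+x. ennreal ((g x)\<^sup>2) \<partial>M) = (\<integral>\<^sup>+x. liminf (\<lambda>i. ennreal ((f i x)\<^sup>2)) \<partial>M)"
  proof (rule nn_integral_cong_AE, rule AE_mp[OF lim], rule AE_I2, rule impI)
    fix x assume "(\<lambda>i. f i x) \<longlonglongrightarrow> g x"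
    then have "(\<lambda>i. ennreal ((f i x)\<^sup>2)) \<longlonglongrightarrow> ennreal ((g x)\<^sup>2)" by (intro tendsto_intros tendsto_ennrealI)
    from lim_imp_Liminf[OF _ this] show "ennreal ((g x)\<^sup>2) = liminf (\<lambda>i. ennreal ((f i x)\<^sup>2))" by simp
  qed
  also have "\<dots> \<le> liminf (\<lambda>i. \<integral>\<^sup>+x. ennreal ((f i x)\<^sup>2) \<partial>M)"
    using f by (intro nn_integral_liminf) measurable
  also have "\<dots> \<le> liminf (\<lambda>i::nat. ennreal B)"
  proof (rule Liminf_mono, rule always_eventually, rule allI)
    fix i
    have "(\<integral>\<^sup>+x. ennreal ((f i x)\<^sup>2) \<partial>M) = ennreal (LINT x|M. (f i x)\<^sup>2)"
      by (rule nn_integral_eq_integral[OF int]) simp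
    then show "(\<integral>\<^sup>+x. ennreal ((f i x)\<^sup>2) \<partial>M) \<le> ennreal B" using bound[of i] by (simp add: ennreal_leI)
  qed
  also have "\<dots> = ennreal B" by (simp add: Liminf_const)
  finally have le: "(\<integral>\<^sup>+x. ennreal ((g x)\<^sup>2) \<partial>M) \<le> ennreal B" .
  show i: "integrable M (\<lambda>x. (g x)\<^sup>2)"
  proof (rule integrableI_bounded)
    show "(\<lambda>x. (g x)\<^sup>2) \<in> borel_measurable M" using g by measurable
    show "(\<integral>\<^sup>+x. ennreal (norm ((g x)\<^sup>2)) \<partial>M) < \<infinity>"
      using le by (simp add: order_le_less_trans[OF le])
  qed
  have "ennreal (LINT x|M. (g x)\<^sup>2) \<le> ennreal B"
    using le nn_integral_eq_integral[OF i] by simp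
  then show "(LINT x|M. (g x)\<^sup>2) \<le> B" using B by (simp add: ennreal_le_iff)
qed

text \<open>On a bounded interval a Cauchy sequence for the square norm is Cauchy for the integral
  norm, so a subsequence converges almost everywhere; Fatou's lemma carries bounds on tails over to
  the limit.\<close>

lemma L2_complete:
  assumes g: "\<And>n. g n \<in> L2"
    and cauchy: "\<And>e. e > 0 \<Longrightarrow> \<exists>N. \<forall>i\<ge>N. \<forall>j\<ge>N. integral {0..pi} (\<lambda>x. (g i x - g j x)\<^sup>2) \<le> e"
  obtains h where "h \<in> L2"
    "(\<lambda>n. integral {0..pi} (\<lambda>x. (g n x - h x)\<^sup>2)) \<longlonglongrightarrow> 0"
    "\<And>N B. (\<And>n. n \<ge> N \<Longrightarrow> integral {0..pi} (\<lambda>x. (g n x)\<^sup>2) \<le> B) \<Longrightarrow> integral {0..pi} (\<lambda>x. (h x)\<^sup>2) \<le> B"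
proof -
  have L1: "\<exists>N. \<forall>i\<ge>N. \<forall>j\<ge>N. (LINT x|leb0. norm (g i x - g j x)) < e" if e: "e > 0" for e
  proof -
    \<comment> \<open>Cauchy-Schwarz on an interval of length \<open>pi\<close> turns this bound
      into half of \<open>e^2\<close>.\<close>
    obtain N where N: "\<And>i j. i \<ge> N \<Longrightarrow> j \<ge> N \<Longrightarrow> integral {0..pi} (\<lambda>x. (g i x - g j x)\<^sup>2) \<le> e\<^sup>2 / (2 * pi)"
      using cauchy[of "e\<^sup>2 / (2 * pi)"] e by auto
    have "(LINT x|leb0. norm (g i x - g j x)) < e" if "i \<ge> N" "j \<ge> N" for i j
    proof -
      have d: "(\<lambda>x. g i x - g j x) \<in> L2" by (intro L2_diff g)
      have ad: "(\<lambda>x. \<bar>g i x - g j x\<bar>) \<in> L2"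
        using L2_measurable[OF d] L2_square_integrable[OF d] by (intro L2_I borel_measurable_abs) simp_all
      have eq: "(LINT x|leb0. norm (g i x - g j x)) = integral {0..pi} (\<lambda>x. \<bar>g i x - g j x\<bar>)"
        using integral_leb0[OF L2_integrable[OF ad]] by simp
      have "(integral {0..pi} (\<lambda>x. \<bar>g i x - g j x\<bar>))\<^sup>2 \<le> pi * integral {0..pi} (\<lambda>x. (g i x - g j x)\<^sup>2)"
        using integral_square_le[OF ad, of 0 pi] by simp
      moreover have "pi * integral {0..pi} (\<lambda>x. (g i x - g j x)\<^sup>2) \<le> pi * (e\<^sup>2 / (2 * pi))"
        by (intro mult_left_mono N that) auto
      moreover have "pi * (e\<^sup>2 / (2 * pi)) < e\<^sup>2" using e by simp
      ultimately have "(LINT x|leb0. norm (g i x - g j x))\<^sup>2 < e\<^sup>2" unfolding eq by linarith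
      then show ?thesis using e by (intro power2_less_imp_less[of _ e]) auto
    qed
    then show ?thesis by blast
  qed
  obtain r where r: "strict_mono r" and ae: "AE x in leb0. Cauchy (\<lambda>i. g (r i) x)"
    using cauchy_L1_AE_cauchy_subseq[of leb0 g, OF L2_integrable[OF g] L1] by blast
  define h where "h x = lim (\<lambda>i. g (r i) x)" for x
  have hm: "h \<in> borel_measurable leb0"
    unfolding h_def[abs_def] by (intro borel_measurable_lim_metric L2_measurable g)
  have lim: "AE x in leb0. (\<lambda>i. g (r i) x) \<longlonglongrightarrow> h x"
    using ae unfolding h_def
    by eventually_elim (simp add: Cauchy_convergent_iff convergent_LIMSEQ_iff)
  have rge: "r i \<ge> i" for i using r by (rule seq_suble)
  \<comment> \<open>General enough for three uses: \<open>g N1 - h\<close> lies in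
    \<open>L2\<close>, \<open>g n - h\<close> is small, and (with \<open>f = 0\<close>) bounds on
    the \<open>g n\<close> pass to \<open>h\<close>.\<close>
  have bound: "(\<lambda>x. c * f x + d * h x) \<in> L2 \<and> integral {0..pi} (\<lambda>x. (c * f x + d * h x)\<^sup>2) \<le> B"
    if f: "f \<in> L2" and B: "\<And>n. n \<ge> N \<Longrightarrow> integral {0..pi} (\<lambda>x. (c * f x + d * g n x)\<^sup>2) \<le> B" for f c d B N
  proof -
    have gL: "(\<lambda>x. c * f x + d * g n x) \<in> L2" for n by (intro L2_add L2_scale f g)
    have m: "(\<lambda>x. c * f x + d * h x) \<in> borel_measurable leb0"
      using hm L2_measurable[OF f] by measurable
    have "AE x in leb0. (\<lambda>i. c * f x + d * g (r (i + N)) x) \<longlonglongrightarrow> c * f x + d * h x"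
      using lim by eventually_elim (intro tendsto_intros LIMSEQ_ignore_initial_segment[of "\<lambda>i. g (r i) _"])
    note F = fatou_square[OF L2_measurable[OF gL] m L2_square_integrable[OF gL] _ this, of B]
    have le: "(LINT x|leb0. (c * f x + d * g (r (i + N)) x)\<^sup>2) \<le> B" for i
      unfolding integral_leb0[OF L2_square_integrable[OF gL]] using rge[of "i + N"] by (intro B) auto
    note F = F[OF le]
    have "(\<lambda>x. c * f x + d * h x) \<in> L2" by (rule L2_I[OF m F(1)])
    then show ?thesis using F(2) integral_leb0[OF F(1)] by simp
  qed
  obtain N1 where N1: "\<And>i j. i \<ge> N1 \<Longrightarrow> j \<ge> N1 \<Longrightarrow> integral {0..pi} (\<lambda>x. (g i x - g j x)\<^sup>2) \<le> 1"
    using cauchy[of 1] by auto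
  have diffL: "(\<lambda>x. g N1 x - h x) \<in> L2"
    using bound[OF g, of N1 1 N1 "-1" 1] N1 by simp
  have "(\<lambda>x. g N1 x - (g N1 x - h x)) \<in> L2" by (rule L2_diff[OF g diffL])
  then have hL: "h \<in> L2" by simp
  show ?thesis
  proof (rule that[OF hL])
    show "(\<lambda>n. integral {0..pi} (\<lambda>x. (g n x - h x)\<^sup>2)) \<longlonglongrightarrow> 0"
    proof (rule LIMSEQ_I)
      fix e :: real assume e: "e > 0"
      obtain N where N: "\<And>i j. i \<ge> N \<Longrightarrow> j \<ge> N \<Longrightarrow> integral {0..pi} (\<lambda>x. (g i x - g j x)\<^sup>2) \<le> e / 2"
        using cauchy[of "e / 2"] e by auto
      have "norm (integral {0..pi} (\<lambda>x. (g n x - h x)\<^sup>2) - 0) < e" if "n \<ge> N" for n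
      proof -
        have "integral {0..pi} (\<lambda>x. (g n x - h x)\<^sup>2) \<le> e / 2"
          using bound[OF g, of N 1 n "-1" "e / 2"] N[OF that] by simp
        then show ?thesis using e L2_square_integral_nonneg[of "\<lambda>x. g n x - h x"] by simp
      qed
      then show "\<exists>N. \<forall>n\<ge>N. norm (integral {0..pi} (\<lambda>x. (g n x - h x)\<^sup>2) - 0) < e" by blast
    qed
    show "integral {0..pi} (\<lambda>x. (h x)\<^sup>2) \<le> B"
      if "\<And>n. n \<ge> N \<Longrightarrow> integral {0..pi} (\<lambda>x. (g n x)\<^sup>2) \<le> B" for N B
      using bound[OF L2_const[of 0], of N 0 1 B] that by simp
  qed
qed

text \<open>Among the functions whose primitive is uniformly \<open>\<epsilon>\<close>-close to the uniform limit \<open>J\<close> of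
  the primitives, those of almost minimal norm form, by the parallelogram law, a Cauchy family as
  \<open>\<epsilon>\<close> tends to zero; their limit has primitive \<open>J\<close>.\<close>

theorem L2_primitives_compact:
  assumes f: "\<And>n. f n \<in> L2" and d: "(\<lambda>n. integral {0..pi} (\<lambda>x. (f n x)\<^sup>2)) \<longlonglongrightarrow> d"
  obtains g \<sigma> where "g \<in> L2" "strict_mono (\<sigma> :: nat \<Rightarrow> nat)" "integral {0..pi} (\<lambda>x. (g x)\<^sup>2) \<le> d"
    "uniform_limit {0..pi} (\<lambda>n x. integral {0..x} (f (\<sigma> n))) (\<lambda>x. integral {0..x} g) sequentially"
proof -
  define nsq where "nsq h = integral {0..pi} (\<lambda>x. (h x)\<^sup>2)" for h :: "real \<Rightarrow> real"
  have nsq0: "nsq h \<ge> 0" for h unfolding nsq_def by (rule L2_square_integral_nonneg)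
  obtain B where B: "B > 0" "\<And>n. nsq (f n) \<le> B"
    using convergent_imp_Bseq[OF convergentI[OF d]] unfolding Bseq_def nsq_def by (auto simp: abs_le_iff)
  have hol: "(integral {0..y} h - integral {0..x} h)\<^sup>2 \<le> \<bar>y - x\<bar> * nsq h"
    if h: "h \<in> L2" and xy: "x \<in> {0..pi}" "y \<in> {0..pi}" for h x y
  proof -
    have comb: "integral {0..y} h - integral {0..x} h = integral {x..y} h"
      if "x \<in> {0..pi}" "y \<in> {0..pi}" "x \<le> y" for x y
      using Henstock_Kurzweil_Integration.integral_combine[of 0 x y h]
        integrable_on_subinterval[OF L2_integrable_on[OF h], of 0 y] that by auto
    show ?thesis
    proof (cases "x \<le> y")
      case True
      then show ?thesis
        using integral_square_le[OF h, of x y] comb[OF xy True] xy by (simp add: nsq_def)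
    next
      case False
      then show ?thesis
        using integral_square_le[OF h, of y x] comb[OF xy(2,1)] xy
        by (simp add: nsq_def power2_commute[of "integral {0..y} h"])
    qed
  qed
  have abs_le: "\<bar>integral {0..y} h - integral {0..x} h\<bar> \<le> sqrt (\<bar>y - x\<bar> * nsq h)"
    if "h \<in> L2" "x \<in> {0..pi}" "y \<in> {0..pi}" for h x y
    using hol[OF that] by (rule real_le_rsqrt[of "\<bar>_\<bar>", simplified])
  have abs_le0: "\<bar>integral {0..y} h\<bar> \<le> sqrt (pi * nsq h)" if "h \<in> L2" "y \<in> {0..pi}" for h y
  proof -
    have "\<bar>integral {0..y} h\<bar> \<le> sqrt (\<bar>y - 0\<bar> * nsq h)" using abs_le[OF that(1) _ that(2), of 0] by simp
    also have "\<dots> \<le> sqrt (pi * nsq h)" using that nsq0 by (intro real_sqrt_le_mono mult_right_mono) auto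
    finally show ?thesis .
  qed
  obtain J \<sigma> where cJ: "continuous_on {0..pi} J" and \<sigma>: "strict_mono (\<sigma> :: nat \<Rightarrow> nat)"
    and J: "\<And>e. 0 < e \<Longrightarrow> \<exists>N. \<forall>n x. n \<ge> N \<and> x \<in> {0..pi} \<longrightarrow> norm (integral {0..x} (f (\<sigma> n)) - J x) < e"
  proof (rule Arzela_Ascoli[of "{0..pi}" "\<lambda>n x. integral {0..x} (f n)" "sqrt (pi * B)"])
    show "norm (integral {0..x} (f n)) \<le> sqrt (pi * B)" if "x \<in> {0..pi}" for n x
      using order_trans[OF abs_le0[OF f that] real_sqrt_le_mono[OF mult_left_mono[OF B(2)]]] by simp
    fix x e :: real assume x: "x \<in> {0..pi}" and e: "0 < e"
    show "\<exists>d>0. \<forall>n y. y \<in> {0..pi} \<and> norm (x - y) < d \<longrightarrow> norm (integral {0..x} (f n) - integral {0..y} (f n)) < e"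
    \<comment> \<open>The Hoelder estimate has the constant \<open>B\<close> for all
      \<open>n\<close>, hence a modulus of equicontinuity independent of \<open>n\<close>.\<close>
    proof (intro exI[of _ "e\<^sup>2 / B"] conjI allI impI)
      show "0 < e\<^sup>2 / B" using e B by simp
      fix n y assume y: "y \<in> {0..pi} \<and> norm (x - y) < e\<^sup>2 / B"
      have "(integral {0..x} (f n) - integral {0..y} (f n))\<^sup>2 \<le> \<bar>x - y\<bar> * nsq (f n)"
        using hol[OF f, of y x n] x y by simp
      also have "\<dots> \<le> \<bar>x - y\<bar> * B" by (intro mult_left_mono B) simp
      also have "\<dots> < e\<^sup>2" using y B by (simp add: field_simps)
      finally show "norm (integral {0..x} (f n) - integral {0..y} (f n)) < e"
        using e abs_le_square_iff[of e "integral {0..x} (f n) - integral {0..y} (f n)"] by simp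
    qed
  qed auto
  \<comment> \<open>For \<open>e > 0\<close>, \<open>A e\<close> contains a tail of the subsequence,
    so its infimal square norm \<open>m e\<close> is at most \<open>d\<close>. Along
    \<open>\<epsilon>\<close> the sets shrink and \<open>m\<close> increases, hence
    converges.\<close>
  define A where "A e = {h \<in> L2. \<forall>x\<in>{0..pi}. \<bar>integral {0..x} h - J x\<bar> \<le> e}" for e :: real
  define m where "m e = Inf (nsq ` A e)" for e
  define \<epsilon> where "\<epsilon> j = 1 / real (Suc j)" for j :: nat
  have \<epsilon>: "\<epsilon> j > 0" for j by (simp add: \<epsilon>_def)
  have \<epsilon>_mono: "\<epsilon> j \<le> \<epsilon> i" if "i \<le> j" for i j using that by (simp add: \<epsilon>_def frac_le)
  have \<epsilon>_lim: "\<epsilon> \<longlonglongrightarrow> 0" unfolding \<epsilon>_def by (rule LIMSEQ_Suc[OF lim_1_over_n])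
  have bdd: "bdd_below (nsq ` A e)" for e using nsq0 by (intro bdd_belowI[of _ 0]) auto
  have ne: "\<exists>N. \<forall>n\<ge>N. f (\<sigma> n) \<in> A e" if e: "e > 0" for e
  proof -
    obtain N where N: "\<And>n x. n \<ge> N \<Longrightarrow> x \<in> {0..pi} \<Longrightarrow> norm (integral {0..x} (f (\<sigma> n)) - J x) < e"
      using J[OF e] by blast
    have "f (\<sigma> n) \<in> A e" if n: "n \<ge> N" for n
      unfolding A_def
    proof (intro CollectI conjI ballI f)
      fix x assume "x \<in> {0..pi}"
      from N[OF n this] show "\<bar>integral {0..x} (f (\<sigma> n)) - J x\<bar> \<le> e" by simp
    qed
    then show ?thesis by blast
  qed
  have m_le: "m e \<le> nsq h" if "h \<in> A e" for e h
    unfolding m_def using that by (intro cInf_lower bdd) auto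
  have m_d: "m e \<le> d" if e: "e > 0" for e
  proof -
    obtain N where N: "\<And>n. n \<ge> N \<Longrightarrow> f (\<sigma> n) \<in> A e" using ne[OF e] by auto
    have "(\<lambda>n. nsq (f (\<sigma> n))) \<longlonglongrightarrow> d"
      using LIMSEQ_subseq_LIMSEQ[OF d \<sigma>] by (simp add: o_def nsq_def)
    then show ?thesis by (rule LIMSEQ_le_const) (use m_le[OF N] in blast)
  qed
  have m_mono: "m (\<epsilon> i) \<le> m (\<epsilon> j)" if "i \<le> j" for i j
    unfolding m_def
  proof (rule cInf_superset_mono)
    show "nsq ` A (\<epsilon> j) \<noteq> {}" using ne[OF \<epsilon>[of j]] by auto
    show "nsq ` A (\<epsilon> j) \<subseteq> nsq ` A (\<epsilon> i)"
    proof (intro image_mono subsetI)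
      fix h assume "h \<in> A (\<epsilon> j)"
      then show "h \<in> A (\<epsilon> i)" unfolding A_def using order_trans[OF _ \<epsilon>_mono[OF that]] by blast
    qed
  qed (rule bdd)
  have "\<exists>h\<in>A (\<epsilon> j). nsq h < m (\<epsilon> j) + \<epsilon> j" for j
  proof -
    have "nsq ` A (\<epsilon> j) \<noteq> {}" using ne[OF \<epsilon>[of j]] by auto
    then have "\<exists>z\<in>nsq ` A (\<epsilon> j). z < m (\<epsilon> j) + \<epsilon> j"
      using cInf_lessD[of "nsq ` A (\<epsilon> j)" "m (\<epsilon> j) + \<epsilon> j"] \<epsilon>[of j] unfolding m_def by auto
    then show ?thesis by auto
  qed
  then obtain g where g: "\<And>j. g j \<in> A (\<epsilon> j)" "\<And>j. nsq (g j) < m (\<epsilon> j) + \<epsilon> j" by metis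
  have gL: "g j \<in> L2" for j using g(1) unfolding A_def by blast
  have "incseq (\<lambda>j. m (\<epsilon> j))" using m_mono by (auto simp: incseq_def)
  then obtain l where l: "(\<lambda>j. m (\<epsilon> j)) \<longlonglongrightarrow> l" "\<And>j. m (\<epsilon> j) \<le> l"
    using incseq_convergent[of "\<lambda>j. m (\<epsilon> j)" d] m_d[OF \<epsilon>] by blast
  \<comment> \<open>The midpoint of \<open>g i\<close> and \<open>g j\<close> still lies in
    \<open>A (\<epsilon> i)\<close>, so its square norm is at least \<open>m (\<epsilon> i)\<close>;
    the parallelogram law then leaves little room for the difference.\<close>
  have diff_le: "nsq (\<lambda>x. g i x - g j x) \<le> 2 * (l - m (\<epsilon> i)) + 4 * \<epsilon> i" if ij: "i \<le> j" for i j
  proof -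
    have "(\<lambda>x. 1 / 2 * (g i x + g j x)) \<in> A (\<epsilon> i)"
      unfolding A_def
    proof (intro CollectI conjI ballI)
      show "(\<lambda>x. 1 / 2 * (g i x + g j x)) \<in> L2" by (intro L2_scale L2_add gL)
      fix x assume x: "x \<in> {0..pi}"
      have int: "g i integrable_on {0..x}" for i
        using integrable_on_subinterval[OF L2_integrable_on[OF gL]] x by auto
      have eq: "integral {0..x} (\<lambda>x. 1 / 2 * (g i x + g j x)) = 1 / 2 * (integral {0..x} (g i) + integral {0..x} (g j))"
        using integral_add[OF int int, of i j] by simp
      have "\<bar>integral {0..x} (g i) - J x\<bar> \<le> \<epsilon> i" "\<bar>integral {0..x} (g j) - J x\<bar> \<le> \<epsilon> j"
        using g(1) x unfolding A_def by blast+
      then show "\<bar>integral {0..x} (\<lambda>x. 1 / 2 * (g i x + g j x)) - J x\<bar> \<le> \<epsilon> i"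
        unfolding eq abs_le_iff using \<epsilon>_mono[OF ij] by argo
    qed
    then have "m (\<epsilon> i) \<le> nsq (\<lambda>x. 1 / 2 * (g i x + g j x))" by (rule m_le)
    moreover define z where "z = nsq (\<lambda>x. 1 / 2 * (g i x + g j x))"
    moreover have "nsq (\<lambda>x. g i x - g j x) = 2 * nsq (g i) + 2 * nsq (g j) - 4 * z"
      unfolding nsq_def z_def by (rule L2_parallelogram[OF gL gL])
    ultimately show ?thesis
      unfolding z_def[symmetric] using g(2)[of i] g(2)[of j] l(2)[of j] \<epsilon>_mono[OF ij] by argo
  qed
  have small: "(\<lambda>i. 2 * (l - m (\<epsilon> i)) + 4 * \<epsilon> i) \<longlonglongrightarrow> 0"
  proof -
    have "(\<lambda>i. 2 * (l - m (\<epsilon> i)) + 4 * \<epsilon> i) \<longlonglongrightarrow> 2 * (l - l) + 4 * 0"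
      by (intro tendsto_intros l \<epsilon>_lim)
    then show ?thesis by simp
  qed
  have cauchy: "\<exists>N. \<forall>i\<ge>N. \<forall>j\<ge>N. integral {0..pi} (\<lambda>x. (g i x - g j x)\<^sup>2) \<le> e" if e: "e > 0" for e
  proof -
    obtain N where N: "\<And>i. i \<ge> N \<Longrightarrow> 2 * (l - m (\<epsilon> i)) + 4 * \<epsilon> i < e"
      using order_tendstoD(2)[OF small e] by (auto simp: eventually_sequentially)
    have "nsq (\<lambda>x. g i x - g j x) \<le> e" if "i \<ge> N" "j \<ge> N" for i j
    proof (cases "i \<le> j")
      case True
      then show ?thesis using diff_le[OF True] N[OF that(1)] by linarith
    next
      case False
      have "nsq (\<lambda>x. g i x - g j x) = nsq (\<lambda>x. g j x - g i x)" unfolding nsq_def by (simp add: power2_commute)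
      then show ?thesis using diff_le[of j i] False N[OF that(2)] by linarith
    qed
    then show ?thesis unfolding nsq_def by blast
  qed
  obtain h where h: "h \<in> L2" and conv: "(\<lambda>n. nsq (\<lambda>x. g n x - h x)) \<longlonglongrightarrow> 0"
    and hB: "\<And>N B. (\<And>n. n \<ge> N \<Longrightarrow> nsq (g n) \<le> B) \<Longrightarrow> nsq h \<le> B"
    using L2_complete[OF gL cauchy] unfolding nsq_def by blast
  have "nsq h \<le> d + \<epsilon> N" for N
  proof (rule hB)
    show "nsq (g n) \<le> d + \<epsilon> N" if "n \<ge> N" for n
      using g(2)[of n] m_d[OF \<epsilon>[of n]] \<epsilon>_mono[OF that] by linarith
  qed
  moreover have "(\<lambda>N. d + \<epsilon> N) \<longlonglongrightarrow> d + 0" by (intro tendsto_intros \<epsilon>_lim)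
  ultimately have hd: "nsq h \<le> d" using LIMSEQ_le_const[of "\<lambda>N. d + \<epsilon> N" "d + 0" "nsq h"] by simp
  \<comment> \<open>The primitive at \<open>x\<close> is controlled by the square norm, and that of
    \<open>g n\<close> is within \<open>\<epsilon> n\<close> of \<open>J x\<close>.\<close>
  have hJ: "integral {0..x} h = J x" if x: "x \<in> {0..pi}" for x
  proof -
    have le: "\<bar>integral {0..x} h - J x\<bar> \<le> sqrt (pi * nsq (\<lambda>x. g n x - h x)) + \<epsilon> n" for n
    proof -
      have int: "k integrable_on {0..x}" if "k \<in> L2" for k
        using integrable_on_subinterval[OF L2_integrable_on[OF that]] x by auto
      have "\<bar>integral {0..x} (\<lambda>x. g n x - h x)\<bar> \<le> sqrt (pi * nsq (\<lambda>x. g n x - h x))"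
        by (rule abs_le0[OF L2_diff[OF gL h] x])
      moreover have "integral {0..x} (\<lambda>x. g n x - h x) = integral {0..x} (g n) - integral {0..x} h"
        by (rule integral_diff[OF int[OF gL] int[OF h]])
      moreover have "\<bar>integral {0..x} (g n) - J x\<bar> \<le> \<epsilon> n" using g(1) x unfolding A_def by blast
      ultimately show ?thesis by linarith
    qed
    have "(\<lambda>n. sqrt (pi * nsq (\<lambda>x. g n x - h x)) + \<epsilon> n) \<longlonglongrightarrow> sqrt (pi * 0) + 0"
      by (intro tendsto_intros conv \<epsilon>_lim)
    then have "\<bar>integral {0..x} h - J x\<bar> \<le> sqrt (pi * 0) + 0"
      by (rule LIMSEQ_le_const) (use le in blast)
    then show ?thesis by simp
  qed
  show ?thesis
  proof (rule that[OF h \<sigma>])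
    show "integral {0..pi} (\<lambda>x. (h x)\<^sup>2) \<le> d" using hd by (simp add: nsq_def)
    show "uniform_limit {0..pi} (\<lambda>n x. integral {0..x} (f (\<sigma> n))) (\<lambda>x. integral {0..x} h) sequentially"
    proof (rule uniform_limitI)
      fix e :: real assume "e > 0"
      from J[OF this] obtain N where N: "\<And>n x. n \<ge> N \<Longrightarrow> x \<in> {0..pi} \<Longrightarrow> norm (integral {0..x} (f (\<sigma> n)) - J x) < e"
        by blast
      show "\<forall>\<^sub>F n in sequentially. \<forall>x\<in>{0..pi}. dist (integral {0..x} (f (\<sigma> n))) (integral {0..x} h) < e"
        by (rule eventually_sequentiallyI[of N]) (use N hJ in \<open>simp add: dist_norm\<close>)
    qed
  qed
qed

section \<open>The inverse optimization problem\<close>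

lemma sl_prim_eq:
  assumes q: "q \<in> L2" and x: "x \<in> {0..pi}"
  shows "sl_prim q x = x * sl_mean q - integral {0..x} q"
proof -
  have "q integrable_on {0..x}"
    using integrable_on_subinterval[OF L2_integrable_on[OF q]] x by auto
  then show ?thesis unfolding sl_prim_def using x by (subst integral_diff) auto
qed

lemma sl_mean_shift: "q \<in> L2 \<Longrightarrow> sl_mean (\<lambda>x. q x + c) = sl_mean q + c"
  using L2_integrable_on[of q] L2_integrable_on[OF L2_const[of c]]
  unfolding sl_mean_def by (subst integral_add) (simp_all add: field_simps)

lemma sl_prim_shift: "q \<in> L2 \<Longrightarrow> sl_prim (\<lambda>x. q x + c) = sl_prim q"
  unfolding sl_prim_def[abs_def] by (simp add: sl_mean_shift)

lemma W22_scale: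
  assumes W: "W22 u u' u''"
  shows "W22 (\<lambda>x. r * u x) (\<lambda>x. r * u' x) (\<lambda>x. r * u'' x)"
proof -
  have du: "\<forall>x\<in>{0..pi}. (u has_real_derivative u' x) (at x within {0..pi})" and L: "u'' \<in> L2"
    and eq: "\<forall>x\<in>{0..pi}. u' x = u' 0 + (LINT t|lebesgue_on {0..x}. u'' t)"
    using W unfolding W22_def by blast+
  have "r * u' x = r * u' 0 + (LINT t|lebesgue_on {0..x}. r * u'' t)" if "x \<in> {0..pi}" for x
    using bspec[OF eq that] by (simp add: distrib_left)
  then show ?thesis
    unfolding W22_def using du L2_scale[OF L] by (blast intro: DERIV_cmult)
qed

lemma L2_AE_zero:
  assumes f: "f \<in> L2" and "integral {0..pi} (\<lambda>x. (f x)\<^sup>2) = 0"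
  shows "AE x in leb0. f x = 0"
proof -
  have "integral\<^sup>L leb0 (\<lambda>x. (f x)\<^sup>2) = 0" using assms integral_leb0[OF L2_square_integrable[OF f]] by simp
  then have "AE x in leb0. (f x)\<^sup>2 = 0"
    by (subst (asm) integral_nonneg_eq_0_iff_AE[OF L2_square_integrable[OF f]]) auto
  then show ?thesis by simp
qed

context sl_bc
begin

text \<open>A constant changes the mean and leaves \<open>sl_prim\<close> alone. This is the device
  that restores the constraint.\<close>

lemma SL_eigenvalue_shift:
  assumes "q \<in> L2" "k \<ge> 1"
  shows "SL_eigenvalue \<alpha> k (\<lambda>x. q x + c) = SL_eigenvalue \<alpha> k q + c"
  using assms by (simp add: SL_eigenvalue_eq L2_add L2_const sl_mean_shift sl_prim_shift)

lemma SL_eigenvalue_tendsto: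
  assumes q: "q \<in> L2" and p: "\<And>n. p n \<in> L2" and k: "k \<ge> 1"
    and lim: "uniform_limit {0..pi} (\<lambda>n x. integral {0..x} (p n)) (\<lambda>x. integral {0..x} q) F"
  shows "((\<lambda>n. SL_eigenvalue \<alpha> k (p n)) \<longlongrightarrow> SL_eigenvalue \<alpha> k q) F"
proof -
  have mean: "((\<lambda>n. sl_mean (p n)) \<longlongrightarrow> sl_mean q) F"
    unfolding sl_mean_def by (intro tendsto_intros tendsto_uniform_limitI[OF lim]) auto
  have "uniform_limit {0..pi} (\<lambda>n x. x * sl_mean (p n) - integral {0..x} (p n)) (\<lambda>x. x * sl_mean q - integral {0..x} q) F"
    by (intro uniform_limit_minus uniform_limit_times_continuous uniform_limit_const
        uniform_limit_const_seq mean lim continuous_intros)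
  then have "uniform_limit {0..pi} (\<lambda>n. sl_prim (p n)) (sl_prim q) F"
    by (subst uniform_limit_cong'[where g = "\<lambda>n x. x * sl_mean (p n) - integral {0..x} (p n)"
        and i = "\<lambda>x. x * sl_mean q - integral {0..x} q"]) (auto simp: sl_prim_eq p q)
  then show ?thesis
    unfolding SL_eigenvalue_eq[OF q k] SL_eigenvalue_eq[OF p k]
    by (intro tendsto_add mean ev_tendsto sl_prim_continuous p q)
qed

text \<open>Direct method: for a minimizing sequence the differences from \<open>q0\<close> have,
  along a subsequence, uniformly convergent primitives. The limit has no larger norm, and the
  constraint survives because eigenvalues depend continuously on primitives.\<close>

lemma inverse_opt_solution_exists:
  assumes q0: "q0 \<in> L2" and k: "k \<ge> 1"
  shows "\<exists>qh. inverse_opt_solution \<alpha> k q0 lam qh"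
proof -
  define S where "S = {L2_norm (\<lambda>x. q0 x - q x) |q. q \<in> L2 \<and> SL_eigenvalue \<alpha> k q = lam}"
  have norm_ge: "0 \<le> L2_norm f" for f by (simp add: L2_norm_def integral_nonneg_AE)
  have bdd: "bdd_below S" unfolding S_def using norm_ge by (intro bdd_belowI[of _ 0]) auto
  \<comment> \<open>Shifting \<open>q0\<close> by the missing constant gives an admissible
    potential, so the infimum is over a non-empty set.\<close>
  have "L2_norm (\<lambda>x. q0 x - (q0 x + (lam - SL_eigenvalue \<alpha> k q0))) \<in> S"
    unfolding S_def using SL_eigenvalue_shift[OF q0 k] L2_add[OF q0 L2_const] by fastforce
  then have ne: "S \<noteq> {}" by blast
  define d where "d = Inf S"
  have d0: "d \<ge> 0" unfolding d_def using ne norm_ge by (intro cInf_greatest) (auto simp: S_def)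
  have "\<exists>q. q \<in> L2 \<and> SL_eigenvalue \<alpha> k q = lam \<and> L2_norm (\<lambda>x. q0 x - q x) < d + 1 / real (Suc n)" for n
  proof -
    have "\<exists>z\<in>S. z < d + 1 / real (Suc n)"
      using cInf_lessD[OF ne, of "d + 1 / real (Suc n)"] unfolding d_def by auto
    then show ?thesis unfolding S_def by auto
  qed
  then obtain p where p: "\<And>n. p n \<in> L2" "\<And>n. SL_eigenvalue \<alpha> k (p n) = lam"
    and pd: "\<And>n. L2_norm (\<lambda>x. q0 x - p n x) < d + 1 / real (Suc n)" by metis
  define f where "f n = (\<lambda>x. q0 x - p n x)" for n
  have fL: "f n \<in> L2" for n unfolding f_def by (intro L2_diff q0 p)
  have "(\<lambda>n. L2_norm (f n)) \<longlonglongrightarrow> d"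
  proof (rule tendsto_sandwich)
    show "\<forall>\<^sub>F n in sequentially. d \<le> L2_norm (f n)"
      unfolding d_def f_def by (intro always_eventually allI cInf_lower bdd) (auto simp: S_def p)
    show "\<forall>\<^sub>F n in sequentially. L2_norm (f n) \<le> d + 1 / real (Suc n)"
      unfolding f_def by (intro always_eventually allI less_imp_le pd)
    have "(\<lambda>n. d + 1 / real (Suc n)) \<longlonglongrightarrow> d + 0"
      by (intro tendsto_add tendsto_const LIMSEQ_Suc[OF lim_1_over_n])
    then show "(\<lambda>n. d + 1 / real (Suc n)) \<longlonglongrightarrow> d" by simp
  qed simp
  then have "(\<lambda>n. (L2_norm (f n))\<^sup>2) \<longlonglongrightarrow> d\<^sup>2" by (intro tendsto_intros)
  then have "(\<lambda>n. integral {0..pi} (\<lambda>x. (f n x)\<^sup>2)) \<longlonglongrightarrow> d\<^sup>2"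
    by (simp add: L2_norm_eq[OF fL] L2_square_integral_nonneg)
  from L2_primitives_compact[of f, OF fL this]
  obtain g \<sigma> where g: "g \<in> L2" and gd: "integral {0..pi} (\<lambda>x. (g x)\<^sup>2) \<le> d\<^sup>2"
    and lim: "uniform_limit {0..pi} (\<lambda>n x. integral {0..x} (f (\<sigma> n))) (\<lambda>x. integral {0..x} g) sequentially"
    by blast
  define qh where "qh = (\<lambda>x. q0 x - g x)"
  have qh: "qh \<in> L2" unfolding qh_def by (intro L2_diff q0 g)
  have int: "integral {0..x} (\<lambda>t. q0 t - h t) = integral {0..x} q0 - integral {0..x} h"
    if "h \<in> L2" "x \<in> {0..pi}" for h x
    using that q0 by (intro integral_diff integrable_on_subinterval[OF L2_integrable_on]) auto
  have pf: "p n = (\<lambda>x. q0 x - f n x)" for n by (simp add: f_def)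
  have "uniform_limit {0..pi} (\<lambda>n x. integral {0..x} q0 - integral {0..x} (f (\<sigma> n)))
      (\<lambda>x. integral {0..x} q0 - integral {0..x} g) sequentially"
    by (intro uniform_limit_minus uniform_limit_const lim)
  then have "uniform_limit {0..pi} (\<lambda>n x. integral {0..x} (p (\<sigma> n))) (\<lambda>x. integral {0..x} qh) sequentially"
    by (subst uniform_limit_cong'[where g = "\<lambda>n x. integral {0..x} q0 - integral {0..x} (f (\<sigma> n))"
        and i = "\<lambda>x. integral {0..x} q0 - integral {0..x} g"]) (simp_all add: pf qh_def int fL g)
  then have "(\<lambda>n. SL_eigenvalue \<alpha> k (p (\<sigma> n))) \<longlonglongrightarrow> SL_eigenvalue \<alpha> k qh"
    by (intro SL_eigenvalue_tendsto qh p k)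
  then have ev: "SL_eigenvalue \<alpha> k qh = lam" unfolding p(2) by (simp add: LIMSEQ_const_iff)
  have "L2_norm (\<lambda>x. q0 x - qh x) = sqrt (integral {0..pi} (\<lambda>x. (g x)\<^sup>2))"
    unfolding qh_def by (simp add: L2_norm_eq[OF g])
  also have "\<dots> \<le> d" using gd d0 by (intro real_le_lsqrt)
  finally have "L2_norm (\<lambda>x. q0 x - qh x) \<le> d" .
  moreover have "d \<le> L2_norm (\<lambda>x. q0 x - qh x)"
    unfolding d_def by (intro cInf_lower bdd) (auto simp: S_def qh ev)
  ultimately have "inverse_opt_solution \<alpha> k q0 lam qh"
    unfolding inverse_opt_solution_def S_def[symmetric] d_def[symmetric] using qh ev by simp
  then show ?thesis by blast
qed

lemma inverse_opt_solution_le: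
  assumes "inverse_opt_solution \<alpha> k q0 lam qh" "q \<in> L2" "SL_eigenvalue \<alpha> k q = lam"
  shows "L2_norm (\<lambda>x. q0 x - qh x) \<le> L2_norm (\<lambda>x. q0 x - q x)"
proof -
  have "bdd_below {L2_norm (\<lambda>x. q0 x - q x) |q. q \<in> L2 \<and> SL_eigenvalue \<alpha> k q = lam}"
    by (rule bdd_belowI[of _ 0]) (auto simp: L2_norm_def intro!: integral_nonneg_AE)
  then have "Inf {L2_norm (\<lambda>x. q0 x - q x) |q. q \<in> L2 \<and> SL_eigenvalue \<alpha> k q = lam} \<le> L2_norm (\<lambda>x. q0 x - q x)"
    using assms by (intro cInf_lower) auto
  then show ?thesis using assms(1) unfolding inverse_opt_solution_def by simp
qed

text \<open>Move \<open>qh\<close> in the direction \<open>h\<close>, the component of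
  \<open>q0 - qh\<close> orthogonal to the squared eigenfunction. The eigenvalue is stationary
  there, so the constant that restores the constraint is of lower order and minimality forces the
  integral of \<open>(q0 - qh) h\<close>, which is that of \<open>h^2\<close>, to vanish. Only
  minimality enters, so every minimizer is covered.\<close>

lemma inverse_opt_solution_proportional:
  assumes q0: "q0 \<in> L2" and k: "k \<ge> 1" and sol: "inverse_opt_solution \<alpha> k q0 lam qh"
  shows "\<exists>c. AE x in leb0. q0 x - qh x = c * (eigfun k qh x)\<^sup>2"
proof -
  have qh: "qh \<in> L2" and ev: "SL_eigenvalue \<alpha> k qh = lam"
    using sol unfolding inverse_opt_solution_def by blast+
  define w where "w x = (eigfun k qh x)\<^sup>2" for x
  have cw: "continuous_on {0..pi} w" unfolding w_def by (intro continuous_intros eigfun_continuous[OF qh])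
  have wL: "w \<in> L2" by (rule continuous_imp_L2[OF cw])
  have ww: "integral {0..pi} (\<lambda>x. (w x)\<^sup>2) \<noteq> 0"
  proof -
    have "continuous_on {0..pi} (\<lambda>x. (w x)\<^sup>2)" by (intro continuous_intros cw)
    note iff = integral_eq_0_iff[OF this]
    obtain x where "x \<in> {0<..<pi}" "w x \<noteq> 0" using eigfun_nonzero[OF qh k] by (auto simp: w_def)
    then show ?thesis by (subst iff) (auto intro: bexI[of _ x])
  qed
  define p where "p = (\<lambda>x. q0 x - qh x)"
  have pL: "p \<in> L2" unfolding p_def by (intro L2_diff q0 qh)
  \<comment> \<open>Coefficient of the orthogonal projection of \<open>q0 - qh\<close> on
    \<open>w\<close>.\<close>
  define c where "c = integral {0..pi} (\<lambda>x. p x * w x) / integral {0..pi} (\<lambda>x. (w x)\<^sup>2)"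
  define h where "h = (\<lambda>x. p x + (- c) * w x)"
  have hL: "h \<in> L2" unfolding h_def by (intro L2_add L2_scale pL wL)
  have hw: "integral {0..pi} (\<lambda>x. h x * w x) = 0"
  proof -
    have "integral {0..pi} (\<lambda>x. h x * w x) = integral {0..pi} (\<lambda>x. p x * w x + (- c) * (w x)\<^sup>2)"
      unfolding h_def by (rule integral_cong) (simp add: power2_eq_square algebra_simps)
    also have "\<dots> = integral {0..pi} (\<lambda>x. p x * w x) + (- c) * integral {0..pi} (\<lambda>x. (w x)\<^sup>2)"
      using L2_mult_integrable_on[OF pL wL] integrable_on_mult_right[OF L2_square_integrable_on[OF wL], of "-c"]
      by (subst integral_add) auto
    also have "\<dots> = 0" using ww by (simp add: c_def)
    finally show ?thesis .
  qed
  \<comment> \<open>The constant that brings \<open>qh + t h\<close> back to eigenvalue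
    \<open>lam\<close>; it vanishes to first order at 0.\<close>
  define s where "s t = lam - SL_eigenvalue \<alpha> k (\<lambda>x. qh x + t * h x)" for t
  have s0: "s 0 = 0" by (simp add: s_def ev)
  have "((\<lambda>t. SL_eigenvalue \<alpha> k (\<lambda>x. qh x + t * h x)) has_real_derivative 0) (at 0)"
    using SL_eigenvalue_has_derivative_0[OF qh hL k] hw by (simp add: w_def)
  then have ds: "(s has_real_derivative 0) (at 0)"
    unfolding s_def[abs_def] by (auto intro!: derivative_eq_intros)
  define I1 where "I1 = integral {0..pi} p"
  define Ih where "Ih = integral {0..pi} h"
  define Iph where "Iph = integral {0..pi} (\<lambda>x. p x * h x)"
  define Ihh where "Ihh = integral {0..pi} (\<lambda>x. (h x)\<^sup>2)"
  \<comment> \<open>Increase of the squared distance to \<open>q0\<close> when \<open>qh\<close> is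
    replaced by the admissible \<open>qh + t h + s t\<close>; it has a minimum at 0.\<close>
  define G where "G t = t\<^sup>2 * Ihh + 2 * t * s t * Ih + (s t)\<^sup>2 * pi - 2 * t * Iph - 2 * s t * I1" for t
  have G0: "0 \<le> G t" for t
  proof -
    define r where "r = (\<lambda>x. s t + t * h x)"
    have rL: "r \<in> L2" unfolding r_def by (intro L2_add L2_const L2_scale hL)
    have qt: "(\<lambda>x. qh x + t * h x) \<in> L2" by (intro L2_add L2_scale qh hL)
    have "SL_eigenvalue \<alpha> k (\<lambda>x. qh x + t * h x + s t) = lam"
      unfolding SL_eigenvalue_shift[OF qt k] by (simp add: s_def)
    from inverse_opt_solution_le[OF sol L2_add[OF qt L2_const] this]
    have "L2_norm p \<le> L2_norm (\<lambda>x. p x + (- 1) * r x)"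
      by (simp add: p_def r_def algebra_simps)
    then have "integral {0..pi} (\<lambda>x. (p x)\<^sup>2) \<le> integral {0..pi} (\<lambda>x. (p x + (- 1) * r x)\<^sup>2)"
      using L2_norm_eq[OF pL] L2_norm_eq[OF L2_add[OF pL L2_scale[OF rL, of "-1"]]] by simp
    also have "\<dots> = integral {0..pi} (\<lambda>x. (p x)\<^sup>2) + 2 * (- 1) * integral {0..pi} (\<lambda>x. p x * r x)
        + (- 1)\<^sup>2 * integral {0..pi} (\<lambda>x. (r x)\<^sup>2)"
      by (rule integral_square_add_scale[OF pL rL])
    finally have "0 \<le> integral {0..pi} (\<lambda>x. (r x)\<^sup>2) - 2 * integral {0..pi} (\<lambda>x. p x * r x)" by simp
    moreover have "integral {0..pi} (\<lambda>x. (r x)\<^sup>2) = (s t)\<^sup>2 * pi + 2 * t * (s t * Ih) + t\<^sup>2 * Ihh"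
      unfolding r_def Ih_def Ihh_def
      using integral_square_add_scale[OF L2_const[of "s t"] hL, of t] by simp
    moreover have "integral {0..pi} (\<lambda>x. p x * r x) = s t * I1 + t * Iph"
    proof -
      have "integral {0..pi} (\<lambda>x. p x * r x) = integral {0..pi} (\<lambda>x. s t * p x + t * (p x * h x))"
        unfolding r_def by (rule integral_cong) (simp add: algebra_simps)
      also have "\<dots> = s t * I1 + t * Iph"
        unfolding I1_def Iph_def
        using integrable_on_mult_right[OF L2_integrable_on[OF pL], of "s t"]
          integrable_on_mult_right[OF L2_mult_integrable_on[OF pL hL], of t]
        by (subst integral_add) auto
      finally show ?thesis .
    qed
    ultimately show ?thesis unfolding G_def by (simp add: algebra_simps)
  qed
  have "(G has_real_derivative - 2 * Iph) (at 0)"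
    unfolding G_def[abs_def] by (rule derivative_eq_intros ds refl | simp add: s0)+
  then have Iph: "- 2 * Iph = 0"
    by (rule DERIV_local_min[where d = 1]) (use G0 in \<open>auto simp: G_def s0\<close>)
  \<comment> \<open>Replacing one factor \<open>h\<close> by \<open>p - c w\<close> costs nothing,
    since \<open>h\<close> is orthogonal to \<open>w\<close>.\<close>
  have "integral {0..pi} (\<lambda>x. (h x)\<^sup>2) = integral {0..pi} (\<lambda>x. p x * h x + (- c) * (h x * w x))"
    by (rule integral_cong) (simp add: h_def power2_eq_square algebra_simps)
  also have "\<dots> = Iph + (- c) * integral {0..pi} (\<lambda>x. h x * w x)"
    unfolding Iph_def
    using L2_mult_integrable_on[OF pL hL] integrable_on_mult_right[OF L2_mult_integrable_on[OF hL wL], of "-c"]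
    by (subst integral_add) auto
  finally have "integral {0..pi} (\<lambda>x. (h x)\<^sup>2) = 0" using Iph hw by simp
  from L2_AE_zero[OF hL this] have "AE x in leb0. q0 x - qh x = c * (eigfun k qh x)\<^sup>2"
    by eventually_elim (simp add: h_def p_def w_def)
  then show ?thesis by blast
qed

text \<open>The direction is \<open>c\<close> times a square, so at every point of the segment the
  derivative is \<open>c\<close> times a nonnegative number.\<close>

lemma SL_eigenvalue_monotone_direction:
  assumes q: "q \<in> L2" and p: "p \<in> L2" and k: "k \<ge> 1"
    and w: "continuous_on {0..pi} w" and eq: "AE x in leb0. p x = c * (w x)\<^sup>2"
  shows "c \<le> 0 \<Longrightarrow> SL_eigenvalue \<alpha> k (\<lambda>x. q x + p x) \<le> SL_eigenvalue \<alpha> k q"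
    and "c \<ge> 0 \<Longrightarrow> SL_eigenvalue \<alpha> k (\<lambda>x. q x + p x) \<ge> SL_eigenvalue \<alpha> k q"
proof -
  define \<Lambda> where "\<Lambda> t = SL_eigenvalue \<alpha> k (\<lambda>x. q x + t * p x)" for t
  have d: "\<exists>D. (\<Lambda> has_real_derivative D) (at t) \<and> (c \<le> 0 \<longrightarrow> D \<le> 0) \<and> (c \<ge> 0 \<longrightarrow> D \<ge> 0)" for t
  proof -
    have qt: "(\<lambda>x. q x + t * p x) \<in> L2" by (intro L2_add L2_scale q p)
    define u where "u = eigfun k (\<lambda>x. q x + t * p x)"
    have cu: "continuous_on {0..pi} u" unfolding u_def by (rule eigfun_continuous[OF qt])
    define I where "I = integral {0..pi} (\<lambda>x. (w x)\<^sup>2 * (u x)\<^sup>2)"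
    have I: "I \<ge> 0" unfolding I_def by (rule integral_nonneg_everywhere) simp
    have "integral {0..pi} (\<lambda>x. p x * (u x)\<^sup>2) = integral {0..pi} (\<lambda>x. c * ((w x)\<^sup>2 * (u x)\<^sup>2))"
      by (rule integral_cong_AE_leb0, use eq in eventually_elim) simp_all
    also have "\<dots> = c * I" unfolding I_def by simp
    finally have e: "integral {0..pi} (\<lambda>x. p x * (u x)\<^sup>2) = c * I" .
    have U: "integral {0..pi} (\<lambda>x. (u x)\<^sup>2) > 0"
      unfolding u_def by (rule eigfun_square_integral_pos[OF qt k])
    have "(\<Lambda> has_real_derivative c * I / integral {0..pi} (\<lambda>x. (u x)\<^sup>2)) (at t)"
      unfolding \<Lambda>_def[abs_def] e[symmetric] unfolding u_def by (rule SL_eigenvalue_has_derivative[OF q p k])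
    then show ?thesis using I U
      by (intro exI[of _ "c * I / integral {0..pi} (\<lambda>x. (u x)\<^sup>2)"])
        (auto intro: divide_nonpos_pos divide_nonneg_pos mult_nonpos_nonneg)
  qed
  show "SL_eigenvalue \<alpha> k (\<lambda>x. q x + p x) \<le> SL_eigenvalue \<alpha> k q" if "c \<le> 0"
  proof -
    have "\<Lambda> 1 \<le> \<Lambda> 0" by (rule DERIV_nonpos_imp_nonincreasing) (use d that in auto)
    then show ?thesis by (simp add: \<Lambda>_def)
  qed
  show "SL_eigenvalue \<alpha> k (\<lambda>x. q x + p x) \<ge> SL_eigenvalue \<alpha> k q" if "c \<ge> 0"
  proof -
    have "\<Lambda> 0 \<le> \<Lambda> 1" by (rule DERIV_nonneg_imp_nondecreasing) (use d that in auto)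
    then show ?thesis by (simp add: \<Lambda>_def)
  qed
qed

text \<open>If \<open>\<delta> * u^2 = q0 - qh\<close> for a multiple \<open>u\<close> of the
  eigenfunction of \<open>qh\<close>, then the linear equation with potential \<open>qh\<close> is
  the cubic one with potential \<open>q0\<close>. Scaling keeps the zeros, whose number is known for
  the k-th eigenfunction.\<close>

lemma inverse_opt_solution_NP:
  assumes q0: "q0 \<in> L2" and k: "k \<ge> 1" and sol: "inverse_opt_solution \<alpha> k q0 lam qh"
    and \<delta>: "(lam < SL_eigenvalue \<alpha> k q0 \<and> \<delta> = 1) \<or> (lam > SL_eigenvalue \<alpha> k q0 \<and> \<delta> = -1)"
  shows "\<exists>u. NP_solution \<alpha> q0 lam \<delta> u \<and> nonzero u \<and>
    (AE x in leb0. qh x = q0 x - \<delta> * (u x)\<^sup>2) \<and>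
    finite {x \<in> {0<..<pi}. u x = 0} \<and> card {x \<in> {0<..<pi}. u x = 0} = k - 1"
proof -
  have qh: "qh \<in> L2" and ev: "SL_eigenvalue \<alpha> k qh = lam"
    using sol unfolding inverse_opt_solution_def by blast+
  define \<phi> where "\<phi> = eigfun k qh"
  obtain c where c: "AE x in leb0. q0 x - qh x = c * (\<phi> x)\<^sup>2"
    using inverse_opt_solution_proportional[OF q0 k sol] unfolding \<phi>_def by blast
  have "continuous_on {0..pi} \<phi>" unfolding \<phi>_def by (rule eigfun_continuous[OF qh])
  from SL_eigenvalue_monotone_direction[OF qh L2_diff[OF q0 qh] k this c]
  have "c \<le> 0 \<Longrightarrow> SL_eigenvalue \<alpha> k q0 \<le> lam" "c \<ge> 0 \<Longrightarrow> SL_eigenvalue \<alpha> k q0 \<ge> lam"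
    by (simp_all add: ev)
  \<comment> \<open>A zero coefficient, or one of the wrong sign, would put the eigenvalue of
    \<open>q0\<close> on the wrong side of \<open>lam\<close> or on it.\<close>
  with \<delta> have \<delta>c: "\<delta> * c > 0" and \<delta>2: "\<delta> * \<delta> = 1"
    by (smt (verit) mult_minus1 mult_cancel_right2 mult_minus_left)+
  \<comment> \<open>The scale that gives
    \<open>\<delta> * (r * \<phi> x)^2 = c * (\<phi> x)^2\<close>.\<close>
  define r where "r = sqrt (\<delta> * c)"
  have r: "r > 0" and r2: "\<delta> * r\<^sup>2 = c"
    using \<delta>c \<delta>2 by (simp_all add: r_def mult.assoc[symmetric])
  define u where "u x = r * \<phi> x" for x
  define \<phi>' where "\<phi>' = (\<lambda>x. eigfun_v k qh x - sl_prim qh x * \<phi> x)"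
  define \<phi>'' where "\<phi>'' = (\<lambda>x. (qh x - lam) * \<phi> x)"
  have lam: "sl_mean qh + ev k (sl_prim qh) = lam" using SL_eigenvalue_eq[OF qh k] ev by simp
  have W: "W22 \<phi> \<phi>' \<phi>''" and B: "separated_bc \<alpha> \<phi> \<phi>'"
    using eigfun_eigenfunction(1,2)[OF qh k] unfolding \<phi>_def \<phi>'_def \<phi>''_def lam by blast+
  have "W22 u (\<lambda>x. r * \<phi>' x) (\<lambda>x. r * \<phi>'' x)" unfolding u_def[abs_def] by (rule W22_scale[OF W])
  moreover have "separated_bc \<alpha> u (\<lambda>x. r * \<phi>' x)"
    using B unfolding separated_bc_def u_def by (simp add: mult.assoc flip: distrib_left)
  moreover have eq: "AE x in leb0. qh x = q0 x - \<delta> * (u x)\<^sup>2"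
    using c
  proof eventually_elim
    case (elim x)
    have "\<delta> * (u x)\<^sup>2 = c * (\<phi> x)\<^sup>2" unfolding u_def power_mult_distrib r2[symmetric] by simp
    then show ?case using elim by simp
  qed
  moreover have "AE x in leb0. - (r * \<phi>'' x) + q0 x * u x = lam * u x + \<delta> * (u x) ^ 3"
    using eq
  proof eventually_elim
    case (elim x)
    have "r * \<phi>'' x = (q0 x - \<delta> * (u x)\<^sup>2 - lam) * u x" unfolding \<phi>''_def elim by (simp add: u_def)
    then show ?case by (simp add: power2_eq_square power3_eq_cube algebra_simps)
  qed
  ultimately have "NP_solution \<alpha> q0 lam \<delta> u" unfolding NP_solution_def by blast
  moreover have zero: "u x = 0 \<longleftrightarrow> \<phi> x = 0" for x using r by (simp add: u_def)
  moreover have "nonzero u"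
    using eigfun_nonzero[OF qh k] unfolding nonzero_def zero \<phi>_def by force
  ultimately show ?thesis
    using eq eigfun_zeros[OF qh k] unfolding \<phi>_def by auto
qed

end

text \<open>The initial angle is \<open>- \<alpha>\<close> reduced modulo \<open>pi\<close>.\<close>

lemma sl_bc_exists: "\<exists>a b. sl_bc \<alpha> a b"
proof -
  define n where "n = \<lceil>\<alpha> / pi\<rceil>"
  define a where "a = of_int n * pi - \<alpha>"
  have "\<alpha> / pi \<le> of_int n" "of_int n < \<alpha> / pi + 1" unfolding n_def by linarith+
  then have "\<alpha> \<le> of_int n * pi" "of_int n * pi < \<alpha> + pi" by (simp_all add: field_simps)
  then have "0 \<le> a" "a < pi" "sin (a + \<alpha>) = 0" by (auto simp: a_def sin_zero_iff_int2)
  then have "sl_bc \<alpha> a (if a > 0 then a else pi)" by unfold_locales auto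
  then show ?thesis by blast
qed

theorem theorem1:
  fixes \<alpha> lam :: real and q0 :: "real \<Rightarrow> real" and k :: nat
  assumes "q0 \<in> L2" and "k \<ge> 1"
  shows "(\<exists>qh. inverse_opt_solution \<alpha> k q0 lam qh) \<and>
    (\<forall>qh. inverse_opt_solution \<alpha> k q0 lam qh \<longrightarrow>
      (\<forall>\<delta>. (lam < SL_eigenvalue \<alpha> k q0 \<and> \<delta> = 1) \<or> (lam > SL_eigenvalue \<alpha> k q0 \<and> \<delta> = -1) \<longrightarrow>
        (\<exists>u. NP_solution \<alpha> q0 lam \<delta> u \<and> nonzero u \<and>
          (AE x in lebesgue_on {0<..<pi}. qh x = q0 x - \<delta> * (u x)\<^sup>2) \<and>
          finite {x \<in> {0<..<pi}. u x = 0} \<and>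
          card {x \<in> {0<..<pi}. u x = 0} = k - 1)))"
proof -
  obtain a b where "sl_bc \<alpha> a b" using sl_bc_exists by blast
  then interpret sl_bc \<alpha> a b .
  show ?thesis
    using inverse_opt_solution_exists[OF assms] inverse_opt_solution_NP[OF assms] by blast
qed

end
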